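(* Fix $\ell\in\frac12\mathbb{N}$. For $d\in\mathbb{N}$ define the matrices (indexed by $\{-\ell,\dots,\ell\}$) $$A_d=\sum_{k=-\ell}^{\ell}\left|a^{\zeta(d,k)}_{\zeta(d+1,k),\ell}\right|^2E_{k,k},\qquad B_d=\sum_{k=-\ell}^{\ell}\left(\left|a^{\zeta(d,k)}_{\zeta(d,k+1),\ell}\right|^2E_{k,k+1}+\left|a^{\zeta(d,k)}_{\zeta(d,k-1),\ell}\right|^2E_{k,k-1}\right),$$ $$C_d=\sum_{k=-\ell}^{\ell}\left|a^{\zeta(d,k)}_{\zeta(d-1,k),\ell}\right|^2E_{k,k}.$$ Then for all $d\in\mathbb{N}$ and $a\in A_*$ $$\varphi(a)\,\Phi^\ell_d(a)=A_d\Phi^\ell_{d+1}(a)+B_d\Phi^\ell_d(a)+C_d\Phi^\ell_{d-1}(a),$$ and similarly $$\varphi(a)\,Q^\ell_d(a)=A_dQ^\ell_{d+1}(a)+B_dQ^\ell_d(a)+C_dQ^\ell_{d-1}(a).$$ Moreover $A_d\in\mathrm{GL}_{2\ell+1}(\mathbb{R})$.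
   Context: $\mathbb{N}=\{0,1,2,\dots\}$. $K=\mathrm{SU}(2)$, $U=K\times K$. $m_t=\mathrm{diag}(e^{it/2},e^{-it/2})$, $a_t=(m_t,m_{-t})\in U$, $A_*=\{a_t:0\le t<4\pi\}$. For $\ell\in\frac12\mathbb{N}$, $H^\ell=\mathbb{C}[x,y]_{2\ell}$ with $K$ acting by $T^\ell(k)p=p\circ k^t$ and orthonormal basis $\psi^\ell_j=\binom{2\ell}{\ell-j}^{1/2}x^{\ell-j}y^{\ell+j}$, $j=-\ell,\dots,\ell$; endomorphisms are written as matrices in this basis. For $(\ell_1,\ell_2)$ with $|\ell_1-\ell_2|\le\ell\le\ell_1+\ell_2$, $\ell_1+\ell_2-\ell\in\mathbb{Z}$, let $\beta^{\ell_1,\ell_2}_\ell:H^\ell\to H^{\ell_1}\otimes H^{\ell_2}$, $\psi^\ell_j\mapsto\sum_{j_1,j_2}C^{\ell_1,\ell_2,\ell}_{j_1,j_2,j}\psi^{\ell_1}_{j_1}\otimes\psi^{\ell_2}_{j_2}$ ($C$ = standard Clebsch-Gordan coefficients, zero unless $j_1+j_2=j$), and $\Phi^\ell_{\ell_1,\ell_2}(x)=(\beta^{\ell_1,\ell_2}_\ell)^*\circ T^{\ell_1,\ell_2}(x)\circ\beta^{\ell_1,\ell_2}_\ell$ for $x\in U$, where $T^{\ell_1,\ell_2}$ is the outer tensor product representation. On $A_*$: $(\Phi^\ell_{\ell_1,\ell_2}(a_t))_{j,j}=\sum_{j_1,j_2}e^{i(j_2-j_1)t}(C^{\ell_1,\ell_2,\ell}_{j_1,j_2,j})^2$,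 off-diagonal entries being $0$. $\varphi=\Phi^0_{\frac12,\frac12}$ (so $\varphi(a_t)=\cos t$). With $\zeta(d,k)=\left(\frac{d+\ell+k}{2},\frac{d+\ell-k}{2}\right)$, the full spherical function is $(\Phi^\ell_d(a))_{p,q}=(\Phi^\ell_{\zeta(d,p)}(a))_{q,q}$, $p,q\in\{-\ell,\dots,\ell\}$, $a\in A_*$. $\Phi^\ell_0(a_t)$ is invertible for $t\notin\pi\mathbb{Z}$; the full spherical polynomial is $Q^\ell_d(a)=\Phi^\ell_d(a)(\Phi^\ell_0(a))^{-1}$ there; its entries are polynomials in $\cos t$, so it extends to all of $A_*$. Convention: $\Phi^\ell_{-1}=Q^\ell_{-1}=0$ and $C_0=0$. $E_{i,j}$ is the elementary matrix with a single $1$ at position $(i,j)$, and is $0$ if $|i|>\ell$ or $|j|>\ell$ (those terms are omitted). The numbers $a$ are $$a^{(\ell_1,\ell_2)}_{(m_1,m_2),\ell}=\sum_{j_1,j_2,i_1,i_2,n_1,n_2}C^{\ell_1,\ell_2,\ell}_{j_1,j_2,\ell}C^{\frac12,\frac12,0}_{i_1,i_2,0}C^{\ell_1,\frac12,m_1}_{j_1,i_1,n_1}C^{\ell_2,\frac12,m_2}_{j_2,i_2,n_2}C^{m_1,m_2,\ell}_{n_1,n_2,\ell},$$ summed over $|j_1|\le\ell_1$, $|j_2|\le\ell_2$, $|i_1|,|i_2|\le\frac12$, $|n_1|\le m_1$, $|n_2|\le m_2$ (steps of $1$). *)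

theory Defs
  imports
    Complex_Main
    "HOL-Computational_Algebra.Polynomial"
    "Jordan_Normal_Form.Schur_Decomposition"
begin

section \<open>Half-integral spins and weights\<close>

text \<open>
  Spins and weights are real numbers; a spin \<open>l\<close> is half-integral if \<open>2 * l \<in> \<nat>\<close>.
  Matrices with rows and columns labelled by the weights \<open>-l, ..., l\<close> are matrices of
  size \<open>2l+1\<close> whose row (column) number \<open>r\<close> carries the weight \<open>wt l r = r - l\<close>.
\<close>

definition weights :: "real \<Rightarrow> real set" where
  "weights l = {j. \<bar>j\<bar> \<le> l \<and> l - j \<in> \<int>}"

definition dimH :: "real \<Rightarrow> nat" where
  "dimH l = nat \<lfloor>2 * l\<rfloor> + 1"

definition wt :: "real \<Rightarrow> nat \<Rightarrow> real" where
  "wt l r = real r - l"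

definition wmat :: "real \<Rightarrow> (real \<Rightarrow> real \<Rightarrow> 'a) \<Rightarrow> 'a mat" where
  "wmat l f = mat (dimH l) (dimH l) (\<lambda>(r, s). f (wt l r) (wt l s))"

text \<open>Entry of a weight-indexed matrix at the weights \<open>p, q\<close>.\<close>

definition wentry :: "real \<Rightarrow> 'a mat \<Rightarrow> real \<Rightarrow> real \<Rightarrow> 'a" where
  "wentry l M p q = M $$ (nat \<lfloor>p + l\<rfloor>, nat \<lfloor>q + l\<rfloor>)"

section \<open>The groups and the torus\<close>

definition SU2 :: "complex mat set" where
  "SU2 = {k \<in> carrier_mat 2 2. mat_adjoint k * k = 1\<^sub>m 2 \<and> det k = 1}"

definition m_elt :: "real \<Rightarrow> complex mat" where
  "m_elt t = mat 2 2 (\<lambda>(i, j). if i \<noteq> j then 0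
     else if i = 0 then cis (t / 2) else cis (- t / 2))"

definition a_elt :: "real \<Rightarrow> complex mat \<times> complex mat" where
  "a_elt t = (m_elt t, m_elt (- t))"

definition A_star :: "(complex mat \<times> complex mat) set" where
  "A_star = {a_elt t | t. 0 \<le> t \<and> t < 4 * pi}"

lemma m_elt_in_SU2: "m_elt t \<in> SU2"
proof -
  note m = m_elt_def[of t]
  have c: "m_elt t \<in> carrier_mat 2 2"
    unfolding m by (rule mat_carrier)
  have d: "det (m_elt t) = 1"
  proof -
    have "upper_triangular (m_elt t)"
      by (auto simp: m)
    from det_upper_triangular[OF this c] show ?thesis
      by (simp add: diag_mat_def m numeral_2_eq_2 cis_mult)
  qed
  have "mat_adjoint (m_elt t) * m_elt t = 1\<^sub>m 2"
  proof (rule eq_matI)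
    fix i j :: nat
    assume "i < dim_row (1\<^sub>m 2 :: complex mat)" "j < dim_col (1\<^sub>m 2 :: complex mat)"
    then have ij: "i < 2" "j < 2"
      by auto
    have "mat_adjoint (m_elt t) $$ (i, k) = cnj (m_elt t $$ (k, i))" if "k < 2" for k
      using that ij c by (simp add: mat_adjoint_def mat_of_rows_def)
    then have "(mat_adjoint (m_elt t) * m_elt t) $$ (i, j)
        = (\<Sum>k<2. cnj (m_elt t $$ (k, i)) * m_elt t $$ (k, j))"
      using ij c
      by (simp add: mat_adjoint_def scalar_prod_def lessThan_atLeast0)
    also have "\<dots> = cnj (m_elt t $$ (0, i)) * m_elt t $$ (0, j)
        + cnj (m_elt t $$ (1, i)) * m_elt t $$ (1, j)"
      by (simp add: numeral_2_eq_2)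
    also have "\<dots> = 1\<^sub>m 2 $$ (i, j)"
      using ij by (auto simp: m less_2_cases_iff cis_cnj cis_mult)
    finally show "(mat_adjoint (m_elt t) * m_elt t) $$ (i, j) = 1\<^sub>m 2 $$ (i, j)" .
  qed (use c in \<open>auto simp: mat_adjoint_def mat_of_rows_def\<close>)
  with c d show ?thesis
    by (simp add: SU2_def)
qed

lemma A_star_subset_U: "A_star \<subseteq> SU2 \<times> SU2"
  by (auto simp: A_star_def a_elt_def m_elt_in_SU2)

section \<open>Irreducible representations\<close>

text \<open>
  Elements of \<open>H\<^sup>l\<close> (binary forms of degree \<open>2l\<close>) are represented by the polynomial
  functions they induce on two-component complex vectors \<open>(x, y)\<close>.
\<close>

definition psi :: "real \<Rightarrow> real \<Rightarrow> complex vec \<Rightarrow> complex" where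
  "psi l j v =
     complex_of_real (sqrt (real (nat \<lfloor>2 * l\<rfloor> choose nat \<lfloor>l - j\<rfloor>)))
       * (v $ 0) ^ nat \<lfloor>l - j\<rfloor> * (v $ 1) ^ nat \<lfloor>l + j\<rfloor>"

definition T_act :: "complex mat \<Rightarrow> (complex vec \<Rightarrow> complex) \<Rightarrow> complex vec \<Rightarrow> complex" where
  "T_act k p = (\<lambda>v. p (transpose_mat k *\<^sub>v v))"

text \<open>Coordinates of a form with respect to the basis \<open>psi l j\<close>.\<close>

definition coords :: "real \<Rightarrow> (complex vec \<Rightarrow> complex) \<Rightarrow> real \<Rightarrow> complex" where
  "coords l p = (THE c. (\<forall>j. j \<notin> weights l \<longrightarrow> c j = 0) \<and>
     (\<forall>v \<in> carrier_vec 2. p v = (\<Sum>j\<in>weights l. c j * psi l j v)))"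

definition T_mat :: "real \<Rightarrow> complex mat \<Rightarrow> complex mat" where
  "T_mat l k = wmat l (\<lambda>i j. coords l (T_act k (psi l j)) i)"

text \<open>
  On \<open>H\<^sup>l\<^sup>1 \<otimes> H\<^sup>l\<^sup>2\<close> the basis is \<open>psi l1 j1 \<otimes> psi l2 j2\<close>, ordered lexicographically: row
  number \<open>i\<close> belongs to the pair \<open>(i div n, i mod n)\<close> with \<open>n = dimH l2\<close>.
\<close>

definition kron :: "'a :: times mat \<Rightarrow> 'a mat \<Rightarrow> 'a mat" where
  "kron M N = mat (dim_row M * dim_row N) (dim_col M * dim_col N)
     (\<lambda>(i, j). M $$ (i div dim_row N, j div dim_col N)
               * N $$ (i mod dim_row N, j mod dim_col N))"

definition T_outer :: "real \<Rightarrow> real \<Rightarrow> complex mat \<times> complex mat \<Rightarrow> complex mat" where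
  "T_outer l1 l2 x = kron (T_mat l1 (fst x)) (T_mat l2 (snd x))"

section \<open>Clebsch-Gordan coefficients\<close>

text \<open>
  \<open>CG l1 l2 l j1 j2 j\<close> is \<open>\<langle>l1 j1 l2 j2 | l j\<rangle>\<close> in the Condon-Shortley convention, given by
  Racah's formula; the summation is over those \<open>k\<close> for which all factorial arguments are
  nonnegative.
\<close>

definition CG_triple :: "real \<Rightarrow> real \<Rightarrow> real \<Rightarrow> bool" where
  "CG_triple l1 l2 l \<longleftrightarrow> 2 * l1 \<in> \<nat> \<and> 2 * l2 \<in> \<nat> \<and> 2 * l \<in> \<nat> \<and>
     \<bar>l1 - l2\<bar> \<le> l \<and> l \<le> l1 + l2 \<and> l1 + l2 - l \<in> \<int>"

definition rfact :: "real \<Rightarrow> real" where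
  "rfact x = fact (nat \<lfloor>x\<rfloor>)"

definition CG :: "real \<Rightarrow> real \<Rightarrow> real \<Rightarrow> real \<Rightarrow> real \<Rightarrow> real \<Rightarrow> real" where
  "CG l1 l2 l j1 j2 j =
    (if CG_triple l1 l2 l \<and> j1 \<in> weights l1 \<and> j2 \<in> weights l2 \<and> j \<in> weights l \<and> j1 + j2 = j
     then
       sqrt ((2 * l + 1) * rfact (l + l1 - l2) * rfact (l - l1 + l2) * rfact (l1 + l2 - l)
             / rfact (l1 + l2 + l + 1))
       * sqrt (rfact (l + j) * rfact (l - j) * rfact (l1 - j1) * rfact (l1 + j1)
               * rfact (l2 - j2) * rfact (l2 + j2))
       * (\<Sum>k | real k \<le> l1 + l2 - l \<and> real k \<le> l1 - j1 \<and> real k \<le> l2 + j2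
                 \<and> 0 \<le> l - l2 + j1 + real k \<and> 0 \<le> l - l1 - j2 + real k.
            (-1) ^ k / (fact k * rfact (l1 + l2 - l - real k) * rfact (l1 - j1 - real k)
               * rfact (l2 + j2 - real k) * rfact (l - l2 + j1 + real k)
               * rfact (l - l1 - j2 + real k)))
     else 0)"

definition beta :: "real \<Rightarrow> real \<Rightarrow> real \<Rightarrow> complex mat" where
  "beta l1 l2 l = mat (dimH l1 * dimH l2) (dimH l)
     (\<lambda>(i, r). complex_of_real
        (CG l1 l2 l (wt l1 (i div dimH l2)) (wt l2 (i mod dimH l2)) (wt l r)))"

section \<open>Spherical functions and full spherical polynomials\<close>

definition Phi :: "real \<Rightarrow> real \<Rightarrow> real \<Rightarrow> complex mat \<times> complex mat \<Rightarrow> complex mat" where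
  "Phi l l1 l2 x = mat_adjoint (beta l1 l2 l) * T_outer l1 l2 x * beta l1 l2 l"

text \<open>The scalar spherical function: the only entry of a \<open>1 \<times> 1\<close> matrix.\<close>

definition phi :: "complex mat \<times> complex mat \<Rightarrow> complex" where
  "phi x = wentry 0 (Phi 0 (1/2) (1/2) x) 0 0"

definition zeta :: "real \<Rightarrow> int \<Rightarrow> real \<Rightarrow> real \<times> real" where
  "zeta l d k = ((of_int d + l + k) / 2, (of_int d + l - k) / 2)"

text \<open>The degree is an integer in order to accommodate the value \<open>0\<close> at degree \<open>-1\<close>.\<close>

definition full_Phi :: "real \<Rightarrow> int \<Rightarrow> complex mat \<times> complex mat \<Rightarrow> complex mat" where
  "full_Phi l d a =
    (if d < 0 then 0\<^sub>m (dimH l) (dimH l)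
     else wmat l (\<lambda>p q. case zeta l d p of (l1, l2) \<Rightarrow> wentry l (Phi l l1 l2 a) q q))"

text \<open>
  \<open>Q_poly l d r s\<close> is the polynomial \<open>P\<close> such that \<open>P (cos t)\<close> is the entry \<open>(r, s)\<close> of
  \<open>full_Phi l d (a_elt t) * (full_Phi l 0 (a_elt t))\<^sup>-\<^sup>1\<close> for all \<open>t \<notin> \<pi>\<int>\<close>; evaluating it at
  every \<open>t\<close> extends \<open>Q\<close> to all of \<open>A_star\<close>.
\<close>

definition Q_poly :: "real \<Rightarrow> int \<Rightarrow> nat \<Rightarrow> nat \<Rightarrow> complex poly" where
  "Q_poly l d r s = (THE P. \<forall>t::real. (\<forall>m::int. t \<noteq> of_int m * pi) \<longrightarrow>
     poly P (complex_of_real (cos t)) =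
       (full_Phi l d (a_elt t) * the (mat_inverse (full_Phi l 0 (a_elt t)))) $$ (r, s))"

definition angle :: "complex mat \<times> complex mat \<Rightarrow> real" where
  "angle a = (THE t. 0 \<le> t \<and> t < 4 * pi \<and> a = a_elt t)"

definition full_Q :: "real \<Rightarrow> int \<Rightarrow> complex mat \<times> complex mat \<Rightarrow> complex mat" where
  "full_Q l d a =
    (if d < 0 then 0\<^sub>m (dimH l) (dimH l)
     else mat (dimH l) (dimH l)
       (\<lambda>(r, s). poly (Q_poly l d r s) (complex_of_real (cos (angle a)))))"

section \<open>Recurrence coefficients\<close>

definition a_coeff :: "real \<Rightarrow> real \<times> real \<Rightarrow> real \<times> real \<Rightarrow> real" where
  "a_coeff l L M = (case L of (l1, l2) \<Rightarrow> case M of (m1, m2) \<Rightarrow>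
     (\<Sum>j1\<in>weights l1. \<Sum>j2\<in>weights l2. \<Sum>i1\<in>weights (1/2). \<Sum>i2\<in>weights (1/2).
      \<Sum>n1\<in>weights m1. \<Sum>n2\<in>weights m2.
        CG l1 l2 l j1 j2 l * CG (1/2) (1/2) 0 i1 i2 0
        * CG l1 (1/2) m1 j1 i1 n1 * CG l2 (1/2) m2 j2 i2 n2
        * CG m1 m2 l n1 n2 l))"

text \<open>
  Entry \<open>(p, q)\<close> of the elementary matrix \<open>E\<^sub>i\<^sub>j\<close>. A label \<open>i\<close> or \<open>j\<close> outside \<open>weights l\<close>
  contributes nothing, since \<open>wmat\<close> only evaluates at weights.
\<close>

definition elem :: "real \<Rightarrow> real \<Rightarrow> real \<Rightarrow> real \<Rightarrow> real" where
  "elem i j p q = (if p = i \<and> q = j then 1 else 0)"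

definition rec_A :: "real \<Rightarrow> nat \<Rightarrow> real mat" where
  "rec_A l d = wmat l (\<lambda>p q. \<Sum>k\<in>weights l.
     \<bar>a_coeff l (zeta l (int d) k) (zeta l (int d + 1) k)\<bar>\<^sup>2 * elem k k p q)"

definition rec_B :: "real \<Rightarrow> nat \<Rightarrow> real mat" where
  "rec_B l d = wmat l (\<lambda>p q. \<Sum>k\<in>weights l.
     \<bar>a_coeff l (zeta l (int d) k) (zeta l (int d) (k + 1))\<bar>\<^sup>2 * elem k (k + 1) p q
   + \<bar>a_coeff l (zeta l (int d) k) (zeta l (int d) (k - 1))\<bar>\<^sup>2 * elem k (k - 1) p q)"

definition rec_C :: "real \<Rightarrow> nat \<Rightarrow> real mat" where
  "rec_C l d =
    (if d = 0 then 0\<^sub>m (dimH l) (dimH l)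
     else wmat l (\<lambda>p q. \<Sum>k\<in>weights l.
       \<bar>a_coeff l (zeta l (int d) k) (zeta l (int d - 1) k)\<bar>\<^sup>2 * elem k k p q))"

abbreviation cmat :: "real mat \<Rightarrow> complex mat" where
  "cmat \<equiv> map_mat complex_of_real"

definition GL_real :: "nat \<Rightarrow> real mat set" where
  "GL_real n = {M \<in> carrier_mat n n. invertible_mat M}"

end

theory Submission
  imports Defs "HOL-Computational_Algebra.Formal_Power_Series"
begin

text \<open>
  Tensoring the embedding \<open>H\<^sup>l \<rightarrow> H\<^sup>l\<^sup>1 \<otimes> H\<^sup>l\<^sup>2\<close> with the invariant vector of
  \<open>H\<^sup>1\<^sup>/\<^sup>2 \<otimes> H\<^sup>1\<^sup>/\<^sup>2\<close> and regrouping the four factors gives a \<open>K\<close>-equivariant map into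
  \<open>(H\<^sup>l\<^sup>1 \<otimes> H\<^sup>1\<^sup>/\<^sup>2) \<otimes> (H\<^sup>l\<^sup>2 \<otimes> H\<^sup>1\<^sup>/\<^sup>2)\<close>. This target is the orthogonal sum of the
  \<open>H\<^sup>m\<^sup>1 \<otimes> H\<^sup>m\<^sup>2\<close> with \<open>m1 = l1 \<plusminus> 1/2\<close> and \<open>m2 = l2 \<plusminus> 1/2\<close>, and in each of them \<open>H\<^sup>l\<close>
  occurs at most once. By Schur's lemma the component in \<open>H\<^sup>m\<^sup>1 \<otimes> H\<^sup>m\<^sup>2\<close> is a multiple of
  the embedding of \<open>H\<^sup>l\<close>, and the multiple is \<open>a_coeff\<close>. Taking diagonal
  matrix coefficients of the action of \<open>a_elt t\<close> turns the product of the two spherical functions into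
  the sum of the four spherical functions weighted by the squares of these multiples.

  Everything happens on the torus, so Schur's lemma can be replaced by an
  explicit calculation. For \<open>l1 = (a + b)/2\<close>, \<open>l2 = (a + c)/2\<close>, \<open>l = (b + c)/2\<close> a Clebsch-Gordan
  coefficient is, up to square roots of factorials, a coefficient of
  \<open>(1 - X Y)\<^sup>a (1 + X)\<^sup>b (1 + Y)\<^sup>c\<close> (lemma \<open>CG_eq_cg\<close>). The four coupling
  steps correspond to \<open>a + 1\<close>, \<open>a - 1\<close>, \<open>(b + 1, c - 1)\<close> and \<open>(b - 1, c + 1)\<close>, and
  the proportionality becomes a contiguity relation between these polynomials:
  multiplication by \<open>1 - X Y\<close> in the first case and a differential operator in the
  others (lemmas \<open>bracket_coeff_contig_down_c\<close>, \<open>bracket_coeff_contig_down_a\<close>). The result is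
  \<open>coupled_eq_a_coeff\<close>. The coefficients for coupling with spin one half form an orthogonal
  matrix, so squares can be summed (\<open>sum_coupled_squares\<close>), and
  \<open>spherical_entry_recurrence\<close> follows.

  Row \<open>p\<close> of the full spherical function of degree \<open>d\<close> belongs to the pair \<open>zeta l d p\<close>, and the
  four neighbours of this pair are \<open>zeta l (d + 1) p\<close>, \<open>zeta l d (p + 1)\<close>, \<open>zeta l d (p - 1)\<close> and
  \<open>zeta l (d - 1) p\<close>; this gives the matrix recurrence. The diagonal matrix \<open>rec_A\<close> is
  invertible because coupling upwards has a positive coefficient. For the polynomials, the
  degree-zero function is invertible away from \<open>\<pi>\<int>\<close>, because its rows are, after rescaling
  rows and columns, the coefficients of \<open>(1 + z e\<^sup>-\<^sup>i\<^sup>t)\<^sup>r (1 + z e\<^sup>i\<^sup>t)\<^sup>N\<^sup>-\<^sup>r\<close> with \<open>N = 2l\<close>, powers of two independent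
  linear forms. Multiplying the recurrence by the inverse and solving for degree \<open>d + 1\<close> shows
  inductively that all entries are polynomials in \<open>cos t\<close>, and the recurrence then holds for these
  polynomials identically, hence at every point of \<open>A_star\<close>.
\<close>

section \<open>Coefficients of products of three brackets\<close>

text \<open>
  Integer lower indices make Pascal's rule and absorption hold without side conditions, so that
  inductions may shift exponents below zero.
\<close>

definition binom_int :: "nat \<Rightarrow> int \<Rightarrow> real" where
  "binom_int n z = (if z < 0 then 0 else real (n choose nat z))"

lemma binom_int_Suc: "binom_int (Suc n) z = binom_int n z + binom_int n (z - 1)"
proof (cases "z \<le> 0")
  case False
  then have "nat z = Suc (nat (z - 1))" by linarith
  with False show ?thesis by (simp add: binom_int_def)
qed (auto simp: binom_int_def)

lemma binom_int_absorb: "of_int (z + 1) * binom_int n (z + 1) = (real n - of_int z) * binom_int n z"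
proof (cases "z < 0")
  case True
  then show ?thesis by (cases "z = -1") (auto simp: binom_int_def)
next
  case False
  define k where "k = nat z"
  have z: "z = int k" using False by (simp add: k_def)
  have n: "nat (1 + int k) = Suc k" by linarith
  have "real (Suc k) * real (n choose Suc k) = (real n - real k) * real (n choose k)"
  proof (cases "k \<le> n")
    case True
    have "Suc k * (n choose Suc k) = (n - k) * (n choose k)"
      by (metis binomial_absorb_comp binomial_absorption diff_Suc_1 mult.commute)
    then have "real (Suc k * (n choose Suc k)) = real ((n - k) * (n choose k))" by simp
    then show ?thesis using True by (simp only: of_nat_mult of_nat_diff)
  qed (simp add: binomial_eq_0)
  then show ?thesis by (simp add: z n binom_int_def algebra_simps)
qed

lemma binom_int_0: "binom_int 0 z = (if z = 0 then 1 else 0)"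
  by (auto simp: binom_int_def)

lemma binom_int_outside: "z < 0 \<or> z > int n \<Longrightarrow> binom_int n z = 0"
  by (auto simp: binom_int_def binomial_eq_0)

text \<open>
  The coefficient of \<open>X\<^sup>x Y\<^sup>y\<close> in \<open>(1 - X Y)\<^sup>a (1 + X)\<^sup>b (1 + Y)\<^sup>c\<close>, which is the product of powers of the three
  brackets of classical invariant theory, dehomogenised. The recursion multiplies by one more
  factor \<open>1 - X Y\<close>.
\<close>

fun bracket_coeff :: "nat \<Rightarrow> nat \<Rightarrow> nat \<Rightarrow> int \<Rightarrow> int \<Rightarrow> real" where
  "bracket_coeff 0 b c x y = binom_int b x * binom_int c y"
| "bracket_coeff (Suc a) b c x y = bracket_coeff a b c x y - bracket_coeff a b c (x - 1) (y - 1)"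

lemma bracket_coeff_swap: "bracket_coeff a b c x y = bracket_coeff a c b y x"
  by (induction a arbitrary: x y) auto

lemma bracket_coeff_outside:
  assumes "x < 0 \<or> x > int (a + b) \<or> y < 0 \<or> y > int (a + c)"
  shows "bracket_coeff a b c x y = 0"
  using assms
proof (induction a arbitrary: x y)
  case 0
  then show ?case by (auto simp: binom_int_outside)
next
  case (Suc a)
  have "bracket_coeff a b c x y = 0" "bracket_coeff a b c (x-1) (y-1) = 0"
    by (rule Suc.IH; use Suc.prems in auto)+
  then show ?case by simp
qed

text \<open>
  This is the coefficient of \<open>Y\<^sup>c (X Y)\<^sup>x\<close>. The exponent of \<open>Y\<close> exceeds that of \<open>X\<close> by \<open>c\<close>,
  which forces the factor \<open>Y\<^sup>c\<close> from \<open>(1 + Y)\<^sup>c\<close> and the factor \<open>1\<close> from \<open>(1 + X)\<^sup>b\<close>. It is what remains of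
  the sum for the highest weight.
\<close>

lemma bracket_coeff_highest:
  "bracket_coeff a b c (int x) (int c + int x) = (-1) ^ x * real (a choose x)"
proof (induction a arbitrary: x)
  case 0
  then show ?case by (cases x) (auto simp: binom_int_def nat_add_distrib)
next
  case (Suc a)
  show ?case
  proof (cases x)
    case 0
    then show ?thesis using Suc.IH[of 0] by (simp add: bracket_coeff_outside)
  next
    case (Suc k)
    have "int c + int (Suc k) - 1 = int c + int k" "int (Suc k) - 1 = int k" by auto
    then show ?thesis using Suc.IH[of k] Suc.IH[of "Suc k"]
      by (simp add: Suc distrib_left)
  qed
qed

text \<open>
  For the generating polynomial \<open>G\<close> of parameters \<open>a, b, c\<close> this is the identity
  \<open>\<partial>\<^sub>Y G + X (a + c - Y \<partial>\<^sub>Y) G = c G'\<close>, where \<open>G'\<close> has parameters \<open>a, b + 1, c - 1\<close>. Applying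
  it at \<open>(x, y)\<close> and \<open>(x - 1, y - 1)\<close> and subtracting gives the step from \<open>a\<close> to \<open>a + 1\<close>.
  For \<open>c = 0\<close> the right-hand side vanishes, whatever the truncated \<open>c - 1\<close> is.
\<close>

lemma bracket_coeff_contig_down_c:
  "of_int (y + 1) * bracket_coeff a b c x (y + 1)
     + (real (a + c) - of_int y) * bracket_coeff a b c (x - 1) y
   = real c * bracket_coeff a (Suc b) (c - 1) x y"
proof (induction a arbitrary: x y)
  case 0
  have A: "of_int (y + 1) * binom_int c (y + 1) = real c * binom_int (c - 1) y"
  proof (cases c)
    case (Suc n)
    then show ?thesis
      using binom_int_absorb[of y n] by (simp add: binom_int_Suc algebra_simps)
  qed (auto simp: binom_int_0)
  have B: "(real c - of_int y) * binom_int c y = real c * binom_int (c - 1) y"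
    using binom_int_absorb[of y c] A by simp
  have "of_int (y + 1) * (binom_int b x * binom_int c (y + 1))
     + (real c - of_int y) * (binom_int b (x - 1) * binom_int c y)
     = binom_int b x * (of_int (y + 1) * binom_int c (y + 1))
       + binom_int b (x - 1) * ((real c - of_int y) * binom_int c y)"
    by (simp only: mult_ac)
  also have "\<dots> = real c * (binom_int (Suc b) x * binom_int (c - 1) y)"
    unfolding A B by (simp add: binom_int_Suc algebra_simps)
  finally show ?case by simp
next
  case (Suc a)
  from Suc.IH[of y x] Suc.IH[of "y - 1" "x - 1"] show ?case
    by (simp add: algebra_simps)
qed

text \<open>
  The operator \<open>(a + b - X \<partial>\<^sub>X) (a + c - Y \<partial>\<^sub>Y) - \<partial>\<^sub>X \<partial>\<^sub>Y\<close> lowers the exponent \<open>a\<close>. As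
  it depends on \<open>a\<close> itself, the induction leaves a remainder, which is a multiple of the polynomial and
  accounts for the growth of \<open>a (a + b + c + 1)\<close> by \<open>2 a + b + c + 2\<close>.
\<close>

lemma bracket_coeff_contig_down_a:
  "(real (a + b) - of_int x) * (real (a + c) - of_int y) * bracket_coeff a b c x y
     - of_int (x + 1) * of_int (y + 1) * bracket_coeff a b c (x + 1) (y + 1)
   = real a * real (a + b + c + 1) * bracket_coeff (a - 1) b c x y"
proof (induction a arbitrary: x y)
  case 0
  have "of_int (x + 1) * of_int (y + 1) * (binom_int b (x + 1) * binom_int c (y + 1))
    = (of_int (x + 1) * binom_int b (x + 1)) * (of_int (y + 1) * binom_int c (y + 1))"
    by (simp only: mult_ac)
  also have "\<dots> = (real b - of_int x) * (real c - of_int y) * (binom_int b x * binom_int c y)"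
    unfolding binom_int_absorb by (simp only: mult_ac)
  finally show ?case by simp
next
  case (Suc a)
  have step: "real a * real (a + b + c + 1) * bracket_coeff (a - 1) b c x y
    - real a * real (a + b + c + 1) * bracket_coeff (a - 1) b c (x - 1) (y - 1)
    = real a * real (a + b + c + 1) * bracket_coeff a b c x y"
    by (cases a) (auto simp: algebra_simps)
  from step[folded Suc.IH] show ?case by (simp add: algebra_simps)
qed

text \<open>
  Expanding \<open>(1 - X Y)\<^sup>a\<close> gives the alternating sum that occurs in Racah's formula.
\<close>

lemma bracket_coeff_sum:
  "bracket_coeff a b c x y
     = (\<Sum>k\<le>a. (-1) ^ k * real (a choose k) * binom_int b (x - int k) * binom_int c (y - int k))"
proof -
  have pascal: "(\<Sum>k\<le>Suc a. (-1) ^ k * real (Suc a choose k) * f k)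
      = (\<Sum>k\<le>a. (-1) ^ k * real (a choose k) * f k)
        - (\<Sum>k\<le>a. (-1) ^ k * real (a choose k) * f (Suc k))" for a and f :: "nat \<Rightarrow> real"
  proof -
    have "(\<Sum>k\<le>Suc a. (-1) ^ k * real (Suc a choose k) * f k)
        = f 0 + (\<Sum>k\<le>a. (-1) ^ Suc k * real (Suc a choose Suc k) * f (Suc k))"
      by (subst sum.atMost_Suc_shift) simp
    also have "(\<Sum>k\<le>a. (-1) ^ Suc k * real (Suc a choose Suc k) * f (Suc k))
        = (\<Sum>k\<le>a. (-1) ^ Suc k * real (a choose Suc k) * f (Suc k))
        - (\<Sum>k\<le>a. (-1) ^ k * real (a choose k) * f (Suc k))"
      unfolding sum_subtractf [symmetric] by (rule sum.cong) (auto simp: algebra_simps)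
    also have "f 0 + \<dots> = f 0 + (\<Sum>k\<le>a. (-1) ^ Suc k * real (a choose Suc k) * f (Suc k))
        - (\<Sum>k\<le>a. (-1) ^ k * real (a choose k) * f (Suc k))"
      by simp
    also have "f 0 + (\<Sum>k\<le>a. (-1) ^ Suc k * real (a choose Suc k) * f (Suc k))
        = (\<Sum>k\<le>Suc a. (-1) ^ k * real (a choose k) * f k)"
      by (subst sum.atMost_Suc_shift) simp
    finally show ?thesis by (simp add: binomial_eq_0)
  qed
  show ?thesis
  proof (induction a arbitrary: x y)
    case (Suc a)
    show ?case
      unfolding bracket_coeff.simps(2) Suc.IH
      using pascal[of a "\<lambda>k. binom_int b (x - int k) * binom_int c (y - int k)"]
      by (simp add: mult.assoc algebra_simps)
  qed simp
qed

text \<open>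
  This is Vandermonde's identity for the negative upper arguments \<open>-(c + 1)\<close> and \<open>-(b + 1)\<close>. It provides the
  norm of the highest weight vector.
\<close>

lemma sum_choose_convolution:
  "(\<Sum>x\<le>a. real ((b + (a - x)) choose b) * real ((c + x) choose c)) = real ((a + b + c + 1) choose a)"
proof -
  have neg: "(- (real n + 1)) gchoose k = (-1) ^ k * real ((n + k) choose k)" for n k
    using gbinomial_minus[of "real n + 1" k] binomial_gbinomial[of "n + k" k, where 'a = real]
    by (simp add: add_ac)
  have "(-1) ^ a * real ((a + b + c + 1) choose a) = (- (real (b + c + 1) + 1)) gchoose a"
    unfolding neg by (simp add: add_ac)
  also have "- (real (b + c + 1) + 1) = - (real c + 1) + - (real b + 1)" by simp
  also have "(- (real c + 1) + - (real b + 1)) gchoose a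
      = (\<Sum>x\<le>a. ((- (real c + 1)) gchoose x) * ((- (real b + 1)) gchoose (a - x)))"
    unfolding gbinomial_Vandermonde [symmetric] atLeast0AtMost [symmetric] ..
  also have "\<dots> = (-1) ^ a * (\<Sum>x\<le>a. real ((b + (a - x)) choose b) * real ((c + x) choose c))"
    unfolding sum_distrib_left
  proof (rule sum.cong)
    fix x assume "x \<in> {..a}"
    then have "(-1 :: real) ^ x * (-1) ^ (a - x) = (-1) ^ a"
      by (simp flip: power_add)
    moreover have "(c + x) choose x = (c + x) choose c" "(b + (a - x)) choose (a - x) = (b + (a - x)) choose b"
      by (metis add_diff_cancel_right' binomial_symmetric le_add2)+
    ultimately show "((- (real c + 1)) gchoose x) * ((- (real b + 1)) gchoose (a - x))
        = (-1) ^ a * (real ((b + (a - x)) choose b) * real ((c + x) choose c))"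
      unfolding neg by (simp flip: \<open>_ = (-1) ^ a\<close>)
  qed simp
  finally show ?thesis by simp
qed

section \<open>Weights and admissible triples\<close>

text \<open>
  Enumerating weights downwards from \<open>l\<close> or upwards from \<open>-l\<close> matches the two
  exponents of the bracket polynomial: in the sequel \<open>j1 = l1 - x\<close> and \<open>j2 = y - l2\<close>.
\<close>

lemma weights_eq_below:
  assumes "2 * l = real N"
  shows "weights l = (\<lambda>x. l - real x) ` {..N}"
proof (intro equalityI subsetI)
  fix j assume "j \<in> weights l"
  then obtain z where z: "l - j = of_int z" and "\<bar>j\<bar> \<le> l"
    by (auto simp: weights_def elim: Ints_cases)
  then have "0 \<le> real_of_int z" "real_of_int z \<le> real N"
    using assms by auto
  then have "0 \<le> z" "z \<le> int N" by auto
  then have "j = l - real (nat z)" "nat z \<le> N"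
    using z by auto
  then show "j \<in> (\<lambda>x. l - real x) ` {..N}" by blast
next
  fix j assume "j \<in> (\<lambda>x. l - real x) ` {..N}"
  then obtain k where "k \<le> N" "j = l - real k" by auto
  then show "j \<in> weights l" using assms by (auto simp: weights_def abs_if)
qed

lemma weights_eq_above:
  assumes "2 * l = real N"
  shows "weights l = (\<lambda>x. real x - l) ` {..N}"
proof -
  have "(\<lambda>x. real x - l) ` {..N} = (\<lambda>x. l - real x) ` {..N}"
  proof (intro equalityI subsetI)
    fix j assume "j \<in> (\<lambda>x. real x - l) ` {..N}"
    then obtain k where "k \<le> N" "j = real k - l" by auto
    then have "j = l - real (N - k)" "N - k \<le> N" using assms by (auto simp: of_nat_diff)
    then show "j \<in> (\<lambda>x. l - real x) ` {..N}" by blast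
  next
    fix j assume "j \<in> (\<lambda>x. l - real x) ` {..N}"
    then obtain k where "k \<le> N" "j = l - real k" by auto
    then have "j = real (N - k) - l" "N - k \<le> N" using assms by (auto simp: of_nat_diff)
    then show "j \<in> (\<lambda>x. real x - l) ` {..N}" by blast
  qed
  then show ?thesis using weights_eq_below[OF assms] by simp
qed

lemma in_weights_iff:
  assumes "2 * l = real N"
  shows "l - of_int x \<in> weights l \<longleftrightarrow> 0 \<le> x \<and> x \<le> int N"
proof -
  have "l - of_int x \<in> weights l \<longleftrightarrow> \<bar>l - real_of_int x\<bar> \<le> l"
    by (simp add: weights_def)
  also have "\<dots> \<longleftrightarrow> 0 \<le> real_of_int x \<and> real_of_int x \<le> real N"
    using assms by (auto simp: abs_if)
  also have "\<dots> \<longleftrightarrow> 0 \<le> x \<and> x \<le> int N"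
    by auto
  finally show ?thesis .
qed

lemma in_weights_iff':
  assumes "2 * l = real N"
  shows "of_int x - l \<in> weights l \<longleftrightarrow> 0 \<le> x \<and> x \<le> int N"
proof -
  have "of_int x - l = l - of_int (int N - x)" using assms by simp
  then have "of_int x - l \<in> weights l \<longleftrightarrow> 0 \<le> int N - x \<and> int N - x \<le> int N"
    by (simp only: in_weights_iff[OF assms])
  then show ?thesis by auto
qed

text \<open>
  The triangle conditions say that \<open>a = l1 + l2 - l\<close>, \<open>b = l + l1 - l2\<close> and \<open>c = l - l1 + l2\<close> are natural
  numbers; these are the exponents of the three brackets.
\<close>

lemma CG_triple_iff:
  "CG_triple l1 l2 l \<longleftrightarrow>
     (\<exists>a b c. l1 = real (a + b) / 2 \<and> l2 = real (a + c) / 2 \<and> l = real (b + c) / 2)"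
proof
  assume T: "CG_triple l1 l2 l"
  then obtain n1 n2 where n: "2 * l1 = real n1" "2 * l2 = real n2"
    by (auto simp: CG_triple_def elim!: Nats_cases)
  from T obtain z where z: "l1 + l2 - l = of_int z"
    by (auto simp: CG_triple_def elim!: Ints_cases)
  have "0 \<le> real_of_int z" "real_of_int z \<le> real n1" "real_of_int z \<le> real n2"
    using T z n by (auto simp: CG_triple_def)
  then have zz: "0 \<le> z" "z \<le> int n1" "z \<le> int n2" by auto
  have "l1 = real (nat z + nat (int n1 - z)) / 2" "l2 = real (nat z + nat (int n2 - z)) / 2"
    "l = real (nat (int n1 - z) + nat (int n2 - z)) / 2"
    using z n zz by auto
  then show "\<exists>a b c. l1 = real (a + b) / 2 \<and> l2 = real (a + c) / 2 \<and> l = real (b + c) / 2"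
    by blast
next
  assume "\<exists>a b c. l1 = real (a + b) / 2 \<and> l2 = real (a + c) / 2 \<and> l = real (b + c) / 2"
  then obtain a b c where e: "l1 = real (a + b) / 2" "l2 = real (a + c) / 2" "l = real (b + c) / 2"
    by blast
  have "2 * l1 = real (a + b)" "2 * l2 = real (a + c)" "2 * l = real (b + c)" "l1 + l2 - l = real a"
    using e by (auto simp: field_simps)
  then have "2 * l1 \<in> \<nat>" "2 * l2 \<in> \<nat>" "2 * l \<in> \<nat>" "l1 + l2 - l \<in> \<int>"
    by (simp_all only: of_nat_in_Nats Ints_of_nat)
  moreover have "\<bar>l1 - l2\<bar> \<le> l" "l \<le> l1 + l2"
    using e by (auto simp: abs_if field_simps)
  ultimately show "CG_triple l1 l2 l"
    unfolding CG_triple_def by blast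
qed

section \<open>Clebsch-Gordan coefficients as bracket coefficients\<close>

definition ifact :: "int \<Rightarrow> real" where
  "ifact z = fact (nat z)"

lemma ifact_step: "0 < z \<Longrightarrow> ifact z = of_int z * ifact (z - 1)"
proof -
  assume "0 < z"
  then have "nat z = Suc (nat (z - 1))" by linarith
  then show ?thesis using \<open>0 < z\<close> by (simp add: ifact_def)
qed

lemma rfact_ifact: "r = of_int z \<Longrightarrow> rfact r = ifact z"
  by (simp add: rfact_def ifact_def)

lemma binom_int_ifact:
  "binom_int n z = (if 0 \<le> z \<and> z \<le> int n then fact n / (ifact z * ifact (int n - z)) else 0)"
proof (cases "0 \<le> z \<and> z \<le> int n")
  case True
  then obtain k where k: "z = int k" "k \<le> n" by (metis nonneg_int_cases of_nat_le_iff)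
  then have "nat (int n - int k) = n - k" by simp
  then show ?thesis using k True by (simp add: binom_int_def ifact_def binomial_fact)
next
  case False
  then show ?thesis by (auto simp: binom_int_outside)
qed

text \<open>
  A Clebsch-Gordan coefficient in the coordinates \<open>x = l1 - j1\<close>, \<open>y = l2 + j2\<close> splits into a factor
  depending only on the spins, the square root of a product of factorials, and a rational factor, the bracket
  coefficient.
\<close>

definition cg_norm :: "nat \<Rightarrow> nat \<Rightarrow> nat \<Rightarrow> real" where
  "cg_norm a b c = sqrt (real (b + c + 1) / (fact a * fact b * fact c * fact (a + b + c + 1)))"

definition cg_root :: "nat \<Rightarrow> nat \<Rightarrow> nat \<Rightarrow> int \<Rightarrow> int \<Rightarrow> real" where
  "cg_root a b c x y = ifact (int b - x + y) * ifact (int c + x - y)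
             * (ifact x * ifact (int (a + b) - x) * ifact y * ifact (int (a + c) - y))"

definition cg :: "nat \<Rightarrow> nat \<Rightarrow> nat \<Rightarrow> int \<Rightarrow> int \<Rightarrow> real" where
  "cg a b c x y = cg_norm a b c * sqrt (cg_root a b c x y) * bracket_coeff a b c x y"

lemmas cg_expand = cg_def [unfolded cg_norm_def cg_root_def]

text \<open>
  The conditions on \<open>k\<close> in Racah's formula are exactly those under which the three binomial
  coefficients in the expansion of the bracket coefficient are nonzero.
\<close>

lemma racah_sum_bracket_coeff:
  assumes "l1 = real (a + b) / 2" "l2 = real (a + c) / 2" "l = real (b + c) / 2"
    and "j1 = l1 - of_int x" "j2 = of_int y - l2"
  shows "(\<Sum>k | real k \<le> l1 + l2 - l \<and> real k \<le> l1 - j1 \<and> real k \<le> l2 + j2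
                 \<and> 0 \<le> l - l2 + j1 + real k \<and> 0 \<le> l - l1 - j2 + real k.
            (-1) ^ k / (fact k * rfact (l1 + l2 - l - real k) * rfact (l1 - j1 - real k)
               * rfact (l2 + j2 - real k) * rfact (l - l2 + j1 + real k)
               * rfact (l - l1 - j2 + real k)))
     = bracket_coeff a b c x y / (fact a * fact b * fact c)"
proof -
  define K where "K = {k. real k \<le> l1 + l2 - l \<and> real k \<le> l1 - j1 \<and> real k \<le> l2 + j2
                 \<and> 0 \<le> l - l2 + j1 + real k \<and> 0 \<le> l - l1 - j2 + real k}"
  have e: "l1 + l2 - l = of_int (int a)" "l1 - j1 = of_int x" "l2 + j2 = of_int y"
    "l - l2 + j1 = of_int (int b - x)" "l - l1 - j2 = of_int (int c - y)"
    using assms by (auto simp: field_simps)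
  have K: "K = {k. k \<le> a \<and> 0 \<le> x - int k \<and> x - int k \<le> int b \<and> 0 \<le> y - int k \<and> y - int k \<le> int c}"
  proof (rule Set.set_eqI)
    fix k
    have "real k = of_int (int k)" by simp
    then show "k \<in> K \<longleftrightarrow> k \<in> {k. k \<le> a \<and> 0 \<le> x - int k \<and> x - int k \<le> int b \<and> 0 \<le> y - int k \<and> y - int k \<le> int c}"
      unfolding K_def mem_Collect_eq e by linarith
  qed
  have "bracket_coeff a b c x y
      = (\<Sum>k\<in>K. (-1) ^ k * real (a choose k) * binom_int b (x - int k) * binom_int c (y - int k))"
    unfolding bracket_coeff_sum K
    by (rule sum.mono_neutral_right) (auto simp: binom_int_ifact)
  then have "bracket_coeff a b c x y / (fact a * fact b * fact c)
      = (\<Sum>k\<in>K. (-1) ^ k * real (a choose k) * binom_int b (x - int k) * binom_int c (y - int k)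
            / (fact a * fact b * fact c))"
    by (simp add: sum_divide_distrib)
  also have "\<dots> = (\<Sum>k\<in>K. (-1) ^ k / (fact k * rfact (l1 + l2 - l - real k) * rfact (l1 - j1 - real k)
               * rfact (l2 + j2 - real k) * rfact (l - l2 + j1 + real k)
               * rfact (l - l1 - j2 + real k)))"
  proof (rule sum.cong[OF refl])
    fix k assume "k \<in> K"
    then have k: "k \<le> a" "0 \<le> x - int k \<and> x - int k \<le> int b" "0 \<le> y - int k \<and> y - int k \<le> int c"
      by (auto simp: K)
    have r: "rfact (l1 + l2 - l - real k) = ifact (int a - int k)"
      "rfact (l1 - j1 - real k) = ifact (x - int k)"
      "rfact (l2 + j2 - real k) = ifact (y - int k)"
      "rfact (l - l2 + j1 + real k) = ifact (int b - (x - int k))"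
      "rfact (l - l1 - j2 + real k) = ifact (int c - (y - int k))"
      by (rule rfact_ifact, use e in simp)+
    have b: "real (a choose k) = fact a / (fact k * ifact (int a - int k))"
      using binomial_fact[OF k(1), where 'a = real] k(1) by (simp add: ifact_def flip: of_nat_diff)
    show "(-1) ^ k * real (a choose k) * binom_int b (x - int k) * binom_int c (y - int k)
            / (fact a * fact b * fact c)
      = (-1) ^ k / (fact k * rfact (l1 + l2 - l - real k) * rfact (l1 - j1 - real k)
               * rfact (l2 + j2 - real k) * rfact (l - l2 + j1 + real k)
               * rfact (l - l1 - j2 + real k))"
      unfolding r b using k(2,3) by (simp add: binom_int_ifact)
  qed
  finally show ?thesis unfolding K_def by simp
qed

text \<open>
  There is no bound on \<open>x\<close> and \<open>y\<close>: outside the weights both sides vanish. Only the weight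
  \<open>j\<close> has to lie between \<open>-l\<close> and \<open>l\<close>. Shifted arguments may therefore leave the admissible range.
\<close>

lemma CG_eq_cg:
  assumes l: "l1 = real (a + b) / 2" "l2 = real (a + c) / 2" "l = real (b + c) / 2"
    and j: "j1 = l1 - of_int x" "j2 = of_int y - l2" "j = j1 + j2"
    and q: "0 \<le> int b - x + y" "0 \<le> int c + x - y"
  shows "CG l1 l2 l j1 j2 j = cg a b c x y"
proof -
  have T: "CG_triple l1 l2 l" using l CG_triple_iff by blast
  have d: "2 * l1 = real (a + b)" "2 * l2 = real (a + c)" "2 * l = real (b + c)"
    using l by auto
  have "j = l - of_int (int c + x - y)"
    using l j by (simp add: field_simps)
  then have jw: "j \<in> weights l"
    using q by (simp only: in_weights_iff[OF d(3)]) auto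
  have w1: "j1 \<in> weights l1 \<longleftrightarrow> 0 \<le> x \<and> x \<le> int (a + b)"
    unfolding j(1) by (rule in_weights_iff[OF d(1)])
  have w2: "j2 \<in> weights l2 \<longleftrightarrow> 0 \<le> y \<and> y \<le> int (a + c)"
    unfolding j(2) by (rule in_weights_iff'[OF d(2)])
  show ?thesis
  proof (cases "j1 \<in> weights l1 \<and> j2 \<in> weights l2")
    case False
    then have "bracket_coeff a b c x y = 0"
      using w1 w2 by (intro bracket_coeff_outside) auto
    then show ?thesis using False by (auto simp: CG_def cg_expand)
  next
    case True
    have r: "rfact (l + l1 - l2) = fact b" "rfact (l - l1 + l2) = fact c"
      "rfact (l1 + l2 - l) = fact a" "rfact (l1 + l2 + l + 1) = fact (a + b + c + 1)"
      "rfact (l + j) = ifact (int b - x + y)" "rfact (l - j) = ifact (int c + x - y)"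
      "rfact (l1 - j1) = ifact x" "rfact (l1 + j1) = ifact (int (a + b) - x)"
      "rfact (l2 - j2) = ifact (int (a + c) - y)" "rfact (l2 + j2) = ifact y"
    proof -
      have "l + l1 - l2 = of_int (int b)" "l - l1 + l2 = of_int (int c)"
        "l1 + l2 - l = of_int (int a)" "l1 + l2 + l + 1 = of_int (int (a + b + c + 1))"
        using l by (auto simp: field_simps)
      then show "rfact (l + l1 - l2) = fact b" "rfact (l - l1 + l2) = fact c"
        "rfact (l1 + l2 - l) = fact a" "rfact (l1 + l2 + l + 1) = fact (a + b + c + 1)"
        by (auto simp only: rfact_def floor_of_int nat_int)
      show "rfact (l + j) = ifact (int b - x + y)" "rfact (l - j) = ifact (int c + x - y)"
        "rfact (l1 - j1) = ifact x" "rfact (l1 + j1) = ifact (int (a + b) - x)"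
        "rfact (l2 - j2) = ifact (int (a + c) - y)" "rfact (l2 + j2) = ifact y"
        using l j by (auto intro!: rfact_ifact simp: field_simps)
    qed
    have E: "CG l1 l2 l j1 j2 j =
       sqrt ((2 * l + 1) * rfact (l + l1 - l2) * rfact (l - l1 + l2) * rfact (l1 + l2 - l)
             / rfact (l1 + l2 + l + 1))
       * sqrt (rfact (l + j) * rfact (l - j) * rfact (l1 - j1) * rfact (l1 + j1)
               * rfact (l2 - j2) * rfact (l2 + j2))
       * (bracket_coeff a b c x y / (fact a * fact b * fact c))"
      unfolding CG_def racah_sum_bracket_coeff[OF l j(1,2)]
      using T True jw j(3) by simp
    define F where "F = (fact a * fact b * fact c :: real)"
    define X where "X = real (b + c + 1) / fact (a + b + c + 1)"
    have F: "F > 0" and X: "X \<ge> 0" by (auto simp: F_def X_def)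
    have "sqrt (X * F) = sqrt (X / F) * F"
    proof -
      have "X * F = X / F * F\<^sup>2" using F by (simp add: power2_eq_square)
      then have "sqrt (X * F) = sqrt (X / F) * sqrt (F\<^sup>2)" by (simp only: real_sqrt_mult)
      then show ?thesis using F by simp
    qed
    moreover have "(2 * l + 1) * fact b * fact c * fact a / fact (a + b + c + 1) = X * F"
      using l by (simp add: X_def F_def)
    moreover have "real (b + c + 1) / (fact a * fact b * fact c * fact (a + b + c + 1)) = X / F"
      by (simp add: X_def F_def)
    ultimately show ?thesis
      using F by (simp add: E cg_expand r flip: F_def)
  qed
qed

section \<open>Contiguity relations for Clebsch-Gordan coefficients\<close>

text \<open>
  The brackets \<open>1 + X\<close> and \<open>1 + Y\<close> enter symmetrically. This is the symmetry of Clebsch-Gordan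
  coefficients under exchange of the two tensor factors combined with reversal of all weights.
\<close>

lemma cg_swap: "cg a b c x y = cg a c b y x"
proof -
  have "ifact (int b - x + y) * ifact (int c + x - y)
             * (ifact x * ifact (int (a + b) - x) * ifact y * ifact (int (a + c) - y))
      = ifact (int c - y + x) * ifact (int b + y - x)
             * (ifact y * ifact (int (a + c) - y) * ifact x * ifact (int (a + b) - x))"
    by (simp add: algebra_simps)
  moreover have "real (b + c + 1) / (fact a * fact b * fact c * fact (a + b + c + 1))
      = real (c + b + 1) / (fact a * fact c * fact b * fact (a + c + b + 1))"
    by (simp add: add_ac mult_ac)
  ultimately show ?thesis
    unfolding cg_expand bracket_coeff_swap[of a b c x y] by (simp only:)
qed

lemma ifact_mult: "0 < z \<Longrightarrow> w = z - 1 \<Longrightarrow> z' = z \<Longrightarrow> of_int z * ifact w = ifact z'"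
  using ifact_step[of z] by simp

text \<open>
  The highest weight vector in the tensor product is a unit vector: its squared components are
  the terms of a Vandermonde convolution divided by the value of the sum.
\<close>

lemma cg_highest_norm: "(\<Sum>x\<le>a. (cg a b c (int x) (int c + int x))\<^sup>2) = 1"
proof -
  have "(cg a b c (int x) (int c + int x))\<^sup>2
      = real ((b + (a - x)) choose b) * real ((c + x) choose c)
        / real ((a + b + c + 1) choose a)" if x: "x \<le> a" for x
  proof -
    define P where "P = ifact (int b - int x + (int c + int x)) * ifact (int c + int x - (int c + int x))
      * (ifact (int x) * ifact (int (a + b) - int x) * ifact (int c + int x)
          * ifact (int (a + c) - (int c + int x)))"
    have "ifact (int b - int x + (int c + int x)) = fact (b + c)"
      "ifact (int c + int x - (int c + int x)) = 1"
      "ifact (int x) = fact x" "ifact (int (a + b) - int x) = fact (b + (a - x))"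
      "ifact (int c + int x) = fact (c + x)" "ifact (int (a + c) - (int c + int x)) = fact (a - x)"
      unfolding ifact_def using x by (auto intro!: arg_cong[where f = fact])
    then have P: "P = fact (b + c) * (fact x * fact (b + (a - x)) * fact (c + x) * fact (a - x))"
      unfolding P_def by simp
    then have "P \<ge> 0" by simp
    have "(cg a b c (int x) (int c + int x))\<^sup>2
        = real (b + c + 1) / (fact a * fact b * fact c * fact (a + b + c + 1)) * P * (real (a choose x))\<^sup>2"
      unfolding cg_expand P_def[symmetric] bracket_coeff_highest power_mult_distrib
      using \<open>P \<ge> 0\<close> by (simp flip: power_mult)
    also have "real (a choose x) = fact a / (fact x * fact (a - x))"
      using x by (rule binomial_fact)
    finally have L: "(cg a b c (int x) (int c + int x))\<^sup>2
        = real (b + c + 1) / (fact a * fact b * fact c * fact (a + b + c + 1)) * P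
          * (fact a / (fact x * fact (a - x)))\<^sup>2" .
    have B: "real ((b + (a - x)) choose b) = fact (b + (a - x)) / (fact b * fact (a - x))"
      "real ((c + x) choose c) = fact (c + x) / (fact c * fact x)"
      "real ((a + b + c + 1) choose a) = fact (a + b + c + 1) / (fact a * fact (b + c + 1))"
      by (simp_all add: binomial_fact)
    have F: "fact (b + c + 1) = real (b + c + 1) * fact (b + c)"
      by simp
    show ?thesis unfolding L B P F
      by (simp add: power2_eq_square field_simps del: fact_Suc of_nat_add)
  qed
  then have "(\<Sum>x\<le>a. (cg a b c (int x) (int c + int x))\<^sup>2)
      = (\<Sum>x\<le>a. real ((b + (a - x)) choose b) * real ((c + x) choose c)) / real ((a + b + c + 1) choose a)"
    by (simp add: sum_divide_distrib)
  then show ?thesis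
    unfolding sum_choose_convolution by simp
qed

text \<open>
  The shape of the Clebsch-Gordan coefficients for \<open>H\<^sup>l \<otimes> H\<^sup>1\<^sup>/\<^sup>2\<close> with \<open>n = 2 l\<close>, up to sign.
\<close>

definition halfc :: "nat \<Rightarrow> int \<Rightarrow> real" where
  "halfc n z = sqrt (of_int z / real (n + 1))"

lemma halfc_mult_sqrt:
  "halfc n z * halfc m w * sqrt P = sqrt (of_int z * of_int w * P) / sqrt (real (n + 1) * real (m + 1))"
  by (simp add: halfc_def real_sqrt_mult real_sqrt_divide)

lemma cg_norm_pos: "cg_norm a b c > 0"
  by (simp add: cg_norm_def)

text \<open>
  The square roots combine with those in \<open>cg\<close> to a common root, and what remains is
  multiplication of the generating polynomial by \<open>1 - X Y\<close>. The two degenerate ends of the range are harmless,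
  since there the bracket coefficient vanishes.
\<close>

lemma cg_couple_up_up:
  "\<exists>\<alpha>>0. \<forall>x y. 0 \<le> x \<and> x \<le> int (a + b) + 1 \<and> 0 \<le> y \<and> y \<le> int (a + c) + 1 \<longrightarrow>
     halfc (a + b) (int (a + b) + 1 - x) * halfc (a + c) (int (a + c) + 1 - y) * cg a b c x y
     - halfc (a + b) x * halfc (a + c) y * cg a b c (x - 1) (y - 1)
     = \<alpha> * cg (Suc a) b c x y"
proof -
  define R where "R = sqrt (real (a + b + 1) * real (a + c + 1))"
  have R: "R > 0" by (simp add: R_def)
  have main: "halfc (a + b) (int (a + b) + 1 - x) * halfc (a + c) (int (a + c) + 1 - y) * cg a b c x y
     - halfc (a + b) x * halfc (a + c) y * cg a b c (x - 1) (y - 1)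
     = cg_norm a b c / (R * cg_norm (Suc a) b c) * cg (Suc a) b c x y"
    if xy: "0 \<le> x" "x \<le> int (a + b) + 1" "0 \<le> y" "y \<le> int (a + c) + 1" for x y
  proof -
    let ?K = "cg_root (Suc a) b c x y"
    have 1: "halfc (a + b) (int (a + b) + 1 - x) * halfc (a + c) (int (a + c) + 1 - y) * sqrt (cg_root a b c x y)
        * bracket_coeff a b c x y = sqrt ?K / R * bracket_coeff a b c x y"
    proof (cases "x \<le> int (a + b) \<and> y \<le> int (a + c)")
      case True
      have "of_int (int (a + b) + 1 - x) * of_int (int (a + c) + 1 - y) * cg_root a b c x y = ?K"
      proof -
        have "of_int (int (a + b) + 1 - x) * ifact (int (a + b) - x) = ifact (int (Suc a + b) - x)"
          "of_int (int (a + c) + 1 - y) * ifact (int (a + c) - y) = ifact (int (Suc a + c) - y)"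
          by (rule ifact_mult; use True in simp)+
        note this [symmetric]
        then show ?thesis unfolding cg_root_def by (simp only: mult_ac)
      qed
      then show ?thesis by (simp add: halfc_mult_sqrt R_def)
    next
      case False
      then have "bracket_coeff a b c x y = 0" by (intro bracket_coeff_outside) auto
      then show ?thesis by simp
    qed
    have 2: "halfc (a + b) x * halfc (a + c) y * sqrt (cg_root a b c (x - 1) (y - 1))
        * bracket_coeff a b c (x - 1) (y - 1) = sqrt ?K / R * bracket_coeff a b c (x - 1) (y - 1)"
    proof (cases "0 < x \<and> 0 < y")
      case True
      have "of_int x * of_int y * cg_root a b c (x - 1) (y - 1) = ?K"
      proof -
        have "of_int x * ifact (x - 1) = ifact x" "of_int y * ifact (y - 1) = ifact y"
          by (rule ifact_mult; use True in simp)+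
        note this [symmetric]
        moreover have "int b - (x - 1) + (y - 1) = int b - x + y" "int c + (x - 1) - (y - 1) = int c + x - y"
          "int (a + b) - (x - 1) = int (Suc a + b) - x" "int (a + c) - (y - 1) = int (Suc a + c) - y"
          by auto
        ultimately show ?thesis unfolding cg_root_def by (simp only: mult_ac)
      qed
      then show ?thesis by (simp add: halfc_mult_sqrt R_def)
    next
      case False
      then have "bracket_coeff a b c (x - 1) (y - 1) = 0" by (intro bracket_coeff_outside) auto
      then show ?thesis by simp
    qed
    have "halfc (a + b) (int (a + b) + 1 - x) * halfc (a + c) (int (a + c) + 1 - y) * cg a b c x y
        - halfc (a + b) x * halfc (a + c) y * cg a b c (x - 1) (y - 1)
      = cg_norm a b c * (halfc (a + b) (int (a + b) + 1 - x) * halfc (a + c) (int (a + c) + 1 - y)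
            * sqrt (cg_root a b c x y) * bracket_coeff a b c x y)
        - cg_norm a b c * (halfc (a + b) x * halfc (a + c) y * sqrt (cg_root a b c (x - 1) (y - 1))
            * bracket_coeff a b c (x - 1) (y - 1))"
      by (simp only: cg_def mult_ac)
    also have "\<dots> = cg_norm a b c * sqrt ?K / R * bracket_coeff (Suc a) b c x y"
      unfolding 1 2 by (simp add: algebra_simps)
    also have "\<dots> = cg_norm a b c / (R * cg_norm (Suc a) b c) * cg (Suc a) b c x y"
      using cg_norm_pos[of "Suc a" b c] by (simp only: cg_def) simp
    finally show ?thesis .
  qed
  show ?thesis
    by (rule exI[of _ "cg_norm a b c / (R * cg_norm (Suc a) b c)"])
       (use main R cg_norm_pos in auto)
qed

text \<open>
  After the common root is extracted, this is the contiguity relation that raises \<open>b\<close> and lowers \<open>c\<close>.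
  If \<open>c = 0\<close> there is no admissible triple on the right; the factor \<open>\<alpha> = 0\<close> expresses this.
\<close>

lemma cg_couple_up_down:
  "\<exists>\<alpha>. (c = 0 \<longrightarrow> \<alpha> = 0) \<and> (\<forall>x y. 0 \<le> x \<and> x \<le> int (a + b) + 1 \<and> 0 \<le> y \<and> y \<le> int (a + c) + 1 \<longrightarrow>
     halfc (a + b) (int (a + b) + 1 - x) * halfc (a + c) y * cg a b c x y
     + halfc (a + b) x * halfc (a + c) (int (a + c) + 1 - y) * cg a b c (x - 1) (y - 1)
     = \<alpha> * cg a (Suc b) (c - 1) x (y - 1))"
proof -
  define R where "R = sqrt (real (a + b + 1) * real (a + c + 1))"
  have R: "R > 0" by (simp add: R_def)
  have main: "halfc (a + b) (int (a + b) + 1 - x) * halfc (a + c) y * cg a b c x y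
     + halfc (a + b) x * halfc (a + c) (int (a + c) + 1 - y) * cg a b c (x - 1) (y - 1)
     = cg_norm a b c * real c / (R * cg_norm a (Suc b) (c - 1)) * cg a (Suc b) (c - 1) x (y - 1)"
    if xy: "0 \<le> x" "x \<le> int (a + b) + 1" "0 \<le> y" "y \<le> int (a + c) + 1" for x y
  proof -
    define K where "K = ifact (int b - x + y) * ifact (int c + x - y)
      * (ifact x * ifact (int (a + b) + 1 - x) * ifact (y - 1) * ifact (int (a + c) - y))"
    have 1: "halfc (a + b) (int (a + b) + 1 - x) * halfc (a + c) y * sqrt (cg_root a b c x y)
        * bracket_coeff a b c x y = sqrt K / R * (of_int y * bracket_coeff a b c x y)"
    proof (cases "x \<le> int (a + b) \<and> 0 < y")
      case True
      have "of_int (int (a + b) + 1 - x) * of_int y * cg_root a b c x y = K * (of_int y)\<^sup>2"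
      proof -
        have "of_int (int (a + b) + 1 - x) * ifact (int (a + b) - x) = ifact (int (a + b) + 1 - x)"
          "of_int y * ifact (y - 1) = ifact y"
          by (rule ifact_mult; use True in simp)+
        note this [symmetric]
        then show ?thesis unfolding cg_root_def K_def power2_eq_square by (simp only: mult_ac)
      qed
      then show ?thesis using True by (simp add: halfc_mult_sqrt R_def real_sqrt_mult)
    next
      case False
      then have "y = 0 \<or> bracket_coeff a b c x y = 0"
        using xy by (cases "y = 0") (auto intro: bracket_coeff_outside)
      then show ?thesis by (auto simp: halfc_def)
    qed
    have 2: "halfc (a + b) x * halfc (a + c) (int (a + c) + 1 - y) * sqrt (cg_root a b c (x - 1) (y - 1))
        * bracket_coeff a b c (x - 1) (y - 1)
        = sqrt K / R * (of_int (int (a + c) + 1 - y) * bracket_coeff a b c (x - 1) (y - 1))"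
    proof (cases "0 < x \<and> y \<le> int (a + c)")
      case True
      have "of_int x * of_int (int (a + c) + 1 - y) * cg_root a b c (x - 1) (y - 1)
          = K * (of_int (int (a + c) + 1 - y))\<^sup>2"
      proof -
        have "of_int (int (a + c) + 1 - y) * ifact (int (a + c) - y) = ifact (int (a + c) + 1 - y)"
          "of_int x * ifact (x - 1) = ifact x"
          by (rule ifact_mult; use True in simp)+
        note this [symmetric]
        moreover have "int b - (x - 1) + (y - 1) = int b - x + y" "int c + (x - 1) - (y - 1) = int c + x - y"
          "int (a + b) - (x - 1) = int (a + b) + 1 - x" "int (a + c) - (y - 1) = int (a + c) + 1 - y"
          by auto
        ultimately show ?thesis unfolding cg_root_def K_def power2_eq_square by (simp only: mult_ac)
      qed
      moreover have "sqrt ((of_int (int (a + c) + 1 - y))\<^sup>2) = of_int (int (a + c) + 1 - y)"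
        using xy by simp
      ultimately show ?thesis by (simp only: halfc_mult_sqrt R_def real_sqrt_mult) simp
    next
      case False
      then have "int (a + c) + 1 - y = 0 \<or> bracket_coeff a b c (x - 1) (y - 1) = 0"
        using xy by (cases "y = int (a + c) + 1") (auto intro: bracket_coeff_outside)
      then show ?thesis by (auto simp: halfc_def)
    qed
    have contig: "of_int y * bracket_coeff a b c x y
        + of_int (int (a + c) + 1 - y) * bracket_coeff a b c (x - 1) (y - 1)
        = real c * bracket_coeff a (Suc b) (c - 1) x (y - 1)"
      using bracket_coeff_contig_down_c[of "y - 1" a b c x] by (simp add: algebra_simps)
    have "halfc (a + b) (int (a + b) + 1 - x) * halfc (a + c) y * cg a b c x y
        + halfc (a + b) x * halfc (a + c) (int (a + c) + 1 - y) * cg a b c (x - 1) (y - 1)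
      = cg_norm a b c * (halfc (a + b) (int (a + b) + 1 - x) * halfc (a + c) y
            * sqrt (cg_root a b c x y) * bracket_coeff a b c x y)
        + cg_norm a b c * (halfc (a + b) x * halfc (a + c) (int (a + c) + 1 - y)
            * sqrt (cg_root a b c (x - 1) (y - 1)) * bracket_coeff a b c (x - 1) (y - 1))"
      by (simp only: cg_def mult_ac)
    also have "\<dots> = cg_norm a b c * sqrt K / R * (of_int y * bracket_coeff a b c x y
        + of_int (int (a + c) + 1 - y) * bracket_coeff a b c (x - 1) (y - 1))"
      unfolding 1 2 by (simp only: distrib_left) simp
    also have "\<dots> = cg_norm a b c * sqrt K / R * (real c * bracket_coeff a (Suc b) (c - 1) x (y - 1))"
      unfolding contig ..
    also have "\<dots> = cg_norm a b c * real c / (R * cg_norm a (Suc b) (c - 1)) * cg a (Suc b) (c - 1) x (y - 1)"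
    proof (cases "c = 0")
      case False
      then have "cg_root a (Suc b) (c - 1) x (y - 1) = K"
        unfolding cg_root_def K_def by (simp add: of_nat_diff algebra_simps)
      then show ?thesis
        using cg_norm_pos[of a "Suc b" "c - 1"] by (simp only: cg_def) simp
    qed simp
    finally show ?thesis .
  qed
  show ?thesis
    by (rule exI[of _ "cg_norm a b c * real c / (R * cg_norm a (Suc b) (c - 1))"])
       (use main in auto)
qed

lemma cg_couple_down_up:
  "\<exists>\<alpha>. (b = 0 \<longrightarrow> \<alpha> = 0) \<and> (\<forall>x y. 0 \<le> x \<and> x \<le> int (a + b) + 1 \<and> 0 \<le> y \<and> y \<le> int (a + c) + 1 \<longrightarrow>
     halfc (a + b) x * halfc (a + c) (int (a + c) + 1 - y) * cg a b c x y
     + halfc (a + b) (int (a + b) + 1 - x) * halfc (a + c) y * cg a b c (x - 1) (y - 1)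
     = \<alpha> * cg a (b - 1) (Suc c) (x - 1) y)"
proof -
  from cg_couple_up_down[of b a c] obtain \<alpha> where
    \<alpha>: "b = 0 \<longrightarrow> \<alpha> = 0"
    "\<And>x y. 0 \<le> y \<and> y \<le> int (a + c) + 1 \<and> 0 \<le> x \<and> x \<le> int (a + b) + 1 \<Longrightarrow>
     halfc (a + c) (int (a + c) + 1 - y) * halfc (a + b) x * cg a c b y x
     + halfc (a + c) y * halfc (a + b) (int (a + b) + 1 - x) * cg a c b (y - 1) (x - 1)
     = \<alpha> * cg a (Suc c) (b - 1) y (x - 1)" by blast
  show ?thesis
    unfolding cg_swap[of a b c] cg_swap[of a "b - 1" "Suc c"]
    by (rule exI[of _ \<alpha>]) (use \<alpha> in \<open>simp add: mult_ac\<close>)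
qed

text \<open>
  After the common root is extracted, this is the contiguity relation that lowers \<open>a\<close>. If \<open>a = 0\<close> there is no
  admissible triple on the right and \<open>\<alpha> = 0\<close>.
\<close>

lemma cg_couple_down_down:
  "\<exists>\<alpha>. (a = 0 \<longrightarrow> \<alpha> = 0) \<and> (\<forall>x y. 0 \<le> x \<and> x \<le> int (a + b) + 1 \<and> 0 \<le> y \<and> y \<le> int (a + c) + 1 \<longrightarrow>
     halfc (a + b) (int (a + b) + 1 - x) * halfc (a + c) (int (a + c) + 1 - y) * cg a b c (x - 1) (y - 1)
     - halfc (a + b) x * halfc (a + c) y * cg a b c x y
     = \<alpha> * cg (a - 1) b c (x - 1) (y - 1))"
proof -
  define R where "R = sqrt (real (a + b + 1) * real (a + c + 1))"
  have R: "R > 0" by (simp add: R_def)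
  define k where "k = real a * real (a + b + c + 1)"
  have main: "halfc (a + b) (int (a + b) + 1 - x) * halfc (a + c) (int (a + c) + 1 - y) * cg a b c (x - 1) (y - 1)
     - halfc (a + b) x * halfc (a + c) y * cg a b c x y
     = cg_norm a b c * k / (R * cg_norm (a - 1) b c) * cg (a - 1) b c (x - 1) (y - 1)"
    if xy: "0 \<le> x" "x \<le> int (a + b) + 1" "0 \<le> y" "y \<le> int (a + c) + 1" for x y
  proof -
    define K where "K = ifact (int b - x + y) * ifact (int c + x - y)
      * (ifact (x - 1) * ifact (int (a + b) - x) * ifact (y - 1) * ifact (int (a + c) - y))"
    define X where "X = int (a + b) + 1 - x"
    define Y where "Y = int (a + c) + 1 - y"
    have XY: "X \<ge> 0" "Y \<ge> 0" using xy by (auto simp: X_def Y_def)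
    have 1: "halfc (a + b) x * halfc (a + c) y * sqrt (cg_root a b c x y)
        * bracket_coeff a b c x y = sqrt K / R * (of_int x * of_int y * bracket_coeff a b c x y)"
    proof (cases "0 < x \<and> 0 < y")
      case True
      have "of_int x * of_int y * cg_root a b c x y = K * (of_int x * of_int y)\<^sup>2"
      proof -
        have "of_int x * ifact (x - 1) = ifact x" "of_int y * ifact (y - 1) = ifact y"
          by (rule ifact_mult; use True in simp)+
        note this [symmetric]
        then show ?thesis unfolding cg_root_def K_def power2_eq_square by (simp only: mult_ac)
      qed
      then show ?thesis using xy by (simp add: halfc_mult_sqrt R_def real_sqrt_mult)
    next
      case False
      then have "x = 0 \<or> y = 0" using xy by auto
      then show ?thesis by (auto simp: halfc_def)
    qed
    have 2: "halfc (a + b) X * halfc (a + c) Y * sqrt (cg_root a b c (x - 1) (y - 1))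
        * bracket_coeff a b c (x - 1) (y - 1)
        = sqrt K / R * (of_int X * of_int Y * bracket_coeff a b c (x - 1) (y - 1))"
    proof (cases "0 < X \<and> 0 < Y")
      case True
      have "of_int X * of_int Y * cg_root a b c (x - 1) (y - 1) = K * (of_int X * of_int Y)\<^sup>2"
      proof -
        have "of_int X * ifact (int (a + b) - x) = ifact X" "of_int Y * ifact (int (a + c) - y) = ifact Y"
          by (rule ifact_mult; use True in \<open>simp add: X_def Y_def\<close>)+
        note this [symmetric]
        moreover have "int b - (x - 1) + (y - 1) = int b - x + y" "int c + (x - 1) - (y - 1) = int c + x - y"
          "int (a + b) - (x - 1) = X" "int (a + c) - (y - 1) = Y"
          by (auto simp: X_def Y_def)
        ultimately show ?thesis unfolding cg_root_def K_def power2_eq_square by (simp only: mult_ac)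
      qed
      then show ?thesis using XY by (simp add: halfc_mult_sqrt R_def real_sqrt_mult)
    next
      case False
      then have "X = 0 \<or> Y = 0" using XY by auto
      then show ?thesis by (auto simp: halfc_def)
    qed
    have contig: "of_int X * of_int Y * bracket_coeff a b c (x - 1) (y - 1)
        - of_int x * of_int y * bracket_coeff a b c x y
        = k * bracket_coeff (a - 1) b c (x - 1) (y - 1)"
    proof -
      have "real (a + b) - of_int (x - 1) = of_int X" "real (a + c) - of_int (y - 1) = of_int Y"
        by (auto simp: X_def Y_def)
      then show ?thesis
        using bracket_coeff_contig_down_a[of a b "x - 1" c "y - 1"]
        by (simp add: k_def)
    qed
    have "halfc (a + b) X * halfc (a + c) Y * cg a b c (x - 1) (y - 1)
        - halfc (a + b) x * halfc (a + c) y * cg a b c x y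
      = cg_norm a b c * (halfc (a + b) X * halfc (a + c) Y
            * sqrt (cg_root a b c (x - 1) (y - 1)) * bracket_coeff a b c (x - 1) (y - 1))
        - cg_norm a b c * (halfc (a + b) x * halfc (a + c) y
            * sqrt (cg_root a b c x y) * bracket_coeff a b c x y)"
      by (simp only: cg_def mult_ac)
    also have "\<dots> = cg_norm a b c * sqrt K / R * (of_int X * of_int Y * bracket_coeff a b c (x - 1) (y - 1)
        - of_int x * of_int y * bracket_coeff a b c x y)"
      unfolding 1 2 by (simp only: right_diff_distrib) simp
    also have "\<dots> = cg_norm a b c * sqrt K / R * (k * bracket_coeff (a - 1) b c (x - 1) (y - 1))"
      unfolding contig ..
    also have "\<dots> = cg_norm a b c * k / (R * cg_norm (a - 1) b c) * cg (a - 1) b c (x - 1) (y - 1)"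
    proof (cases "a = 0")
      case False
      then have "cg_root (a - 1) b c (x - 1) (y - 1) = K"
        unfolding cg_root_def K_def by (simp add: of_nat_diff algebra_simps)
      then show ?thesis
        using cg_norm_pos[of "a - 1" b c] by (simp only: cg_def) simp
    qed (simp add: k_def)
    finally show ?thesis by (simp only: X_def Y_def)
  qed
  show ?thesis
    by (rule exI[of _ "cg_norm a b c * k / (R * cg_norm (a - 1) b c)"])
       (use main in \<open>auto simp: k_def\<close>)
qed

lemma finite_weights: "2 * l \<in> \<nat> \<Longrightarrow> finite (weights l)"
  by (elim Nats_cases) (simp add: weights_eq_below)

lemma weights_half: "weights (1/2) = {-1/2, 1/2}"
  using weights_eq_below[of "1/2" 1] by (auto simp: atMost_Suc)

lemma CG_triple_cases:
  assumes "CG_triple l1 l2 l"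
  obtains a b c where "l1 = real (a + b) / 2" "l2 = real (a + c) / 2" "l = real (b + c) / 2"
  using assms CG_triple_iff by blast

text \<open>
  For the highest weight \<open>l\<close> the second weight is determined by the first, so the double sum is the
  single sum of \<open>cg_highest_norm\<close>.
\<close>

lemma CG_highest_norm:
  assumes "CG_triple m1 m2 l"
  shows "(\<Sum>n1\<in>weights m1. \<Sum>n2\<in>weights m2. (CG m1 m2 l n1 n2 l)\<^sup>2) = 1"
proof -
  from assms obtain a b c where e: "m1 = real (a + b) / 2" "m2 = real (a + c) / 2" "l = real (b + c) / 2"
    by (rule CG_triple_cases)
  have d: "2 * m1 = real (a + b)" "2 * m2 = real (a + c)" using e by auto
  have fin: "finite (weights m2)" by (rule finite_weights) (simp only: d of_nat_in_Nats)
  have inner: "(\<Sum>n2\<in>weights m2. (CG m1 m2 l n1 n2 l)\<^sup>2) = (CG m1 m2 l n1 (l - n1) l)\<^sup>2" for n1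
  proof -
    have "(\<Sum>n2\<in>weights m2. (CG m1 m2 l n1 n2 l)\<^sup>2)
        = (\<Sum>n2\<in>weights m2. if n2 = l - n1 then (CG m1 m2 l n1 (l - n1) l)\<^sup>2 else 0)"
      by (rule sum.cong) (auto simp: CG_def)
    also have "\<dots> = (CG m1 m2 l n1 (l - n1) l)\<^sup>2"
      using fin by (auto simp: CG_def)
    finally show ?thesis .
  qed
  have "(\<Sum>n1\<in>weights m1. (CG m1 m2 l n1 (l - n1) l)\<^sup>2)
      = (\<Sum>x\<le>a + b. (CG m1 m2 l (m1 - real x) (l - (m1 - real x)) l)\<^sup>2)"
    unfolding weights_eq_below[OF d(1)] by (subst sum.reindex) (auto simp: inj_on_def)
  also have "\<dots> = (\<Sum>x\<le>a + b. (cg a b c (int x) (int c + int x))\<^sup>2)"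
    by (intro sum.cong refl arg_cong[where f = power2] CG_eq_cg[OF e])
       (use e in \<open>auto simp: field_simps\<close>)
  also have "\<dots> = (\<Sum>x\<le>a. (cg a b c (int x) (int c + int x))\<^sup>2)"
    by (rule sum.mono_neutral_right) (auto simp: cg_expand bracket_coeff_outside)
  also have "\<dots> = 1" by (rule cg_highest_norm)
  finally show ?thesis unfolding inner .
qed

section \<open>Coupling with two spins one half\<close>

text \<open>
  The classical table of coefficients for coupling \<open>l\<close> with spin one half to \<open>l + s\<close>, where
  \<open>i\<close> is the weight of the spin one half and \<open>n\<close> the total weight. The factor \<open>2 * s\<close>
  is the sign.
\<close>

definition spin_half_CG :: "real \<Rightarrow> real \<Rightarrow> real \<Rightarrow> real \<Rightarrow> real" where
  "spin_half_CG l s i n = (if s = i then sqrt ((l + 1/2 + n) / (2 * l + 1))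
     else 2 * s * sqrt ((l + 1/2 - n) / (2 * l + 1)))"

lemma sqrt_mult_sqrt_mult: "C \<ge> 0 \<Longrightarrow> sqrt A * sqrt B * C = sqrt (A * B * C\<^sup>2)"
  by (simp add: real_sqrt_mult)

lemma CG_spin_half:
  assumes l: "2 * l = real N" and s: "s \<in> {-1/2, 1/2}" and i: "i \<in> {-1/2, 1/2}"
    and n: "n \<in> weights (l + s)" and j: "n - i \<in> weights l"
  shows "CG l (1/2) (l + s) (n - i) i n = spin_half_CG l s i n"
proof -
  from j obtain x where x: "x \<le> N" "n - i = l - real x"
    unfolding weights_eq_below[OF l] by auto
  have fp: "fact (Suc k) = real (Suc k) * fact k" for k by simp
  show ?thesis
  proof (cases "s = 1/2")
    case True
    have e: "l = real (0 + N) / 2" "1/2 = real (0 + 1) / 2" "l + s = real (N + 1) / 2"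
      using l True by auto
    have R: "real (N + 1 + 1) / (fact 0 * fact N * fact 1 * fact (0 + N + 1 + 1))
        = 1 / (fact N * fact (Suc N) :: real)"
      by (simp add: fp del: fact_Suc)
    have b: "real (N choose x) = fact N / (fact x * fact (N - x))"
      using x(1) by (rule binomial_fact)
    show ?thesis
    proof (cases "i = 1/2")
      case i: True
      have "CG l (1/2) (l + s) (n - i) i n = cg 0 N 1 (int x) 1"
        by (rule CG_eq_cg[OF e]) (use x i in auto)
      also have "\<dots> = sqrt (1 / (fact N * fact (Suc N))) * sqrt (fact (Suc (N - x)) * fact x * (fact x * fact (N - x)))
           * real (N choose x)"
      proof -
        have "int N - int x + 1 = int (Suc (N - x))" "int 1 + int x - 1 = int x" "int (0 + N) - int x = int (N - x)"
          using x by auto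
        then show ?thesis unfolding cg_expand R
          by (simp only: ifact_def nat_int) (simp add: binom_int_def del: fact_Suc)
      qed
      also have "\<dots> = sqrt (real (Suc (N - x)) / real (Suc N))"
        unfolding sqrt_mult_sqrt_mult[OF of_nat_0_le_iff] unfolding b
        by (simp add: fp power2_eq_square del: fact_Suc)
      also have "real (Suc (N - x)) = l + 1/2 + n"
        using x l i by (simp add: of_nat_diff)
      also have "real (Suc N) = 2 * l + 1" using l by simp
      finally show ?thesis unfolding True i by (simp add: spin_half_CG_def)
    next
      case False
      then have i: "i = -1/2" using i by auto
      have "CG l (1/2) (l + s) (n - i) i n = cg 0 N 1 (int x) 0"
        by (rule CG_eq_cg[OF e]) (use x i in auto)
      also have "\<dots> = sqrt (1 / (fact N * fact (Suc N))) * sqrt (fact (N - x) * fact (Suc x) * (fact x * fact (N - x)))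
           * real (N choose x)"
      proof -
        have "int N - int x + 0 = int (N - x)" "int 1 + int x - 0 = int (Suc x)" "int (0 + N) - int x = int (N - x)"
          using x by auto
        then show ?thesis unfolding cg_expand R
          by (simp only: ifact_def nat_int) (simp add: binom_int_def del: fact_Suc)
      qed
      also have "\<dots> = sqrt (real (Suc x) / real (Suc N))"
        unfolding sqrt_mult_sqrt_mult[OF of_nat_0_le_iff] unfolding b
        by (simp add: fp power2_eq_square del: fact_Suc)
      also have "real (Suc x) = l + 1/2 - n"
        using x l i by simp
      also have "real (Suc N) = 2 * l + 1" using l by simp
      finally show ?thesis unfolding True i by (simp add: spin_half_CG_def)
    qed
  next
    case False
    then have s': "s = -1/2" using s by auto
    from n have "\<bar>n\<bar> \<le> l + s" by (simp add: weights_def)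
    then have nl: "\<bar>n\<bar> \<le> l - 1/2" using s' by simp
    then have "N \<noteq> 0" using l by auto
    then obtain M where M: "N = Suc M" by (cases N) auto
    have e: "l = real (1 + M) / 2" "1/2 = real (1 + 0) / 2" "l + s = real (M + 0) / 2"
      using l s' M by auto
    have R: "real (M + 0 + 1) / (fact 1 * fact M * fact 0 * fact (1 + M + 0 + 1))
        = real (Suc M) / (fact M * fact (Suc N))"
      using M by (simp del: fact_Suc)
    show ?thesis
    proof (cases "i = 1/2")
      case i: True
      have "real x \<noteq> 0" using x(2) i nl by auto
      then obtain z where z: "x = Suc z" by (cases x) auto
      have zM: "z \<le> M" using x z M by simp
      have b: "real (M choose z) = fact M / (fact z * fact (M - z))"
        using zM by (rule binomial_fact)
      have "CG l (1/2) (l + s) (n - i) i n = cg 1 M 0 (int x) 1"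
        by (rule CG_eq_cg[OF e]) (use x i z M in auto)
      also have "\<dots> = - (sqrt (real (Suc M) / (fact M * fact (Suc N))) * sqrt (fact (M - z) * fact z * (fact (Suc z) * fact (M - z)))
           * real (M choose z))"
      proof -
        have "int M - int x + 1 = int (M - z)" "int 0 + int x - 1 = int z" "int (1 + M) - int x = int (M - z)"
          "int x = int (Suc z)"
          using z zM by auto
        moreover have "bracket_coeff 1 M 0 (int x) 1 = - real (M choose z)"
          using z by (simp add: binom_int_0) (simp add: binom_int_def)
        ultimately show ?thesis unfolding cg_expand R
          by (simp only: ifact_def nat_int) (simp del: fact_Suc)
      qed
      also have "\<dots> = - sqrt (real (Suc z) / real (Suc N))"
        unfolding sqrt_mult_sqrt_mult[OF of_nat_0_le_iff] unfolding b
        by (simp add: fp M power2_eq_square del: fact_Suc of_nat_Suc)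
      also have "real (Suc z) = l + 1/2 - n"
        using x l i z by simp
      also have "real (Suc N) = 2 * l + 1" using l by simp
      finally show ?thesis unfolding s' i by (simp add: spin_half_CG_def)
    next
      case False
      then have i: "i = -1/2" using i by auto
      have "real x \<noteq> real N" using x(2) i nl l by auto
      then have xM: "x \<le> M" using x M by auto
      have b: "real (M choose x) = fact M / (fact x * fact (M - x))"
        using xM by (rule binomial_fact)
      have "CG l (1/2) (l + s) (n - i) i n = cg 1 M 0 (int x) 0"
        by (rule CG_eq_cg[OF e]) (use x i xM in auto)
      also have "\<dots> = sqrt (real (Suc M) / (fact M * fact (Suc N))) * sqrt (fact (M - x) * fact x * (fact x * fact (Suc (M - x))))
           * real (M choose x)"
      proof -
        have "int M - int x + 0 = int (M - x)" "int 0 + int x - 0 = int x" "int (1 + M) - int x = int (Suc (M - x))"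
          using xM by auto
        moreover have "bracket_coeff 1 M 0 (int x) 0 = real (M choose x)"
          by (simp add: binom_int_0) (simp add: binom_int_def)
        ultimately show ?thesis unfolding cg_expand R
          by (simp only: ifact_def nat_int) (simp add: ifact_def del: fact_Suc)
      qed
      also have "\<dots> = sqrt (real (Suc (M - x)) / real (Suc N))"
        unfolding sqrt_mult_sqrt_mult[OF of_nat_0_le_iff] unfolding b
        by (simp add: fp M power2_eq_square del: fact_Suc of_nat_Suc)
      also have "real (Suc (M - x)) = l + 1/2 + n"
        using x l i xM M by (simp add: of_nat_diff)
      also have "real (Suc N) = 2 * l + 1" using l by simp
      finally show ?thesis unfolding s' i by (simp add: spin_half_CG_def)
    qed
  qed
qed

text \<open>
  The component along \<open>n1, n2\<close> in \<open>H\<^sup>m\<^sup>1 \<otimes> H\<^sup>m\<^sup>2\<close>, \<open>m1 = l1 + s1\<close>, \<open>m2 = l2 + s2\<close>, of the image of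
  \<open>psi l q\<close> tensored with the invariant vector
  \<open>(psi (1/2) (1/2) \<otimes> psi (1/2) (-1/2) - psi (1/2) (-1/2) \<otimes> psi (1/2) (1/2)) / sqrt 2\<close>.
\<close>

definition coupled :: "real \<Rightarrow> real \<Rightarrow> real \<Rightarrow> real \<Rightarrow> real \<Rightarrow> real \<Rightarrow> real \<Rightarrow> real \<Rightarrow> real" where
  "coupled l l1 l2 s1 s2 q n1 n2 =
     (spin_half_CG l1 s1 (1/2) n1 * spin_half_CG l2 s2 (-1/2) n2 * CG l1 l2 l (n1 - 1/2) (n2 + 1/2) q
      - spin_half_CG l1 s1 (-1/2) n1 * spin_half_CG l2 s2 (1/2) n2 * CG l1 l2 l (n1 + 1/2) (n2 - 1/2) q)
     / sqrt 2"

text \<open>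
  This is the instance of Schur's lemma that the recurrence rests on: the factor depends on the spins only. It is
  assembled from the four contiguity relations, one for each choice of signs. When the target triple is not
  admissible, the factor is zero.
\<close>

lemma coupled_proportional:
  assumes T: "CG_triple l1 l2 l" and s: "s1 \<in> {-1/2, 1/2}" "s2 \<in> {-1/2, 1/2}"
  shows "\<exists>\<alpha>. (s1 = 1/2 \<and> s2 = 1/2 \<longrightarrow> \<alpha> > 0) \<and>
     (\<forall>q\<in>weights l. \<forall>n1\<in>weights (l1 + 1/2). \<forall>n2\<in>weights (l2 + 1/2).
        coupled l l1 l2 s1 s2 q n1 n2 = \<alpha> * CG (l1 + s1) (l2 + s2) l n1 n2 q)"
proof -
  from T obtain a b c where e: "l1 = real (a + b) / 2" "l2 = real (a + c) / 2" "l = real (b + c) / 2"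
    by (rule CG_triple_cases)
  have d: "2 * l = real (b + c)" "2 * (l1 + 1/2) = real (a + b + 1)" "2 * (l2 + 1/2) = real (a + c + 1)"
    using e by auto
  \<comment> \<open>With \<open>x = l1 + 1/2 - n1\<close> and \<open>y = l2 + 1/2 + n2\<close>, the four values of \<open>spin_half_CG\<close> up to sign.\<close>
  define up1 where "up1 x = halfc (a + b) (int (a + b) + 1 - x)" for x
  define dn1 where "dn1 x = halfc (a + b) x" for x
  define up2 where "up2 y = halfc (a + c) y" for y
  define dn2 where "dn2 y = halfc (a + c) (int (a + c) + 1 - y)" for y
  have param: "\<exists>x y. 0 \<le> x \<and> x \<le> int (a + b) + 1 \<and> 0 \<le> y \<and> y \<le> int (a + c) + 1
      \<and> 0 \<le> int b - x + y \<and> 0 \<le> int c + x - y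
      \<and> n1 = l1 + 1/2 - of_int x \<and> n2 = of_int y - (l2 + 1/2)"
    if q: "q \<in> weights l" and n1: "n1 \<in> weights (l1 + 1/2)" and n2: "n2 \<in> weights (l2 + 1/2)"
      and nq: "n1 + n2 = q" for q n1 n2
  proof -
    from n1 obtain x where x: "x \<le> a + b + 1" "n1 = l1 + 1/2 - real x"
      unfolding weights_eq_below[OF d(2)] by auto
    from n2 obtain y where y: "y \<le> a + c + 1" "n2 = real y - (l2 + 1/2)"
      unfolding weights_eq_above[OF d(3)] by auto
    from q have "\<bar>q\<bar> \<le> l" by (simp add: weights_def)
    then have "\<bar>l1 - l2 - real x + real y\<bar> \<le> l" using x y nq by simp
    then have "real x \<le> real b + real y" "real y \<le> real c + real x"
      using e by (auto simp: abs_if field_simps split: if_splits)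
    then have "x \<le> b + y" "y \<le> c + x"
      unfolding of_nat_add[symmetric] of_nat_le_iff by auto
    then show ?thesis
      using x y by (intro exI[of _ "int x"] exI[of _ "int y"]) auto
  qed
  have coeffs: "spin_half_CG l1 s (1/2) (l1 + 1/2 - of_int x) = (if s = 1/2 then up1 x else - dn1 x)"
      "spin_half_CG l1 s (-1/2) (l1 + 1/2 - of_int x) = (if s = 1/2 then dn1 x else up1 x)"
      "spin_half_CG l2 s (1/2) (of_int y - (l2 + 1/2)) = (if s = 1/2 then up2 y else - dn2 y)"
      "spin_half_CG l2 s (-1/2) (of_int y - (l2 + 1/2)) = (if s = 1/2 then dn2 y else up2 y)"
    if "s \<in> {-1/2, 1/2}" for s x y
  proof -
    have num: "l1 + 1/2 + (l1 + 1/2 - of_int x) = of_int (int (a + b) + 1 - x)"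
      "l1 + 1/2 - (l1 + 1/2 - of_int x) = of_int x" "2 * l1 + 1 = real (a + b + 1)"
      "l2 + 1/2 + (of_int y - (l2 + 1/2)) = of_int y"
      "l2 + 1/2 - (of_int y - (l2 + 1/2)) = of_int (int (a + c) + 1 - y)" "2 * l2 + 1 = real (a + c + 1)"
      using e by (auto simp: field_simps)
    have h: "sqrt ((l1 + 1/2 + (l1 + 1/2 - of_int x)) / (2 * l1 + 1)) = up1 x"
      "sqrt ((l1 + 1/2 - (l1 + 1/2 - of_int x)) / (2 * l1 + 1)) = dn1 x"
      "sqrt ((l2 + 1/2 + (of_int y - (l2 + 1/2))) / (2 * l2 + 1)) = up2 y"
      "sqrt ((l2 + 1/2 - (of_int y - (l2 + 1/2))) / (2 * l2 + 1)) = dn2 y"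
      unfolding num up1_def dn1_def up2_def dn2_def halfc_def by (rule refl)+
    from that consider "s = 1/2" | "s = -1/2" by auto
    then show "spin_half_CG l1 s (1/2) (l1 + 1/2 - of_int x) = (if s = 1/2 then up1 x else - dn1 x)"
      "spin_half_CG l1 s (-1/2) (l1 + 1/2 - of_int x) = (if s = 1/2 then dn1 x else up1 x)"
      "spin_half_CG l2 s (1/2) (of_int y - (l2 + 1/2)) = (if s = 1/2 then up2 y else - dn2 y)"
      "spin_half_CG l2 s (-1/2) (of_int y - (l2 + 1/2)) = (if s = 1/2 then dn2 y else up2 y)"
      unfolding spin_half_CG_def h by (cases; simp)+
  qed
  \<comment> \<open>It remains to compare both sides in the coordinates \<open>x, y\<close>; the constant \<open>1 / sqrt 2\<close> is absorbed into the factor.\<close>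
  have reduce: "\<exists>\<alpha>. (s1 = 1/2 \<and> s2 = 1/2 \<longrightarrow> \<alpha> > 0) \<and>
     (\<forall>q\<in>weights l. \<forall>n1\<in>weights (l1 + 1/2). \<forall>n2\<in>weights (l2 + 1/2).
        coupled l l1 l2 s1 s2 q n1 n2 = \<alpha> * CG (l1 + s1) (l2 + s2) l n1 n2 q)"
    if pos: "s1 = 1/2 \<and> s2 = 1/2 \<longrightarrow> \<alpha> > 0"
      and main: "\<And>x y. 0 \<le> x \<and> x \<le> int (a + b) + 1 \<and> 0 \<le> y \<and> y \<le> int (a + c) + 1 \<Longrightarrow>
        0 \<le> int b - x + y \<Longrightarrow> 0 \<le> int c + x - y \<Longrightarrow>
        (if s1 = 1/2 then up1 x else - dn1 x) * (if s2 = 1/2 then dn2 y else up2 y) * cg a b c x y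
        - (if s1 = 1/2 then dn1 x else up1 x) * (if s2 = 1/2 then up2 y else - dn2 y) * cg a b c (x - 1) (y - 1)
        = \<alpha> * CG (l1 + s1) (l2 + s2) l (l1 + 1/2 - of_int x) (of_int y - (l2 + 1/2))
             (l1 + 1/2 - of_int x + (of_int y - (l2 + 1/2)))" for \<alpha>
  proof (intro exI[of _ "\<alpha> / sqrt 2"] conjI ballI)
    fix q n1 n2
    assume q: "q \<in> weights l" and n: "n1 \<in> weights (l1 + 1/2)" "n2 \<in> weights (l2 + 1/2)"
    show "coupled l l1 l2 s1 s2 q n1 n2 = \<alpha> / sqrt 2 * CG (l1 + s1) (l2 + s2) l n1 n2 q"
    proof (cases "n1 + n2 = q")
      case True
      obtain x y where xy: "0 \<le> x \<and> x \<le> int (a + b) + 1 \<and> 0 \<le> y \<and> y \<le> int (a + c) + 1"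
        "0 \<le> int b - x + y" "0 \<le> int c + x - y"
        and nn: "n1 = l1 + 1/2 - of_int x" "n2 = of_int y - (l2 + 1/2)"
        using param[OF q n True] by blast
      have u: "CG l1 l2 l (n1 - 1/2) (n2 + 1/2) q = cg a b c x y"
        by (rule CG_eq_cg[OF e]) (use nn xy True in auto)
      have w: "CG l1 l2 l (n1 + 1/2) (n2 - 1/2) q = cg a b c (x - 1) (y - 1)"
        by (rule CG_eq_cg[OF e]) (use nn xy True in auto)
      have "coupled l l1 l2 s1 s2 q n1 n2 =
        ((if s1 = 1/2 then up1 x else - dn1 x) * (if s2 = 1/2 then dn2 y else up2 y) * cg a b c x y
        - (if s1 = 1/2 then dn1 x else up1 x) * (if s2 = 1/2 then up2 y else - dn2 y) * cg a b c (x - 1) (y - 1))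
        / sqrt 2"
        unfolding coupled_def u w unfolding nn coeffs[OF s(1)] coeffs[OF s(2)] ..
      also have "\<dots> = \<alpha> / sqrt 2 * CG (l1 + s1) (l2 + s2) l n1 n2 q"
        unfolding main[OF xy] True[symmetric] nn by simp
      finally show ?thesis .
    next
      case False
      then show ?thesis by (simp add: coupled_def CG_def)
    qed
  qed (use pos in auto)
  consider "s1 = 1/2" "s2 = 1/2" | "s1 = 1/2" "s2 = -1/2" | "s1 = -1/2" "s2 = 1/2" | "s1 = -1/2" "s2 = -1/2"
    using s by auto
  then show ?thesis
  proof cases
    case 1
    obtain \<alpha> where \<alpha>: "\<alpha> > 0" "\<And>x y. 0 \<le> x \<and> x \<le> int (a + b) + 1 \<and> 0 \<le> y \<and> y \<le> int (a + c) + 1 \<Longrightarrow>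
      up1 x * dn2 y * cg a b c x y - dn1 x * up2 y * cg a b c (x - 1) (y - 1) = \<alpha> * cg (Suc a) b c x y"
      using cg_couple_up_up[of a b c] unfolding up1_def dn1_def up2_def dn2_def by blast
    show ?thesis
    proof (rule reduce[of \<alpha>])
      fix x y assume xy: "0 \<le> x \<and> x \<le> int (a + b) + 1 \<and> 0 \<le> y \<and> y \<le> int (a + c) + 1"
        "0 \<le> int b - x + y" "0 \<le> int c + x - y"
      have "CG (l1 + s1) (l2 + s2) l (l1 + 1/2 - of_int x) (of_int y - (l2 + 1/2))
             (l1 + 1/2 - of_int x + (of_int y - (l2 + 1/2))) = cg (Suc a) b c x y"
        by (rule CG_eq_cg) (use e 1 xy in auto)
      with \<alpha>(2)[OF xy(1)] 1 show "(if s1 = 1/2 then up1 x else - dn1 x) * (if s2 = 1/2 then dn2 y else up2 y) * cg a b c x y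
        - (if s1 = 1/2 then dn1 x else up1 x) * (if s2 = 1/2 then up2 y else - dn2 y) * cg a b c (x - 1) (y - 1)
        = \<alpha> * CG (l1 + s1) (l2 + s2) l (l1 + 1/2 - of_int x) (of_int y - (l2 + 1/2))
             (l1 + 1/2 - of_int x + (of_int y - (l2 + 1/2)))" by simp
    qed (use \<alpha> in simp)
  next
    case 2
    obtain \<alpha> where \<alpha>: "c = 0 \<longrightarrow> \<alpha> = 0" "\<And>x y. 0 \<le> x \<and> x \<le> int (a + b) + 1 \<and> 0 \<le> y \<and> y \<le> int (a + c) + 1 \<Longrightarrow>
      up1 x * up2 y * cg a b c x y + dn1 x * dn2 y * cg a b c (x - 1) (y - 1) = \<alpha> * cg a (Suc b) (c - 1) x (y - 1)"
      using cg_couple_up_down[of c a b] unfolding up1_def dn1_def up2_def dn2_def by blast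
    show ?thesis
    proof (rule reduce[of \<alpha>])
      fix x y assume xy: "0 \<le> x \<and> x \<le> int (a + b) + 1 \<and> 0 \<le> y \<and> y \<le> int (a + c) + 1"
        "0 \<le> int b - x + y" "0 \<le> int c + x - y"
      have "CG (l1 + s1) (l2 + s2) l (l1 + 1/2 - of_int x) (of_int y - (l2 + 1/2))
             (l1 + 1/2 - of_int x + (of_int y - (l2 + 1/2))) = cg a (Suc b) (c - 1) x (y - 1)" if "c \<noteq> 0"
        by (rule CG_eq_cg) (use e 2 xy that in \<open>auto simp: of_nat_diff field_simps\<close>)
      with \<alpha>(1) \<alpha>(2)[OF xy(1)] 2 show "(if s1 = 1/2 then up1 x else - dn1 x) * (if s2 = 1/2 then dn2 y else up2 y) * cg a b c x y
        - (if s1 = 1/2 then dn1 x else up1 x) * (if s2 = 1/2 then up2 y else - dn2 y) * cg a b c (x - 1) (y - 1)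
        = \<alpha> * CG (l1 + s1) (l2 + s2) l (l1 + 1/2 - of_int x) (of_int y - (l2 + 1/2))
             (l1 + 1/2 - of_int x + (of_int y - (l2 + 1/2)))"
        by (cases "c = 0") simp_all
    qed (use 2 in simp)
  next
    case 3
    obtain \<alpha> where \<alpha>: "b = 0 \<longrightarrow> \<alpha> = 0" "\<And>x y. 0 \<le> x \<and> x \<le> int (a + b) + 1 \<and> 0 \<le> y \<and> y \<le> int (a + c) + 1 \<Longrightarrow>
      dn1 x * dn2 y * cg a b c x y + up1 x * up2 y * cg a b c (x - 1) (y - 1) = \<alpha> * cg a (b - 1) (Suc c) (x - 1) y"
      using cg_couple_down_up[of b a c] unfolding up1_def dn1_def up2_def dn2_def by blast
    show ?thesis
    proof (rule reduce[of "- \<alpha>"])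
      fix x y assume xy: "0 \<le> x \<and> x \<le> int (a + b) + 1 \<and> 0 \<le> y \<and> y \<le> int (a + c) + 1"
        "0 \<le> int b - x + y" "0 \<le> int c + x - y"
      have "CG (l1 + s1) (l2 + s2) l (l1 + 1/2 - of_int x) (of_int y - (l2 + 1/2))
             (l1 + 1/2 - of_int x + (of_int y - (l2 + 1/2))) = cg a (b - 1) (Suc c) (x - 1) y" if "b \<noteq> 0"
        by (rule CG_eq_cg) (use e 3 xy that in \<open>auto simp: of_nat_diff field_simps\<close>)
      with \<alpha>(1) \<alpha>(2)[OF xy(1)] 3 show "(if s1 = 1/2 then up1 x else - dn1 x) * (if s2 = 1/2 then dn2 y else up2 y) * cg a b c x y
        - (if s1 = 1/2 then dn1 x else up1 x) * (if s2 = 1/2 then up2 y else - dn2 y) * cg a b c (x - 1) (y - 1)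
        = - \<alpha> * CG (l1 + s1) (l2 + s2) l (l1 + 1/2 - of_int x) (of_int y - (l2 + 1/2))
             (l1 + 1/2 - of_int x + (of_int y - (l2 + 1/2)))"
        by (cases "b = 0") simp_all
    qed (use 3 in simp)
  next
    case 4
    obtain \<alpha> where \<alpha>: "a = 0 \<longrightarrow> \<alpha> = 0" "\<And>x y. 0 \<le> x \<and> x \<le> int (a + b) + 1 \<and> 0 \<le> y \<and> y \<le> int (a + c) + 1 \<Longrightarrow>
      up1 x * dn2 y * cg a b c (x - 1) (y - 1) - dn1 x * up2 y * cg a b c x y = \<alpha> * cg (a - 1) b c (x - 1) (y - 1)"
      using cg_couple_down_down[of a b c] unfolding up1_def dn1_def up2_def dn2_def by blast
    show ?thesis
    proof (rule reduce[of "\<alpha>"])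
      fix x y assume xy: "0 \<le> x \<and> x \<le> int (a + b) + 1 \<and> 0 \<le> y \<and> y \<le> int (a + c) + 1"
        "0 \<le> int b - x + y" "0 \<le> int c + x - y"
      have "CG (l1 + s1) (l2 + s2) l (l1 + 1/2 - of_int x) (of_int y - (l2 + 1/2))
             (l1 + 1/2 - of_int x + (of_int y - (l2 + 1/2))) = cg (a - 1) b c (x - 1) (y - 1)" if "a \<noteq> 0"
        by (rule CG_eq_cg) (use e 4 xy that in \<open>auto simp: of_nat_diff field_simps\<close>)
      with \<alpha>(1) \<alpha>(2)[OF xy(1)] 4 show "(if s1 = 1/2 then up1 x else - dn1 x) * (if s2 = 1/2 then dn2 y else up2 y) * cg a b c x y
        - (if s1 = 1/2 then dn1 x else up1 x) * (if s2 = 1/2 then up2 y else - dn2 y) * cg a b c (x - 1) (y - 1)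
        = \<alpha> * CG (l1 + s1) (l2 + s2) l (l1 + 1/2 - of_int x) (of_int y - (l2 + 1/2))
             (l1 + 1/2 - of_int x + (of_int y - (l2 + 1/2)))"
        by (cases "a = 0") simp_all
    qed (use 4 in simp)
  qed
qed

section \<open>Identification of the proportionality factor\<close>

lemma CG_half_half: "CG (1/2) (1/2) 0 (1/2) (-1/2) 0 = 1 / sqrt 2"
    "CG (1/2) (1/2) 0 (-1/2) (1/2) 0 = - 1 / sqrt 2"
proof -
  have e: "(1/2 :: real) = real (1 + 0) / 2" "(0 :: real) = real (0 + 0) / 2" by auto
  have "CG (1/2) (1/2) 0 (1/2) (-1/2) 0 = cg 1 0 0 0 0"
    by (rule CG_eq_cg) auto
  also have "\<dots> = 1 / sqrt 2"
    by (simp add: cg_expand ifact_def binom_int_def real_sqrt_divide numeral_2_eq_2)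
  finally show "CG (1/2) (1/2) 0 (1/2) (-1/2) 0 = 1 / sqrt 2" .
  have "CG (1/2) (1/2) 0 (-1/2) (1/2) 0 = cg 1 0 0 1 1"
    by (rule CG_eq_cg) auto
  also have "\<dots> = - 1 / sqrt 2"
    by (simp add: cg_expand ifact_def binom_int_def real_sqrt_divide numeral_2_eq_2)
  finally show "CG (1/2) (1/2) 0 (-1/2) (1/2) 0 = - 1 / sqrt 2" .
qed

lemma CG_outside: "j1 \<notin> weights l1 \<or> j2 \<notin> weights l2 \<or> \<not> CG_triple l1 l2 l \<Longrightarrow> CG l1 l2 l j1 j2 j = 0"
  by (auto simp: CG_def)

text \<open>
  Conservation of weight leaves a single term. If \<open>n - i\<close> is not a weight, the vanishing of \<open>g\<close> makes
  the formula correct nevertheless.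
\<close>

lemma sum_CG_spin_half:
  assumes l: "2 * l \<in> \<nat>" and s: "s \<in> {-1/2, 1/2}" and i: "i \<in> {-1/2, 1/2}"
    and n: "n \<in> weights (l + s)" and g: "\<And>j. j \<notin> weights l \<Longrightarrow> g j = 0"
  shows "(\<Sum>j\<in>weights l. g j * CG l (1/2) (l + s) j i n) = spin_half_CG l s i n * g (n - i)"
proof -
  from l obtain N where N: "2 * l = real N" by (rule Nats_cases)
  have "(\<Sum>j\<in>weights l. g j * CG l (1/2) (l + s) j i n)
      = (\<Sum>j\<in>weights l. if j = n - i then spin_half_CG l s i n * g (n - i) else 0)"
  proof (rule sum.cong[OF refl])
    fix j assume j: "j \<in> weights l"
    show "g j * CG l (1/2) (l + s) j i n = (if j = n - i then spin_half_CG l s i n * g (n - i) else 0)"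
    proof (cases "j = n - i")
      case True
      then show ?thesis using CG_spin_half[OF N s i n] j by simp
    qed (auto simp: CG_def)
  qed
  also have "\<dots> = spin_half_CG l s i n * g (n - i)"
    using finite_weights[OF l] g by auto
  finally show ?thesis .
qed

text \<open>
  Carrying out the sums over \<open>j1, j2, i1, i2\<close> first exhibits \<open>a_coeff\<close> as the inner product of the projected
  highest weight vector with the highest weight vector of \<open>H\<^sup>l\<close> inside \<open>H\<^sup>m\<^sup>1 \<otimes> H\<^sup>m\<^sup>2\<close>.
\<close>

lemma a_coeff_eq_inner_product:
  assumes T: "CG_triple l1 l2 l" and s: "s1 \<in> {-1/2, 1/2}" "s2 \<in> {-1/2, 1/2}"
  shows "a_coeff l (l1, l2) (l1 + s1, l2 + s2)
     = (\<Sum>n1\<in>weights (l1 + s1). \<Sum>n2\<in>weights (l2 + s2).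
          coupled l l1 l2 s1 s2 l n1 n2 * CG (l1 + s1) (l2 + s2) l n1 n2 l)"
proof -
  let ?m1 = "l1 + s1" and ?m2 = "l2 + s2"
  have N: "2 * l1 \<in> \<nat>" "2 * l2 \<in> \<nat>" using T by (auto simp: CG_triple_def)
  define f where "f j1 j2 i1 i2 n1 n2 = CG l1 l2 l j1 j2 l * CG (1/2) (1/2) 0 i1 i2 0
        * CG l1 (1/2) ?m1 j1 i1 n1 * CG l2 (1/2) ?m2 j2 i2 n2
        * CG ?m1 ?m2 l n1 n2 l" for j1 j2 i1 i2 n1 n2
  define I where "I = weights (1/2)"
  have "a_coeff l (l1, l2) (?m1, ?m2)
      = (\<Sum>(j1,j2,i1,i2,n1,n2)\<in>weights l1 \<times> weights l2 \<times> I \<times> I \<times> weights ?m1 \<times> weights ?m2. f j1 j2 i1 i2 n1 n2)"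
    unfolding a_coeff_def f_def I_def by (simp add: sum.cartesian_product)
  also have "\<dots> = (\<Sum>(n1,n2,i1,i2,j1,j2)\<in>weights ?m1 \<times> weights ?m2 \<times> I \<times> I \<times> weights l1 \<times> weights l2. f j1 j2 i1 i2 n1 n2)"
    by (rule sum.reindex_bij_witness[of _ "\<lambda>(n1,n2,i1,i2,j1,j2). (j1,j2,i1,i2,n1,n2)" "\<lambda>(j1,j2,i1,i2,n1,n2). (n1,n2,i1,i2,j1,j2)"]) auto
  also have "\<dots> = (\<Sum>n1\<in>weights ?m1. \<Sum>n2\<in>weights ?m2. \<Sum>i1\<in>I. \<Sum>i2\<in>I. \<Sum>j1\<in>weights l1. \<Sum>j2\<in>weights l2. f j1 j2 i1 i2 n1 n2)"
    by (simp add: sum.cartesian_product)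
  also have "\<dots> = (\<Sum>n1\<in>weights ?m1. \<Sum>n2\<in>weights ?m2.
          coupled l l1 l2 s1 s2 l n1 n2 * CG ?m1 ?m2 l n1 n2 l)"
  proof (intro sum.cong refl)
    fix n1 n2 assume n: "n1 \<in> weights ?m1" "n2 \<in> weights ?m2"
    have inner: "(\<Sum>j1\<in>weights l1. \<Sum>j2\<in>weights l2. f j1 j2 i1 i2 n1 n2)
        = spin_half_CG l1 s1 i1 n1 * spin_half_CG l2 s2 i2 n2 * CG l1 l2 l (n1 - i1) (n2 - i2) l
          * CG (1/2) (1/2) 0 i1 i2 0 * CG ?m1 ?m2 l n1 n2 l"
      if i: "i1 \<in> {-1/2, 1/2}" "i2 \<in> {-1/2, 1/2}" for i1 i2
    proof -
      have "(\<Sum>j2\<in>weights l2. f j1 j2 i1 i2 n1 n2)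
          = (spin_half_CG l2 s2 i2 n2 * CG l1 l2 l j1 (n2 - i2) l * CG (1/2) (1/2) 0 i1 i2 0 * CG ?m1 ?m2 l n1 n2 l)
            * CG l1 (1/2) ?m1 j1 i1 n1" for j1
      proof -
        have "(\<Sum>j2\<in>weights l2. f j1 j2 i1 i2 n1 n2)
            = (\<Sum>j2\<in>weights l2. CG l1 l2 l j1 j2 l * CG l2 (1/2) ?m2 j2 i2 n2)
              * (CG (1/2) (1/2) 0 i1 i2 0 * CG l1 (1/2) ?m1 j1 i1 n1 * CG ?m1 ?m2 l n1 n2 l)"
          unfolding f_def sum_distrib_right by (simp only: mult_ac)
        also have "(\<Sum>j2\<in>weights l2. CG l1 l2 l j1 j2 l * CG l2 (1/2) ?m2 j2 i2 n2)
            = spin_half_CG l2 s2 i2 n2 * CG l1 l2 l j1 (n2 - i2) l"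
          by (rule sum_CG_spin_half[OF N(2) s(2) i(2) n(2)]) (simp add: CG_outside)
        finally show ?thesis by (simp only: mult_ac)
      qed
      then have "(\<Sum>j1\<in>weights l1. \<Sum>j2\<in>weights l2. f j1 j2 i1 i2 n1 n2)
        = (\<Sum>j1\<in>weights l1. (spin_half_CG l2 s2 i2 n2 * CG l1 l2 l j1 (n2 - i2) l
            * CG (1/2) (1/2) 0 i1 i2 0 * CG ?m1 ?m2 l n1 n2 l) * CG l1 (1/2) ?m1 j1 i1 n1)"
        by simp
      also have "\<dots> = spin_half_CG l1 s1 i1 n1 * (spin_half_CG l2 s2 i2 n2 * CG l1 l2 l (n1 - i1) (n2 - i2) l
            * CG (1/2) (1/2) 0 i1 i2 0 * CG ?m1 ?m2 l n1 n2 l)"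
        by (rule sum_CG_spin_half[OF N(1) s(1) i(1) n(1)]) (simp add: CG_outside)
      finally show ?thesis by (simp only: mult_ac)
    qed
    have "CG (1/2) (1/2) 0 (1/2) (1/2) 0 = 0" "CG (1/2) (1/2) 0 (-1/2) (-1/2) 0 = 0"
      by (auto simp: CG_def)
    then have "(\<Sum>i1\<in>I. \<Sum>i2\<in>I. \<Sum>j1\<in>weights l1. \<Sum>j2\<in>weights l2. f j1 j2 i1 i2 n1 n2)
      = (\<Sum>j1\<in>weights l1. \<Sum>j2\<in>weights l2. f j1 j2 (1/2) (-1/2) n1 n2)
        + (\<Sum>j1\<in>weights l1. \<Sum>j2\<in>weights l2. f j1 j2 (-1/2) (1/2) n1 n2)"
      unfolding I_def weights_half by (simp add: inner)
    also have "\<dots> = coupled l l1 l2 s1 s2 l n1 n2 * CG ?m1 ?m2 l n1 n2 l"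
      by (simp add: inner CG_half_half[simplified] coupled_def field_simps)
    finally show "(\<Sum>i1\<in>I. \<Sum>i2\<in>I. \<Sum>j1\<in>weights l1. \<Sum>j2\<in>weights l2. f j1 j2 i1 i2 n1 n2)
      = coupled l l1 l2 s1 s2 l n1 n2 * CG ?m1 ?m2 l n1 n2 l" .
  qed
  finally show ?thesis .
qed

lemma weights_down_half_subset:
  assumes "2 * l \<in> \<nat>" "s \<in> {-1/2, 1/2}"
  shows "weights (l + s) \<subseteq> weights (l + 1/2)"
proof (cases "s = 1/2")
  case False
  then have s: "s = -1/2" using assms by auto
  show ?thesis
  proof
    fix n assume "n \<in> weights (l + s)"
    then have n: "\<bar>n\<bar> \<le> l - 1/2" "l - 1/2 - n \<in> \<int>" using s by (auto simp: weights_def)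
    have "l + 1/2 - n = (l - 1/2 - n) + 1" by simp
    then have "l + 1/2 - n \<in> \<int>" using n(2) by (metis Ints_1 Ints_add)
    then show "n \<in> weights (l + 1/2)" using n by (auto simp: weights_def)
  qed
next
  case True
  show ?thesis unfolding True ..
qed

lemma highest_in_weights: "2 * l \<in> \<nat> \<Longrightarrow> l \<in> weights l"
  by (auto simp: weights_def elim: Nats_cases)

text \<open>
  Since the highest weight vector has norm one, its inner product with \<open>\<alpha>\<close> times itself is \<open>\<alpha>\<close>.
\<close>

lemma a_coeff_as_proportionality_factor:
  assumes T: "CG_triple l1 l2 l" and s: "s1 \<in> {-1/2, 1/2}" "s2 \<in> {-1/2, 1/2}"
  obtains \<alpha> where "s1 = 1/2 \<and> s2 = 1/2 \<longrightarrow> \<alpha> > 0"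
    and "\<And>q n1 n2. q \<in> weights l \<Longrightarrow> n1 \<in> weights (l1 + 1/2) \<Longrightarrow> n2 \<in> weights (l2 + 1/2) \<Longrightarrow>
        coupled l l1 l2 s1 s2 q n1 n2 = \<alpha> * CG (l1 + s1) (l2 + s2) l n1 n2 q"
    and "CG_triple (l1 + s1) (l2 + s2) l \<Longrightarrow> a_coeff l (l1, l2) (l1 + s1, l2 + s2) = \<alpha>"
proof -
  let ?m1 = "l1 + s1" and ?m2 = "l2 + s2"
  have N: "2 * l1 \<in> \<nat>" "2 * l2 \<in> \<nat>" "2 * l \<in> \<nat>" using T by (auto simp: CG_triple_def)
  obtain \<alpha> where pos: "s1 = 1/2 \<and> s2 = 1/2 \<longrightarrow> \<alpha> > 0"
    and \<alpha>: "\<And>q n1 n2. q \<in> weights l \<Longrightarrow> n1 \<in> weights (l1 + 1/2) \<Longrightarrow> n2 \<in> weights (l2 + 1/2) \<Longrightarrow>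
        coupled l l1 l2 s1 s2 q n1 n2 = \<alpha> * CG ?m1 ?m2 l n1 n2 q"
    using coupled_proportional[OF T s] by blast
  have "a_coeff l (l1, l2) (?m1, ?m2)
      = \<alpha> * (\<Sum>n1\<in>weights ?m1. \<Sum>n2\<in>weights ?m2. (CG ?m1 ?m2 l n1 n2 l)\<^sup>2)"
    unfolding a_coeff_eq_inner_product[OF T s] sum_distrib_left
  proof (intro sum.cong refl)
    fix n1 n2 assume "n1 \<in> weights ?m1" "n2 \<in> weights ?m2"
    then have "n1 \<in> weights (l1 + 1/2)" "n2 \<in> weights (l2 + 1/2)"
      using weights_down_half_subset N s by blast+
    then show "coupled l l1 l2 s1 s2 l n1 n2 * CG ?m1 ?m2 l n1 n2 l = \<alpha> * (CG ?m1 ?m2 l n1 n2 l)\<^sup>2"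
      using \<alpha> highest_in_weights[OF N(3)] by (simp add: power2_eq_square)
  qed
  then have "CG_triple ?m1 ?m2 l \<Longrightarrow> a_coeff l (l1, l2) (?m1, ?m2) = \<alpha>"
    by (simp add: CG_highest_norm)
  with pos \<alpha> show thesis using that by blast
qed

text \<open>
  When the target triple is not admissible, both sides vanish because \<open>CG\<close> does.
\<close>

lemma coupled_eq_a_coeff:
  assumes T: "CG_triple l1 l2 l" and s: "s1 \<in> {-1/2, 1/2}" "s2 \<in> {-1/2, 1/2}"
    and q: "q \<in> weights l" and n: "n1 \<in> weights (l1 + 1/2)" "n2 \<in> weights (l2 + 1/2)"
  shows "coupled l l1 l2 s1 s2 q n1 n2
     = a_coeff l (l1, l2) (l1 + s1, l2 + s2) * CG (l1 + s1) (l2 + s2) l n1 n2 q"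
proof -
  obtain \<alpha> where \<alpha>: "coupled l l1 l2 s1 s2 q n1 n2 = \<alpha> * CG (l1 + s1) (l2 + s2) l n1 n2 q"
    "CG_triple (l1 + s1) (l2 + s2) l \<Longrightarrow> a_coeff l (l1, l2) (l1 + s1, l2 + s2) = \<alpha>"
    using a_coeff_as_proportionality_factor[OF T s] q n by metis
  show ?thesis
    by (cases "CG_triple (l1 + s1) (l2 + s2) l") (simp_all add: \<alpha> CG_outside)
qed

lemma a_coeff_up_up_pos:
  assumes T: "CG_triple l1 l2 l"
  shows "a_coeff l (l1, l2) (l1 + 1/2, l2 + 1/2) > 0"
proof -
  obtain a b c where "l1 = real (a + b) / 2" "l2 = real (a + c) / 2" "l = real (b + c) / 2"
    using T by (rule CG_triple_cases)
  then have "l1 + 1/2 = real (Suc a + b) / 2" "l2 + 1/2 = real (Suc a + c) / 2" "l = real (b + c) / 2"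
    by auto
  then have "CG_triple (l1 + 1/2) (l2 + 1/2) l" using CG_triple_iff by blast
  moreover obtain \<alpha> where "\<alpha> > 0"
    "CG_triple (l1 + 1/2) (l2 + 1/2) l \<Longrightarrow> a_coeff l (l1, l2) (l1 + 1/2, l2 + 1/2) = \<alpha>"
    by (rule a_coeff_as_proportionality_factor[OF T, of "1/2" "1/2"]) auto
  ultimately show ?thesis by simp
qed

section \<open>The recurrence for scalar spherical entries\<close>

text \<open>
  The coefficients for \<open>m1\<close> and \<open>m2\<close> form a rotation by an angle each, and their tensor product is an orthogonal
  \<open>4 \<times> 4\<close> matrix. The vector it is applied to has only two nonzero entries, because the
  invariant vector has only the weights \<open>\<plusminus>(1/2, -1/2)\<close>.
\<close>

lemma sum_coupled_squares:
  assumes l: "2 * l1 \<in> \<nat>" "2 * l2 \<in> \<nat>"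
    and n: "n1 \<in> weights (l1 + 1/2)" "n2 \<in> weights (l2 + 1/2)"
  shows "(\<Sum>s1\<in>{-1/2, 1/2}. \<Sum>s2\<in>{-1/2, 1/2}. (coupled l l1 l2 s1 s2 q n1 n2)\<^sup>2)
     = ((CG l1 l2 l (n1 - 1/2) (n2 + 1/2) q)\<^sup>2 + (CG l1 l2 l (n1 + 1/2) (n2 - 1/2) q)\<^sup>2) / 2"
proof -
  have pyth: "(sqrt ((l + 1/2 + n) / (2 * l + 1)))\<^sup>2 + (sqrt ((l + 1/2 - n) / (2 * l + 1)))\<^sup>2 = 1"
    if "2 * l \<in> \<nat>" "n \<in> weights (l + 1/2)" for l n :: real
  proof -
    have "0 \<le> 2 * l" using that(1) by (auto elim: Nats_cases)
    moreover have "\<bar>n\<bar> \<le> l + 1/2" using that(2) by (simp add: weights_def)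
    ultimately have "0 \<le> (l + 1/2 + n) / (2 * l + 1)" "0 \<le> (l + 1/2 - n) / (2 * l + 1)"
      by auto
    then have "(sqrt ((l + 1/2 + n) / (2 * l + 1)))\<^sup>2 + (sqrt ((l + 1/2 - n) / (2 * l + 1)))\<^sup>2
      = (l + 1/2 + n) / (2 * l + 1) + (l + 1/2 - n) / (2 * l + 1)" by simp
    also have "\<dots> = 1" using \<open>0 \<le> 2 * l\<close> by (simp flip: add_divide_distrib)
    finally show ?thesis .
  qed
  \<comment> \<open>Cosine and sine of the two rotation angles.\<close>
  define p1 r1 p2 r2 where d: "p1 = sqrt ((l1 + 1/2 + n1) / (2 * l1 + 1))" "r1 = sqrt ((l1 + 1/2 - n1) / (2 * l1 + 1))"
    "p2 = sqrt ((l2 + 1/2 + n2) / (2 * l2 + 1))" "r2 = sqrt ((l2 + 1/2 - n2) / (2 * l2 + 1))"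
  have u1: "p1\<^sup>2 + r1\<^sup>2 = 1" "p2\<^sup>2 + r2\<^sup>2 = 1"
    unfolding d using pyth l n by auto
  define u w where uw: "u = CG l1 l2 l (n1 - 1/2) (n2 + 1/2) q" "w = CG l1 l2 l (n1 + 1/2) (n2 - 1/2) q"
  have "(\<Sum>s1\<in>{-1/2, 1/2}. \<Sum>s2\<in>{-1/2, 1/2}. (coupled l l1 l2 s1 s2 q n1 n2)\<^sup>2)
     = ((- r1 * p2 * u + p1 * r2 * w)\<^sup>2 + (- r1 * r2 * u - p1 * p2 * w)\<^sup>2
        + (p1 * p2 * u + r1 * r2 * w)\<^sup>2 + (p1 * r2 * u - r1 * p2 * w)\<^sup>2) / 2"
    unfolding coupled_def spin_half_CG_def d [symmetric] uw [symmetric]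
    by (simp add: power_divide add_divide_distrib)
  also have "\<dots> = (p1\<^sup>2 + r1\<^sup>2) * (p2\<^sup>2 + r2\<^sup>2) * (u\<^sup>2 + w\<^sup>2) / 2"
    by (simp add: power2_eq_square algebra_simps)
  also have "\<dots> = (u\<^sup>2 + w\<^sup>2) / 2" unfolding u1 by simp
  finally show ?thesis unfolding uw .
qed

text \<open>
  Rewrites a sum over the weights of \<open>l\<close> in terms of the weights \<open>n\<close> of \<open>H\<^sup>l \<otimes> H\<^sup>1\<^sup>/\<^sup>2\<close>. The
  interval for \<open>n\<close> is longer by one point, where \<open>g\<close> vanishes.
\<close>

lemma sum_weights_shift:
  fixes g :: "real \<Rightarrow> 'b :: comm_monoid_add"
  assumes l: "2 * l \<in> \<nat>" and g: "\<And>j. j \<notin> weights l \<Longrightarrow> g j = 0"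
  shows "(\<Sum>j\<in>weights l. g j) = (\<Sum>n\<in>weights (l + 1/2). g (n - 1/2))"
    and "(\<Sum>j\<in>weights l. g j) = (\<Sum>n\<in>weights (l + 1/2). g (n + 1/2))"
proof -
  from l obtain N where N: "2 * l = real N" by (rule Nats_cases)
  have N': "2 * (l + 1/2) = real (Suc N)" using N by simp
  have A: "(\<Sum>j\<in>weights l. g j) = (\<Sum>x\<le>N. g (l - real x))"
    unfolding weights_eq_below[OF N] by (subst sum.reindex) (auto simp: inj_on_def)
  have out: "l - real x \<notin> weights l" if "x > N" for x
    using that N by (auto simp: weights_def)
  have "(\<Sum>n\<in>weights (l + 1/2). g (n - 1/2)) = (\<Sum>x\<le>Suc N. g (l - real x))"
    unfolding weights_eq_below[OF N'] by (subst sum.reindex) (auto simp: inj_on_def)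
  also have "\<dots> = (\<Sum>x\<le>N. g (l - real x))"
    by (rule sum.mono_neutral_right) (auto intro!: g out)
  finally show "(\<Sum>j\<in>weights l. g j) = (\<Sum>n\<in>weights (l + 1/2). g (n - 1/2))"
    using A by simp
  have B: "(\<Sum>j\<in>weights l. g j) = (\<Sum>x\<le>N. g (real x - l))"
    unfolding weights_eq_above[OF N] by (subst sum.reindex) (auto simp: inj_on_def)
  have out: "real x - l \<notin> weights l" if "x > N" for x
    using that N by (auto simp: weights_def)
  have "(\<Sum>n\<in>weights (l + 1/2). g (n + 1/2)) = (\<Sum>x\<le>Suc N. g (real x - l))"
    unfolding weights_eq_above[OF N'] by (subst sum.reindex) (auto simp: inj_on_def)
  also have "\<dots> = (\<Sum>x\<le>N. g (real x - l))"
    by (rule sum.mono_neutral_right) (auto intro!: g out)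
  finally show "(\<Sum>j\<in>weights l. g j) = (\<Sum>n\<in>weights (l + 1/2). g (n + 1/2))"
    using B by simp
qed

definition spherical_entry :: "real \<Rightarrow> real \<Rightarrow> real \<Rightarrow> real \<Rightarrow> real \<Rightarrow> complex" where
  "spherical_entry l l1 l2 q t = (\<Sum>j1\<in>weights l1. \<Sum>j2\<in>weights l2.
     cis ((j2 - j1) * t) * complex_of_real ((CG l1 l2 l j1 j2 q)\<^sup>2))"

lemma spherical_entry_not_triple: "\<not> CG_triple l1 l2 l \<Longrightarrow> spherical_entry l l1 l2 q t = 0"
  by (simp add: spherical_entry_def CG_outside)

text \<open>
  Multiplication by \<open>cos t\<close> shifts \<open>j2 - j1\<close> by \<open>\<plusminus>1\<close>. Expressed in the weights
  \<open>n1 = j1 \<plusminus> 1/2\<close>, \<open>n2 = j2 \<minusplus> 1/2\<close>, the two shifted sums have the common exponential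
  \<open>cis ((n2 - n1) t)\<close>, and their squared coefficients add up to those of the four target pairs.
\<close>

lemma spherical_entry_recurrence:
  assumes T: "CG_triple l1 l2 l" and q: "q \<in> weights l"
  shows "complex_of_real (cos t) * spherical_entry l l1 l2 q t =
    (\<Sum>s1\<in>{-1/2, 1/2}. \<Sum>s2\<in>{-1/2, 1/2}.
       complex_of_real ((a_coeff l (l1, l2) (l1 + s1, l2 + s2))\<^sup>2) * spherical_entry l (l1 + s1) (l2 + s2) q t)"
proof -
  have N: "2 * l1 \<in> \<nat>" "2 * l2 \<in> \<nat>" "2 * l \<in> \<nat>" using T by (auto simp: CG_triple_def)
  let ?W1 = "weights (l1 + 1/2)" and ?W2 = "weights (l2 + 1/2)"
  have "2 * (l1 + 1/2) = 2 * l1 + 1" "2 * (l2 + 1/2) = 2 * l2 + 1" by auto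
  then have "2 * (l1 + 1/2) \<in> \<nat>" "2 * (l2 + 1/2) \<in> \<nat>" using N by (metis Nats_1 Nats_add)+
  then have fin: "finite ?W1" "finite ?W2" by (auto intro: finite_weights)
  define C where "C j1 j2 = complex_of_real ((CG l1 l2 l j1 j2 q)\<^sup>2)" for j1 j2
  have Cz: "C j1 j2 = 0" if "j1 \<notin> weights l1 \<or> j2 \<notin> weights l2" for j1 j2
    using that by (auto simp: C_def CG_outside)
  have cos: "complex_of_real (cos t) * cis x = (cis (x + t) + cis (x - t)) / 2" for x
    by (simp add: complex_eq_iff cos_add cos_diff sin_add sin_diff)
  have "complex_of_real (cos t) * spherical_entry l l1 l2 q t
      = (\<Sum>j1\<in>weights l1. \<Sum>j2\<in>weights l2. cis ((j2 - j1 - 1) * t) * C j1 j2 / 2)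
        + (\<Sum>j1\<in>weights l1. \<Sum>j2\<in>weights l2. cis ((j2 - j1 + 1) * t) * C j1 j2 / 2)"
    unfolding spherical_entry_def sum_distrib_left sum.distrib [symmetric] C_def[symmetric]
  proof (intro sum.cong refl)
    fix j1 j2
    have "complex_of_real (cos t) * (cis ((j2 - j1) * t) * C j1 j2)
        = (complex_of_real (cos t) * cis ((j2 - j1) * t)) * C j1 j2" by simp
    also have "\<dots> = (cis ((j2 - j1 + 1) * t) + cis ((j2 - j1 - 1) * t)) / 2 * C j1 j2"
      unfolding cos by (simp add: algebra_simps)
    finally show "complex_of_real (cos t) * (cis ((j2 - j1) * t) * C j1 j2)
        = cis ((j2 - j1 - 1) * t) * C j1 j2 / 2 + cis ((j2 - j1 + 1) * t) * C j1 j2 / 2"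
      by (simp add: field_simps)
  qed
  also have "(\<Sum>j1\<in>weights l1. \<Sum>j2\<in>weights l2. cis ((j2 - j1 - 1) * t) * C j1 j2 / 2)
      = (\<Sum>n1\<in>?W1. \<Sum>n2\<in>?W2. cis ((n2 - n1) * t) * C (n1 - 1/2) (n2 + 1/2) / 2)"
  proof -
    have "(\<Sum>j1\<in>weights l1. \<Sum>j2\<in>weights l2. cis ((j2 - j1 - 1) * t) * C j1 j2 / 2)
        = (\<Sum>j1\<in>weights l1. \<Sum>n2\<in>?W2. cis ((n2 + 1/2 - j1 - 1) * t) * C j1 (n2 + 1/2) / 2)"
      by (intro sum.cong refl sum_weights_shift(2)[OF N(2)]) (simp add: Cz)
    also have "\<dots> = (\<Sum>n1\<in>?W1. \<Sum>n2\<in>?W2. cis ((n2 + 1/2 - (n1 - 1/2) - 1) * t) * C (n1 - 1/2) (n2 + 1/2) / 2)"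
      by (intro sum_weights_shift(1)[OF N(1)]) (simp add: Cz)
    finally show ?thesis by (simp add: algebra_simps)
  qed
  also have "(\<Sum>j1\<in>weights l1. \<Sum>j2\<in>weights l2. cis ((j2 - j1 + 1) * t) * C j1 j2 / 2)
      = (\<Sum>n1\<in>?W1. \<Sum>n2\<in>?W2. cis ((n2 - n1) * t) * C (n1 + 1/2) (n2 - 1/2) / 2)"
  proof -
    have "(\<Sum>j1\<in>weights l1. \<Sum>j2\<in>weights l2. cis ((j2 - j1 + 1) * t) * C j1 j2 / 2)
        = (\<Sum>j1\<in>weights l1. \<Sum>n2\<in>?W2. cis ((n2 - 1/2 - j1 + 1) * t) * C j1 (n2 - 1/2) / 2)"
      by (intro sum.cong refl sum_weights_shift(1)[OF N(2)]) (simp add: Cz)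
    also have "\<dots> = (\<Sum>n1\<in>?W1. \<Sum>n2\<in>?W2. cis ((n2 - 1/2 - (n1 + 1/2) + 1) * t) * C (n1 + 1/2) (n2 - 1/2) / 2)"
      by (intro sum_weights_shift(2)[OF N(1)]) (simp add: Cz)
    finally show ?thesis by (simp add: algebra_simps)
  qed
  also have "(\<Sum>n1\<in>?W1. \<Sum>n2\<in>?W2. cis ((n2 - n1) * t) * C (n1 - 1/2) (n2 + 1/2) / 2)
      + (\<Sum>n1\<in>?W1. \<Sum>n2\<in>?W2. cis ((n2 - n1) * t) * C (n1 + 1/2) (n2 - 1/2) / 2)
      = (\<Sum>n1\<in>?W1. \<Sum>n2\<in>?W2. \<Sum>s1\<in>{-1/2, 1/2}. \<Sum>s2\<in>{-1/2, 1/2}.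
           cis ((n2 - n1) * t) * complex_of_real ((a_coeff l (l1, l2) (l1 + s1, l2 + s2) * CG (l1 + s1) (l2 + s2) l n1 n2 q)\<^sup>2))"
    unfolding sum.distrib [symmetric]
  proof (intro sum.cong refl)
    fix n1 n2 assume n: "n1 \<in> ?W1" "n2 \<in> ?W2"
    have "(\<Sum>s1\<in>{-1/2, 1/2}. \<Sum>s2\<in>{-1/2, 1/2}.
        (a_coeff l (l1, l2) (l1 + s1, l2 + s2) * CG (l1 + s1) (l2 + s2) l n1 n2 q)\<^sup>2)
      = (\<Sum>s1\<in>{-1/2, 1/2}. \<Sum>s2\<in>{-1/2, 1/2}. (coupled l l1 l2 s1 s2 q n1 n2)\<^sup>2)"
      by (intro sum.cong refl arg_cong[where f = power2] coupled_eq_a_coeff[symmetric] T q n)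
    also have "\<dots> = ((CG l1 l2 l (n1 - 1/2) (n2 + 1/2) q)\<^sup>2 + (CG l1 l2 l (n1 + 1/2) (n2 - 1/2) q)\<^sup>2) / 2"
      by (rule sum_coupled_squares[OF N(1,2) n])
    finally have E': "(\<Sum>s1\<in>{-1/2, 1/2}. \<Sum>s2\<in>{-1/2, 1/2}.
        (a_coeff l (l1, l2) (l1 + s1, l2 + s2) * CG (l1 + s1) (l2 + s2) l n1 n2 q)\<^sup>2)
      = ((CG l1 l2 l (n1 - 1/2) (n2 + 1/2) q)\<^sup>2 + (CG l1 l2 l (n1 + 1/2) (n2 - 1/2) q)\<^sup>2) / 2" .
    have E: "complex_of_real (\<Sum>s1\<in>{-1/2, 1/2}. \<Sum>s2\<in>{-1/2, 1/2}.
        (a_coeff l (l1, l2) (l1 + s1, l2 + s2) * CG (l1 + s1) (l2 + s2) l n1 n2 q)\<^sup>2)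
      = (C (n1 - 1/2) (n2 + 1/2) + C (n1 + 1/2) (n2 - 1/2)) / 2"
      unfolding E' C_def by simp
    show "cis ((n2 - n1) * t) * C (n1 - 1/2) (n2 + 1/2) / 2
        + cis ((n2 - n1) * t) * C (n1 + 1/2) (n2 - 1/2) / 2
      = (\<Sum>s1\<in>{-1/2, 1/2}. \<Sum>s2\<in>{-1/2, 1/2}.
           cis ((n2 - n1) * t) * complex_of_real ((a_coeff l (l1, l2) (l1 + s1, l2 + s2) * CG (l1 + s1) (l2 + s2) l n1 n2 q)\<^sup>2))"
      unfolding sum_distrib_left [symmetric] of_real_sum [symmetric] E by (simp add: field_simps)
  qed
  also have "\<dots> = (\<Sum>s1\<in>{-1/2, 1/2}. \<Sum>s2\<in>{-1/2, 1/2}. \<Sum>n1\<in>?W1. \<Sum>n2\<in>?W2.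
           cis ((n2 - n1) * t) * complex_of_real ((a_coeff l (l1, l2) (l1 + s1, l2 + s2) * CG (l1 + s1) (l2 + s2) l n1 n2 q)\<^sup>2))"
    by (simp add: sum.distrib)
  also have "\<dots> = (\<Sum>s1\<in>{-1/2, 1/2}. \<Sum>s2\<in>{-1/2, 1/2}.
       complex_of_real ((a_coeff l (l1, l2) (l1 + s1, l2 + s2))\<^sup>2) * spherical_entry l (l1 + s1) (l2 + s2) q t)"
  proof (intro sum.cong refl)
    fix s1 s2 :: real assume s: "s1 \<in> {-1/2, 1/2}" "s2 \<in> {-1/2, 1/2}"
    let ?V1 = "weights (l1 + s1)" and ?V2 = "weights (l2 + s2)"
    let ?A = "a_coeff l (l1, l2) (l1 + s1, l2 + s2)"
    define G where "G n1 n2 = cis ((n2 - n1) * t) * complex_of_real ((CG (l1 + s1) (l2 + s2) l n1 n2 q)\<^sup>2)" for n1 n2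
    \<comment> \<open>The sum over the weights of \<open>m1, m2\<close> may be extended, since the added coefficients vanish.\<close>
    have sub: "?V1 \<subseteq> ?W1" "?V2 \<subseteq> ?W2" using weights_down_half_subset N s by blast+
    have "(\<Sum>n1\<in>?V1. \<Sum>n2\<in>?V2. G n1 n2) = (\<Sum>n1\<in>?V1. \<Sum>n2\<in>?W2. G n1 n2)"
      by (intro sum.cong refl sum.mono_neutral_left fin sub) (auto simp: G_def CG_outside)
    also have "\<dots> = (\<Sum>n1\<in>?W1. \<Sum>n2\<in>?W2. G n1 n2)"
      by (intro sum.mono_neutral_left fin sub) (auto simp: G_def CG_outside)
    finally have G: "spherical_entry l (l1 + s1) (l2 + s2) q t = (\<Sum>n1\<in>?W1. \<Sum>n2\<in>?W2. G n1 n2)"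
      unfolding spherical_entry_def G_def .
    show "(\<Sum>n1\<in>?W1. \<Sum>n2\<in>?W2. cis ((n2 - n1) * t) * complex_of_real ((?A * CG (l1 + s1) (l2 + s2) l n1 n2 q)\<^sup>2))
      = complex_of_real (?A\<^sup>2) * spherical_entry l (l1 + s1) (l2 + s2) q t"
      unfolding G sum_distrib_left G_def by (simp add: power_mult_distrib mult_ac)
  qed
  finally show ?thesis .
qed

section \<open>Matrix coefficients on the torus\<close>

lemma dimH_eq: "2 * l = real N \<Longrightarrow> dimH l = Suc N"
  by (simp add: dimH_def)

lemma sum_weights_wt:
  assumes "2 * l = real N"
  shows "(\<Sum>j\<in>weights l. g j) = (\<Sum>r<Suc N. g (wt l r))"
  unfolding weights_eq_above[OF assms] lessThan_Suc_atMost wt_def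
  by (subst sum.reindex) (auto simp: inj_on_def)

lemma wt_in_weights: "2 * l = real N \<Longrightarrow> r < Suc N \<Longrightarrow> wt l r \<in> weights l"
  by (auto simp: weights_eq_above wt_def)

lemma index_wt: "nat \<lfloor>wt l r + l\<rfloor> = r"
  by (simp add: wt_def)

lemma psi_wt:
  assumes "2 * l = real N" "r \<le> N"
  shows "psi l (wt l r) v = complex_of_real (sqrt (real (N choose r))) * (v $ 0) ^ (N - r) * (v $ 1) ^ r"
proof -
  have "l - wt l r = real (N - r)" "l + wt l r = real r"
    using assms by (auto simp: wt_def of_nat_diff)
  then have "nat \<lfloor>l - wt l r\<rfloor> = N - r" "nat \<lfloor>l + wt l r\<rfloor> = r" "nat \<lfloor>2 * l\<rfloor> = N"
    using assms(1) by (simp_all only: floor_of_nat nat_int)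
  moreover have "N choose (N - r) = N choose r"
    using assms(2) by (rule binomial_symmetric [symmetric])
  ultimately show ?thesis by (simp only: psi_def)
qed

text \<open>
  On the vectors \<open>(1, z)\<close> the basis forms become multiples of the distinct powers of \<open>z\<close>; hence coordinates with
  respect to this basis are well defined.
\<close>

lemma psi_unique:
  assumes l: "2 * l = real N"
    and eq: "\<And>v. v \<in> carrier_vec 2 \<Longrightarrow> (\<Sum>j\<in>weights l. c j * psi l j v) = (\<Sum>j\<in>weights l. c' j * psi l j v)"
    and j: "j \<in> weights l"
  shows "c j = c' j"
proof -
  define d where "d r = (c (wt l r) - c' (wt l r)) * complex_of_real (sqrt (real (N choose r)))" for r
  have "\<forall>z. (\<Sum>r\<le>N. d r * z ^ r) = 0"
  proof
    fix z :: complex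
    define v where "v = vec 2 (\<lambda>i. if i = 0 then 1 else z)"
    have v: "v \<in> carrier_vec 2" "v $ 0 = 1" "v $ 1 = z"
      by (simp_all add: v_def)
    have "(\<Sum>r\<le>N. d r * z ^ r) = (\<Sum>r<Suc N. (c (wt l r) - c' (wt l r)) * psi l (wt l r) v)"
      unfolding lessThan_Suc_atMost
      by (rule sum.cong[OF refl], unfold d_def)
         (simp only: atMost_iff psi_wt[OF l] v power_one mult_1_right mult.assoc)
    also have "\<dots> = (\<Sum>j\<in>weights l. c j * psi l j v) - (\<Sum>j\<in>weights l. c' j * psi l j v)"
      unfolding sum_weights_wt[OF l] by (simp only: left_diff_distrib sum_subtractf)
    finally show "(\<Sum>r\<le>N. d r * z ^ r) = 0" using eq[OF v(1)] by simp
  qed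
  then have d0: "\<forall>r\<le>N. d r = 0" by (simp only: polyfun_eq_0)
  from j obtain r where r: "r \<le> N" "j = wt l r" unfolding weights_eq_above[OF l] wt_def by auto
  have "N choose r \<noteq> 0" using r(1) by simp
  then show ?thesis using d0 r by (auto simp: d_def)
qed

lemma T_act_m_elt:
  assumes l: "2 * l = real N" and r: "r \<le> N" and v: "v \<in> carrier_vec 2"
  shows "T_act (m_elt t) (psi l (wt l r)) v = cis (- wt l r * t) * psi l (wt l r) v"
proof -
  let ?w = "transpose_mat (m_elt t) *\<^sub>v v"
  have w: "?w $ 0 = cis (t / 2) * v $ 0" "?w $ 1 = cis (- t / 2) * v $ 1"
    using v by (auto simp: m_elt_def scalar_prod_def numeral_2_eq_2)
  have "cis (t / 2) ^ (N - r) * cis (- t / 2) ^ r = cis (real (N - r) * (t / 2) + real r * (- t / 2))"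
    by (simp only: Complex.DeMoivre cis_mult)
  also have "real (N - r) * (t / 2) + real r * (- t / 2) = - wt l r * t"
    using l r by (simp add: wt_def of_nat_diff field_simps)
  finally have E: "cis (t / 2) ^ (N - r) * cis (- t / 2) ^ r = cis (- wt l r * t)" .
  have "T_act (m_elt t) (psi l (wt l r)) v
      = (cis (t / 2) ^ (N - r) * cis (- t / 2) ^ r) * psi l (wt l r) v"
    unfolding T_act_def psi_wt[OF l r] w by (simp only: power_mult_distrib mult_ac)
  then show ?thesis unfolding E .
qed

text \<open>
  The torus acts diagonally, so the definite description defining \<open>coords\<close> can be evaluated.
\<close>

lemma T_mat_m_elt:
  assumes l: "2 * l = real N"
  shows "T_mat l (m_elt t) = mat (Suc N) (Suc N) (\<lambda>(r, s). if r = s then cis (- wt l r * t) else 0)"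
proof -
  have "coords l (T_act (m_elt t) (psi l (wt l s))) (wt l r) = (if r = s then cis (- wt l r * t) else 0)"
    if rs: "r < Suc N" "s < Suc N" for r s
  proof -
    define c where "c j = (if j = wt l s then cis (- wt l s * t) else 0)" for j
    have fin: "finite (weights l)" unfolding weights_eq_above[OF l] by simp
    have c: "\<forall>v\<in>carrier_vec 2. T_act (m_elt t) (psi l (wt l s)) v = (\<Sum>j\<in>weights l. c j * psi l j v)"
    proof
      fix v :: "complex vec" assume v: "v \<in> carrier_vec 2"
      have "(\<Sum>j\<in>weights l. c j * psi l j v)
          = (\<Sum>j\<in>weights l. if j = wt l s then cis (- wt l s * t) * psi l (wt l s) v else 0)"
        by (rule sum.cong) (auto simp: c_def)
      also have "\<dots> = cis (- wt l s * t) * psi l (wt l s) v"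
        using fin wt_in_weights[OF l rs(2)] by simp
      finally show "T_act (m_elt t) (psi l (wt l s)) v = (\<Sum>j\<in>weights l. c j * psi l j v)"
        using T_act_m_elt[OF l _ v, of s t] rs by simp
    qed
    have "coords l (T_act (m_elt t) (psi l (wt l s))) = c"
      unfolding coords_def
    proof (rule the_equality)
      show "(\<forall>j. j \<notin> weights l \<longrightarrow> c j = 0) \<and>
        (\<forall>v\<in>carrier_vec 2. T_act (m_elt t) (psi l (wt l s)) v = (\<Sum>j\<in>weights l. c j * psi l j v))"
        using c wt_in_weights[OF l rs(2)] by (auto simp: c_def)
    next
      fix c' assume c': "(\<forall>j. j \<notin> weights l \<longrightarrow> c' j = 0) \<and>
        (\<forall>v\<in>carrier_vec 2. T_act (m_elt t) (psi l (wt l s)) v = (\<Sum>j\<in>weights l. c' j * psi l j v))"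
      show "c' = c"
      proof
        fix j show "c' j = c j"
        proof (cases "j \<in> weights l")
          case True
          show ?thesis
            by (rule psi_unique[OF l _ True]) (use c c' in metis)
        next
          case False
          then show ?thesis using c' wt_in_weights[OF l rs(2)] by (auto simp: c_def)
        qed
      qed
    qed
    then show ?thesis by (auto simp: c_def wt_def)
  qed
  then show ?thesis
    unfolding T_mat_def wmat_def dimH_eq[OF l] by (intro eq_matI) auto
qed

lemma sum_div_mod:
  fixes f :: "nat \<Rightarrow> nat \<Rightarrow> 'b :: comm_monoid_add"
  shows "(\<Sum>k<m * n. f (k div n) (k mod n)) = (\<Sum>i<m. \<Sum>j<n. f i j)"
proof (cases "n = 0")
  case False
  have "(\<Sum>k<m * n. f (k div n) (k mod n)) = (\<Sum>(i, j)\<in>{..<m} \<times> {..<n}. f i j)"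
  proof (rule sum.reindex_bij_witness[of _ "\<lambda>(i, j). i * n + j" "\<lambda>k. (k div n, k mod n)"])
    fix a assume "a \<in> {..<m * n}"
    then show "(a div n, a mod n) \<in> {..<m} \<times> {..<n}"
      using False by (auto simp: less_mult_imp_div_less)
  next
    fix b assume "b \<in> {..<m} \<times> {..<n}"
    then obtain i j where b: "b = (i, j)" "i < m" "j < n" by auto
    have "i * n + j < Suc i * n" using b by simp
    also have "\<dots> \<le> m * n" using b by (intro mult_le_mono1) simp
    finally show "(case b of (i, j) \<Rightarrow> i * n + j) \<in> {..<m * n}" using b by simp
  qed (use False in auto)
  then show ?thesis by (simp add: sum.cartesian_product)
qed simp

lemma T_outer_a_elt:
  assumes l: "2 * l1 = real N1" "2 * l2 = real N2"
  shows "T_outer l1 l2 (a_elt t) = mat (Suc N1 * Suc N2) (Suc N1 * Suc N2)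
    (\<lambda>(i, k). if i = k then cis ((wt l2 (k mod Suc N2) - wt l1 (k div Suc N2)) * t) else 0)"
proof (rule eq_matI)
  fix i k assume "i < dim_row (mat (Suc N1 * Suc N2) (Suc N1 * Suc N2)
    (\<lambda>(i, k). if i = k then cis ((wt l2 (k mod Suc N2) - wt l1 (k div Suc N2)) * t) else (0::complex)))"
    "k < dim_col (mat (Suc N1 * Suc N2) (Suc N1 * Suc N2)
    (\<lambda>(i, k). if i = k then cis ((wt l2 (k mod Suc N2) - wt l1 (k div Suc N2)) * t) else (0::complex)))"
  then have ik: "i < Suc N1 * Suc N2" "k < Suc N1 * Suc N2" by (simp_all only: dim_row_mat dim_col_mat)
  then have b: "i div Suc N2 < Suc N1" "k div Suc N2 < Suc N1" "i mod Suc N2 < Suc N2" "k mod Suc N2 < Suc N2"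
    by (simp_all only: less_mult_imp_div_less mod_less_divisor zero_less_Suc)
  have eq: "i div Suc N2 = k div Suc N2 \<Longrightarrow> i mod Suc N2 = k mod Suc N2 \<Longrightarrow> i = k"
    by (metis div_mult_mod_eq)
  show "T_outer l1 l2 (a_elt t) $$ (i, k) = mat (Suc N1 * Suc N2) (Suc N1 * Suc N2)
    (\<lambda>(i, k). if i = k then cis ((wt l2 (k mod Suc N2) - wt l1 (k div Suc N2)) * t) else 0) $$ (i, k)"
    unfolding T_outer_def a_elt_def fst_conv snd_conv kron_def T_mat_m_elt[OF l(1)] T_mat_m_elt[OF l(2)]
      dim_row_mat dim_col_mat index_mat(1)[OF ik] split_conv
      index_mat(1)[OF b(1) b(2)] index_mat(1)[OF b(3) b(4)]
    using eq by (auto simp: cis_mult algebra_simps)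
qed (simp_all only: T_outer_def a_elt_def fst_conv snd_conv kron_def T_mat_m_elt[OF l(1)] T_mat_m_elt[OF l(2)]
      dim_row_mat dim_col_mat)

lemma mat_adjoint_index:
  "i < dim_col A \<Longrightarrow> k < dim_row A \<Longrightarrow> mat_adjoint A $$ (i, k) = conjugate (A $$ (k, i))"
  by (simp add: mat_adjoint_def mat_of_rows_def)

lemma mat_adjoint_carrier: "A \<in> carrier_mat m n \<Longrightarrow> mat_adjoint A \<in> carrier_mat n m"
  by (auto simp: mat_adjoint_def mat_of_rows_def)

lemma mult_mat_index_sum:
  assumes "A \<in> carrier_mat m n" "B \<in> carrier_mat n p" "i < m" "j < p"
  shows "(A * B) $$ (i, j) = (\<Sum>k<n. A $$ (i, k) * B $$ (k, j))"
  using assms by (simp add: scalar_prod_def lessThan_atLeast0)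

text \<open>
  As \<open>T_outer l1 l2 (a_elt t)\<close> is diagonal, a diagonal entry of the conjugate by \<open>beta\<close> is
  a sum of its eigenvalues weighted by squares of Clebsch-Gordan coefficients.
\<close>

lemma Phi_diag_entry:
  assumes l: "2 * l1 = real N1" "2 * l2 = real N2" and L: "2 * l = real N" and r: "r \<le> N"
  shows "wentry l (Phi l l1 l2 (a_elt t)) (wt l r) (wt l r) = spherical_entry l l1 l2 (wt l r) t"
proof -
  define n where "n = Suc N1 * Suc N2"
  define B where "B = beta l1 l2 l"
  define D where "D = T_outer l1 l2 (a_elt t)"
  define \<tau> where "\<tau> k = cis ((wt l2 (k mod Suc N2) - wt l1 (k div Suc N2)) * t)" for k
  define C where "C k = CG l1 l2 l (wt l1 (k div Suc N2)) (wt l2 (k mod Suc N2)) (wt l r)" for k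
  have r': "r < Suc N" using r by simp
  have B: "B \<in> carrier_mat n (Suc N)"
    unfolding B_def beta_def n_def dimH_eq[OF l(1)] dimH_eq[OF l(2)] dimH_eq[OF L] by (rule mat_carrier)
  have Bk: "B $$ (k, r) = complex_of_real (C k)" if "k < n" for k
    unfolding B_def beta_def dimH_eq[OF l(1)] dimH_eq[OF l(2)] dimH_eq[OF L] n_def [symmetric]
      index_mat(1)[OF that r'] split_conv C_def ..
  have D: "D \<in> carrier_mat n n" "\<And>i k. i < n \<Longrightarrow> k < n \<Longrightarrow> D $$ (i, k) = (if i = k then \<tau> k else 0)"
    unfolding D_def T_outer_a_elt[OF l] n_def [symmetric] \<tau>_def [symmetric]
    by (rule mat_carrier, simp only: index_mat(1) split_conv)
  have adj: "mat_adjoint B \<in> carrier_mat (Suc N) n"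
    using B by (rule mat_adjoint_carrier)
  have adjk: "mat_adjoint B $$ (r, k) = complex_of_real (C k)" if "k < n" for k
  proof -
    have "mat_adjoint B $$ (r, k) = conjugate (B $$ (k, r))"
      by (rule mat_adjoint_index) (use B r' that in \<open>simp_all only: carrier_matD\<close>)
    then show ?thesis unfolding Bk[OF that] by simp
  qed
  have AD: "(mat_adjoint B * D) $$ (r, k) = complex_of_real (C k) * \<tau> k" if k: "k < n" for k
  proof -
    have "(mat_adjoint B * D) $$ (r, k) = (\<Sum>i<n. mat_adjoint B $$ (r, i) * D $$ (i, k))"
      by (rule mult_mat_index_sum[OF adj D(1) r' k])
    also have "\<dots> = (\<Sum>i<n. if i = k then complex_of_real (C k) * \<tau> k else 0)"
      by (rule sum.cong) (auto simp: adjk D(2) k)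
    finally show ?thesis using k by simp
  qed
  have "(mat_adjoint B * D * B) $$ (r, r) = (\<Sum>k<n. (mat_adjoint B * D) $$ (r, k) * B $$ (k, r))"
    by (rule mult_mat_index_sum[OF mult_carrier_mat[OF adj D(1)] B r' r'])
  also have "\<dots> = (\<Sum>k<n. \<tau> k * complex_of_real ((C k)\<^sup>2))"
    by (rule sum.cong) (auto simp: AD Bk power2_eq_square)
  also have "\<dots> = (\<Sum>k<Suc N1 * Suc N2. (\<lambda>a b. cis ((wt l2 b - wt l1 a) * t)
        * complex_of_real ((CG l1 l2 l (wt l1 a) (wt l2 b) (wt l r))\<^sup>2)) (k div Suc N2) (k mod Suc N2))"
    by (simp only: n_def \<tau>_def C_def)
  also have "\<dots> = (\<Sum>a<Suc N1. \<Sum>b<Suc N2. cis ((wt l2 b - wt l1 a) * t)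
        * complex_of_real ((CG l1 l2 l (wt l1 a) (wt l2 b) (wt l r))\<^sup>2))"
    by (rule sum_div_mod)
  also have "\<dots> = spherical_entry l l1 l2 (wt l r) t"
    unfolding spherical_entry_def sum_weights_wt[OF l(1)] sum_weights_wt[OF l(2)] ..
  finally show ?thesis
    unfolding wentry_def Phi_def index_wt B_def D_def .
qed

lemma phi_a_elt: "phi (a_elt t) = complex_of_real (cos t)"
proof -
  have "phi (a_elt t) = spherical_entry 0 (1/2) (1/2) 0 t"
    using Phi_diag_entry[of "1/2" 1 "1/2" 1 0 0 0 t] by (simp add: phi_def wt_def)
  moreover have "CG (1/2) (1/2) 0 (1/2) (1/2) 0 = 0" "CG (1/2) (1/2) 0 (-1/2) (-1/2) 0 = 0"
    by (auto simp: CG_def)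
  ultimately show ?thesis
    unfolding spherical_entry_def weights_half
    by (simp add: CG_half_half[simplified] power_divide complex_eq_iff)
qed

text \<open>
  Row \<open>r\<close> carries the weight \<open>p = r - l\<close>, for which \<open>zeta l d p\<close> is \<open>((d + r)/2, (d + N - r)/2)\<close>.
\<close>

lemma full_Phi_index:
  assumes L: "2 * l = real N" and r: "r \<le> N" and s: "s \<le> N"
  shows "full_Phi l (int d) (a_elt t) $$ (r, s)
     = spherical_entry l (real (d + r) / 2) (real (d + (N - r)) / 2) (wt l s) t"
proof -
  have z: "zeta l (int d) (wt l r) = (real (d + r) / 2, real (d + (N - r)) / 2)"
    using L r by (auto simp: zeta_def wt_def of_nat_diff)
  show ?thesis
    unfolding full_Phi_def wmat_def dimH_eq[OF L] using r s
    by (simp add: z Phi_diag_entry[of _ "d + r" _ "d + (N - r)", OF _ _ L s] del: of_nat_add)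
qed

lemma full_Phi_carrier: "full_Phi l d a \<in> carrier_mat (dimH l) (dimH l)"
  by (simp add: full_Phi_def wmat_def)

section \<open>The recurrence for the full spherical functions\<close>

lemma det_nonzero_imp_two_sided_inverse:
  fixes A :: "'a :: field mat"
  assumes A: "A \<in> carrier_mat n n" and d: "det A \<noteq> 0"
  obtains B where "B \<in> carrier_mat n n" "A * B = 1\<^sub>m n" "B * A = 1\<^sub>m n"
  using det_non_zero_imp_unit[OF A d, unfolded Units_def, of "()"] that
  by (auto simp: ring_mat_def)

text \<open>
  Fixing \<open>N = 2 l\<close> lets rows and columns be addressed by their natural numbers \<open>0, ..., N\<close>.
\<close>

locale half_integral_spin =
  fixes l :: real and N :: nat
  assumes spin: "2 * l = real N"
begin

definition A_coef :: "nat \<Rightarrow> nat \<Rightarrow> real" where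
  "A_coef d r = (a_coeff l (zeta l (int d) (wt l r)) (zeta l (int d + 1) (wt l r)))\<^sup>2"

definition B_up :: "nat \<Rightarrow> nat \<Rightarrow> real" where
  "B_up d r = (a_coeff l (zeta l (int d) (wt l r)) (zeta l (int d) (wt l r + 1)))\<^sup>2"

definition B_down :: "nat \<Rightarrow> nat \<Rightarrow> real" where
  "B_down d r = (a_coeff l (zeta l (int d) (wt l r)) (zeta l (int d) (wt l r - 1)))\<^sup>2"

definition C_coef :: "nat \<Rightarrow> nat \<Rightarrow> real" where
  "C_coef d r = (a_coeff l (zeta l (int d) (wt l r)) (zeta l (int d - 1) (wt l r)))\<^sup>2"

lemma fin: "finite (weights l)"
  unfolding weights_eq_above[OF spin] by simp

text \<open>
  Of the elementary matrices, only the one with row label \<open>p\<close> contributes to row \<open>p\<close>.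
\<close>

lemma sum_elem_row:
  assumes "p \<in> weights l"
  shows "(\<Sum>k\<in>weights l. f k * elem k (g k) p q) = (if q = g p then f p else 0)"
proof -
  have "(\<Sum>k\<in>weights l. f k * elem k (g k) p q) = (\<Sum>k\<in>weights l. if k = p then (if q = g p then f p else 0) else 0)"
    by (rule sum.cong) (auto simp: elem_def)
  then show ?thesis using assms fin by simp
qed

lemma rec_carrier:
  "rec_A l d \<in> carrier_mat (Suc N) (Suc N)" "rec_B l d \<in> carrier_mat (Suc N) (Suc N)"
  "rec_C l d \<in> carrier_mat (Suc N) (Suc N)"
  by (auto simp: rec_A_def rec_B_def rec_C_def wmat_def dimH_eq[OF spin])

lemma rec_A_index:
  assumes "r \<le> N" "k \<le> N"
  shows "rec_A l d $$ (r, k) = (if k = r then A_coef d r else 0)"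
proof -
  have "wt l r \<in> weights l" using assms wt_in_weights[OF spin] by simp
  from sum_elem_row[OF this, of "\<lambda>k. \<bar>a_coeff l (zeta l (int d) k) (zeta l (int d + 1) k)\<bar>\<^sup>2" "\<lambda>k. k"]
  show ?thesis using assms
    by (simp add: rec_A_def wmat_def dimH_eq[OF spin] A_coef_def) (simp add: wt_def)
qed

lemma rec_C_index:
  assumes "r \<le> N" "k \<le> N"
  shows "rec_C l d $$ (r, k) = (if k = r \<and> d > 0 then C_coef d r else 0)"
proof -
  have "wt l r \<in> weights l" using assms wt_in_weights[OF spin] by simp
  from sum_elem_row[OF this, of "\<lambda>k. \<bar>a_coeff l (zeta l (int d) k) (zeta l (int d - 1) k)\<bar>\<^sup>2" "\<lambda>k. k"]
  show ?thesis using assms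
    by (simp add: rec_C_def wmat_def dimH_eq[OF spin] C_coef_def) (simp add: wt_def)
qed

lemma rec_B_index:
  assumes "r \<le> N" "k \<le> N"
  shows "rec_B l d $$ (r, k) = (if k = r + 1 then B_up d r else 0) + (if k + 1 = r then B_down d r else 0)"
proof -
  have w: "wt l r \<in> weights l" using assms wt_in_weights[OF spin] by simp
  have "wt l k = wt l r + 1 \<longleftrightarrow> real k = real (r + 1)" "wt l k = wt l r - 1 \<longleftrightarrow> real (k + 1) = real r"
    by (auto simp: wt_def)
  then have e: "wt l k = wt l r + 1 \<longleftrightarrow> k = r + 1" "wt l k = wt l r - 1 \<longleftrightarrow> k + 1 = r"
    by (simp_all only: of_nat_eq_iff)
  from sum_elem_row[OF w, of "\<lambda>k. \<bar>a_coeff l (zeta l (int d) k) (zeta l (int d) (k + 1))\<bar>\<^sup>2" "\<lambda>k. k + 1" "wt l k"]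
    sum_elem_row[OF w, of "\<lambda>k. \<bar>a_coeff l (zeta l (int d) k) (zeta l (int d) (k - 1))\<bar>\<^sup>2" "\<lambda>k. k - 1" "wt l k"]
  show ?thesis using assms
    by (simp add: rec_B_def wmat_def dimH_eq[OF spin] B_up_def B_down_def sum.distrib e)
qed

text \<open>
  Multiplication by \<open>rec_A\<close> or \<open>rec_C\<close> rescales rows, and multiplication by \<open>rec_B\<close>
  mixes neighbouring rows. Columns are untouched, which is why the recurrence survives right multiplication by a
  matrix.
\<close>

lemma rec_mult_index:
  assumes M: "M \<in> carrier_mat (Suc N) m" and r: "r \<le> N" and s: "s < m"
  shows "(cmat (rec_A l d) * M) $$ (r, s) = of_real (A_coef d r) * M $$ (r, s)"
    "(cmat (rec_B l d) * M) $$ (r, s) = (if r < N then of_real (B_up d r) * M $$ (r + 1, s) else 0)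
        + (if 0 < r then of_real (B_down d r) * M $$ (r - 1, s) else 0)"
    "(cmat (rec_C l d) * M) $$ (r, s) = (if d > 0 then of_real (C_coef d r) * M $$ (r, s) else 0)"
proof -
  have prod: "(cmat R * M) $$ (r, s) = (\<Sum>k<Suc N. of_real (R $$ (r, k)) * M $$ (k, s))"
    if "R \<in> carrier_mat (Suc N) (Suc N)" for R
    using mult_mat_index_sum[of "cmat R" "Suc N" "Suc N" M m r s] that M r s by simp
  have "(cmat (rec_A l d) * M) $$ (r, s)
      = (\<Sum>k<Suc N. if k = r then of_real (A_coef d r) * M $$ (r, s) else 0)"
    unfolding prod[OF rec_carrier(1)] by (rule sum.cong) (use r in \<open>auto simp: rec_A_index\<close>)
  then show "(cmat (rec_A l d) * M) $$ (r, s) = of_real (A_coef d r) * M $$ (r, s)"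
    using r by simp
  have "(cmat (rec_C l d) * M) $$ (r, s)
      = (\<Sum>k<Suc N. if k = r then (if d > 0 then of_real (C_coef d r) * M $$ (r, s) else 0) else 0)"
    unfolding prod[OF rec_carrier(3)] by (rule sum.cong) (use r in \<open>auto simp: rec_C_index\<close>)
  then show "(cmat (rec_C l d) * M) $$ (r, s) = (if d > 0 then of_real (C_coef d r) * M $$ (r, s) else 0)"
    using r by simp
  have "(cmat (rec_B l d) * M) $$ (r, s)
      = (\<Sum>k<Suc N. (if k = r + 1 then of_real (B_up d r) * M $$ (r + 1, s) else 0)
          + (if k = r - 1 then (if 0 < r then of_real (B_down d r) * M $$ (r - 1, s) else 0) else 0))"
    unfolding prod[OF rec_carrier(2)] by (rule sum.cong) (use r in \<open>auto simp: rec_B_index\<close>)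
  then show "(cmat (rec_B l d) * M) $$ (r, s) = (if r < N then of_real (B_up d r) * M $$ (r + 1, s) else 0)
        + (if 0 < r then of_real (B_down d r) * M $$ (r - 1, s) else 0)"
    unfolding sum.distrib using r by (auto simp del: sum.lessThan_Suc)
qed

lemma zeta_nat: "r \<le> N \<Longrightarrow> zeta l (int d) (wt l r) = (real (d + r) / 2, real (d + (N - r)) / 2)"
  using spin by (auto simp: zeta_def wt_def of_nat_diff)

lemma triple_zeta: "r \<le> N \<Longrightarrow> CG_triple (real (d + r) / 2) (real (d + (N - r)) / 2) l"
  using spin unfolding CG_triple_iff by (intro exI[of _ d] exI[of _ r] exI[of _ "N - r"]) (auto simp: of_nat_diff)

lemma A_coef_pos: "r \<le> N \<Longrightarrow> A_coef d r > 0"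
proof -
  assume r: "r \<le> N"
  let ?l1 = "real (d + r) / 2" and ?l2 = "real (d + (N - r)) / 2"
  have "zeta l (int d + 1) (wt l r) = (?l1 + 1/2, ?l2 + 1/2)"
    using spin r by (auto simp: zeta_def wt_def of_nat_diff field_simps)
  moreover have "a_coeff l (?l1, ?l2) (?l1 + 1/2, ?l2 + 1/2) > 0"
    by (rule a_coeff_up_up_pos[OF triple_zeta[OF r]])
  ultimately show ?thesis
    unfolding A_coef_def zeta_nat[OF r] by simp
qed

lemma rec_A_GL: "rec_A l d \<in> GL_real (Suc N)"
proof -
  have "upper_triangular (rec_A l d)"
    using rec_carrier(1)[of d] by (auto simp: rec_A_index)
  then have "det (rec_A l d) = prod_list (diag_mat (rec_A l d))"
    by (rule det_upper_triangular[OF _ rec_carrier(1)])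
  moreover have nz: "A_coef d r \<noteq> 0" if "r \<le> N" for r
    using A_coef_pos[OF that, of d] by simp
  have "0 \<notin> set (diag_mat (rec_A l d))"
    using rec_carrier(1)[of d] by (auto simp: diag_mat_def rec_A_index nz)
  ultimately have "det (rec_A l d) \<noteq> 0"
    by (simp add: prod_list_zero_iff)
  then obtain B where "B \<in> carrier_mat (Suc N) (Suc N)" "rec_A l d * B = 1\<^sub>m (Suc N)" "B * rec_A l d = 1\<^sub>m (Suc N)"
    using det_nonzero_imp_two_sided_inverse[OF rec_carrier(1)] by blast
  then show ?thesis
    using rec_carrier(1)[of d] by (auto simp: GL_real_def invertible_mat_def inverts_mat_def)
qed

text \<open>
  The pair \<open>zeta l d p\<close> is \<open>(l1, l2)\<close>, and its four neighbours are again values of \<open>zeta\<close>. At the borders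
  \<open>r = N\<close>, \<open>r = 0\<close> and \<open>d = 0\<close> the missing neighbour violates the triangle condition, and its spherical entry is zero.
\<close>

lemma full_Phi_recurrence_index:
  fixes t :: real
  assumes r: "r \<le> N" and s: "s \<le> N"
  defines "F \<equiv> \<lambda>d r. full_Phi l d (a_elt t) $$ (r, s)"
  shows "of_real (cos t) * F (int d) r = of_real (A_coef d r) * F (int d + 1) r
     + ((if r < N then of_real (B_up d r) * F (int d) (r + 1) else 0)
        + (if 0 < r then of_real (B_down d r) * F (int d) (r - 1) else 0))
     + (if d > 0 then of_real (C_coef d r) * F (int d - 1) r else 0)"
proof -
  define l1 where "l1 = real (d + r) / 2"
  define l2 where "l2 = real (d + (N - r)) / 2"
  have T: "CG_triple l1 l2 l" unfolding l1_def l2_def by (rule triple_zeta[OF r])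
  have ws: "wt l s \<in> weights l" using s wt_in_weights[OF spin] by simp
  have z0: "zeta l (int d) (wt l r) = (l1, l2)" unfolding l1_def l2_def by (rule zeta_nat[OF r])
  have z: "zeta l (int d + 1) (wt l r) = (l1 + 1/2, l2 + 1/2)"
    "zeta l (int d) (wt l r + 1) = (l1 + 1/2, l2 + - 1/2)"
    "zeta l (int d) (wt l r - 1) = (l1 + - 1/2, l2 + 1/2)"
    "zeta l (int d - 1) (wt l r) = (l1 + - 1/2, l2 + - 1/2)"
    using z0 by (auto simp: zeta_def field_simps)
  let ?S = "\<lambda>s1 s2. spherical_entry l (l1 + s1) (l2 + s2) (wt l s) t"
  have F0: "F (int d) r = spherical_entry l l1 l2 (wt l s) t"
    unfolding F_def l1_def l2_def by (rule full_Phi_index[OF spin r s])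
  have Fpp: "F (int d + 1) r = ?S (1/2) (1/2)"
  proof -
    have "F (int d + 1) r = F (int (d + 1)) r" by (simp add: add.commute)
    also have "\<dots> = ?S (1/2) (1/2)"
      unfolding F_def full_Phi_index[OF spin r s] l1_def l2_def by (simp add: add_divide_distrib add_ac)
    finally show ?thesis .
  qed
  have Fpm: "?S (1/2) (-1/2) = (if r < N then F (int d) (r + 1) else 0)"
  proof (cases "r < N")
    case True
    then have e: "real (d + (r + 1)) / 2 = l1 + 1/2" "real (d + (N - (r + 1))) / 2 = l2 + - 1/2"
      by (auto simp: l1_def l2_def of_nat_diff field_simps)
    have "r + 1 \<le> N" using True by simp
    from full_Phi_index[OF spin this s, of d t, unfolded e] show ?thesis
      using True by (simp add: F_def)
  next
    case False
    then have "l1 - l2 = l"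
      using r spin by (simp add: l1_def l2_def field_simps)
    then have "\<not> CG_triple (l1 + 1/2) (l2 + - 1/2) l"
      by (auto simp: CG_triple_def)
    then show ?thesis using False by (simp add: spherical_entry_not_triple)
  qed
  have Fmp: "?S (-1/2) (1/2) = (if 0 < r then F (int d) (r - 1) else 0)"
  proof (cases "0 < r")
    case True
    then have e: "real (d + (r - 1)) / 2 = l1 + - 1/2" "real (d + (N - (r - 1))) / 2 = l2 + 1/2"
      using r by (auto simp: l1_def l2_def of_nat_diff field_simps)
    have "r - 1 \<le> N" using r by simp
    from full_Phi_index[OF spin this s, of d t, unfolded e] show ?thesis
      using True by (simp add: F_def)
  next
    case False
    then have "l2 - l1 = l"
      using r spin by (simp add: l1_def l2_def field_simps)
    then have "\<not> CG_triple (l1 + - 1/2) (l2 + 1/2) l"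
      by (auto simp: CG_triple_def)
    then show ?thesis using False by (simp add: spherical_entry_not_triple)
  qed
  have Fmm: "?S (-1/2) (-1/2) = (if 0 < d then F (int d - 1) r else 0)"
  proof (cases "0 < d")
    case True
    then have e: "real (d - 1 + r) / 2 = l1 + - 1/2" "real (d - 1 + (N - r)) / 2 = l2 + - 1/2"
      by (auto simp: l1_def l2_def of_nat_diff field_simps)
    have "int (d - 1) = int d - 1" using True by simp
    from full_Phi_index[OF spin r s, of "d - 1" t, unfolded e this] show ?thesis
      using True by (simp add: F_def)
  next
    case False
    then have "l1 + l2 = l"
      using r spin by (simp add: l1_def l2_def of_nat_diff field_simps)
    then have "\<not> CG_triple (l1 + - 1/2) (l2 + - 1/2) l"
      by (auto simp: CG_triple_def)
    then show ?thesis using False by (simp add: spherical_entry_not_triple)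
  qed
  have "of_real (cos t) * F (int d) r
      = of_real (A_coef d r) * ?S (1/2) (1/2) + of_real (B_up d r) * ?S (1/2) (-1/2)
        + of_real (B_down d r) * ?S (-1/2) (1/2) + of_real (C_coef d r) * ?S (-1/2) (-1/2)"
    unfolding F0 spherical_entry_recurrence[OF T ws] A_coef_def B_up_def B_down_def C_coef_def z0 z
    by (simp add: add_ac)
  then show ?thesis unfolding Fpp Fpm Fmp Fmm by simp
qed

lemma full_Phi_recurrence:
  "of_real (cos t) \<cdot>\<^sub>m full_Phi l (int d) (a_elt t) =
     cmat (rec_A l d) * full_Phi l (int d + 1) (a_elt t)
     + cmat (rec_B l d) * full_Phi l (int d) (a_elt t)
     + cmat (rec_C l d) * full_Phi l (int d - 1) (a_elt t)"
proof (rule eq_matI)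
  note c = full_Phi_carrier[of l, unfolded dimH_eq[OF spin]]
  have dims: "dim_row (full_Phi l d' a) = Suc N" "dim_col (full_Phi l d' a) = Suc N" for d' a
    using c[of d' a] by auto
  have rdims: "dim_row (rec_A l d) = Suc N" "dim_row (rec_B l d) = Suc N" "dim_row (rec_C l d) = Suc N"
    using rec_carrier[of d] by auto
  show "dim_row (of_real (cos t) \<cdot>\<^sub>m full_Phi l (int d) (a_elt t)) =
     dim_row (cmat (rec_A l d) * full_Phi l (int d + 1) (a_elt t)
     + cmat (rec_B l d) * full_Phi l (int d) (a_elt t)
     + cmat (rec_C l d) * full_Phi l (int d - 1) (a_elt t))"
    "dim_col (of_real (cos t) \<cdot>\<^sub>m full_Phi l (int d) (a_elt t)) =
     dim_col (cmat (rec_A l d) * full_Phi l (int d + 1) (a_elt t)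
     + cmat (rec_B l d) * full_Phi l (int d) (a_elt t)
     + cmat (rec_C l d) * full_Phi l (int d - 1) (a_elt t))"
    by (simp_all add: dims rdims)
  fix r s
  assume "r < dim_row (cmat (rec_A l d) * full_Phi l (int d + 1) (a_elt t)
     + cmat (rec_B l d) * full_Phi l (int d) (a_elt t)
     + cmat (rec_C l d) * full_Phi l (int d - 1) (a_elt t))"
    "s < dim_col (cmat (rec_A l d) * full_Phi l (int d + 1) (a_elt t)
     + cmat (rec_B l d) * full_Phi l (int d) (a_elt t)
     + cmat (rec_C l d) * full_Phi l (int d - 1) (a_elt t))"
  then have rs: "r \<le> N" "s \<le> N" "r < Suc N" "s < Suc N" by (auto simp: dims rdims)
  have "(of_real (cos t) \<cdot>\<^sub>m full_Phi l (int d) (a_elt t)) $$ (r, s)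
      = of_real (cos t) * full_Phi l (int d) (a_elt t) $$ (r, s)"
    using rs by (simp add: dims)
  also have "\<dots> = (cmat (rec_A l d) * full_Phi l (int d + 1) (a_elt t)) $$ (r, s)
     + (cmat (rec_B l d) * full_Phi l (int d) (a_elt t)) $$ (r, s)
     + (cmat (rec_C l d) * full_Phi l (int d - 1) (a_elt t)) $$ (r, s)"
    unfolding rec_mult_index[OF c rs(1,4)] by (rule full_Phi_recurrence_index[OF rs(1,2)])
  finally show "(of_real (cos t) \<cdot>\<^sub>m full_Phi l (int d) (a_elt t)) $$ (r, s) =
     (cmat (rec_A l d) * full_Phi l (int d + 1) (a_elt t)
     + cmat (rec_B l d) * full_Phi l (int d) (a_elt t)
     + cmat (rec_C l d) * full_Phi l (int d - 1) (a_elt t)) $$ (r, s)"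
    using rs by (simp add: dims rdims)
qed

end

section \<open>Independence of the rows of the degree-zero function\<close>

text \<open>
  The angles outside \<open>\<pi>\<int>\<close>, at which \<open>Q_poly\<close> is characterised.
\<close>

definition generic_angle :: "real \<Rightarrow> bool" where
  "generic_angle t \<longleftrightarrow> (\<forall>m::int. t \<noteq> of_int m * pi)"

text \<open>
  The cosine is injective on \<open>(0, \<pi>)\<close>, so the values at generic angles form an infinite set.
\<close>

lemma poly_eq_if_eq_at_cos:
  fixes p q :: "complex poly"
  assumes "\<And>t. generic_angle t \<Longrightarrow> poly p (complex_of_real (cos t)) = poly q (complex_of_real (cos t))"
  shows "p = q"
proof (rule ccontr)
  assume "p \<noteq> q"
  then have "finite {x. poly (p - q) x = 0}" by (intro poly_roots_finite) simp
  moreover have "(\<lambda>t. complex_of_real (cos t)) ` {0<..<pi} \<subseteq> {x. poly (p - q) x = 0}"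
  proof safe
    fix t assume t: "t \<in> {0<..<pi}"
    have "generic_angle t"
      unfolding generic_angle_def
    proof (intro allI notI)
      fix m :: int assume m: "t = of_int m * pi"
      have "0 * pi < of_int m * pi" "of_int m * pi < 1 * pi" using t m by auto
      then have "0 < real_of_int m" "real_of_int m < 1"
        by (simp_all only: mult_less_cancel_right_pos pi_gt_zero)
      then show False by auto
    qed
    then show "poly (p - q) (complex_of_real (cos t)) = 0" using assms by simp
  qed
  ultimately have "finite ((\<lambda>t. complex_of_real (cos t)) ` {0<..<pi})"
    by (rule finite_subset[rotated])
  moreover have "inj_on (\<lambda>t. complex_of_real (cos t)) {0<..<pi}"
    by (rule inj_onI) (auto intro: cos_inj_pi)
  ultimately have "finite {0<..<pi}" by (rule finite_imageD)
  then show False using infinite_Ioo[of 0 pi] by simp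
qed

text \<open>
  Dividing by \<open>(1 + z v)\<^sup>N\<close> turns the sum into the polynomial with coefficients \<open>w\<close>
  evaluated at \<open>x = (1 + z u) / (1 + z v)\<close>. As \<open>u \<noteq> v\<close>, this is a nondegenerate
  Moebius transformation of \<open>z\<close>, so infinitely many \<open>x\<close> are roots.
\<close>

lemma homogeneous_powers_independent:
  fixes u v :: complex
  assumes uv: "u \<noteq> v" and z: "\<And>z. (\<Sum>r\<le>N. w r * ((1 + z * u) ^ r * (1 + z * v) ^ (N - r))) = 0"
    and r: "r \<le> N"
  shows "w r = 0"
proof -
  define p where "p = (\<Sum>r\<le>N. monom (w r) r)"
  have p: "poly p x = (\<Sum>r\<le>N. w r * x ^ r)" for x
    by (simp add: p_def poly_sum poly_monom)
  have "poly p x = 0" if x: "u - x * v \<noteq> 0" for x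
  proof -
    \<comment> \<open>The inverse Moebius transformation.\<close>
    define z where "z = (x - 1) / (u - x * v)"
    have V: "1 + z * v = (u - v) / (u - x * v)" and U: "1 + z * u = x * (1 + z * v)"
      using x by (auto simp: z_def field_simps)
    then have V0: "1 + z * v \<noteq> 0" using uv x by simp
    have "0 = (\<Sum>r\<le>N. w r * ((1 + z * u) ^ r * (1 + z * v) ^ (N - r)))" using assms(2) by simp
    also have "\<dots> = (\<Sum>r\<le>N. w r * x ^ r * (1 + z * v) ^ N)"
    proof (rule sum.cong[OF refl])
      fix r assume "r \<in> {..N}"
      then have "(1 + z * v) ^ r * (1 + z * v) ^ (N - r) = (1 + z * v) ^ N"
        by (simp flip: power_add)
      then show "w r * ((1 + z * u) ^ r * (1 + z * v) ^ (N - r)) = w r * x ^ r * (1 + z * v) ^ N"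
        unfolding U power_mult_distrib by (simp only: mult_ac)
    qed
    also have "\<dots> = poly p x * (1 + z * v) ^ N"
      unfolding p sum_distrib_right ..
    finally show ?thesis using V0 by simp
  qed
  then have "UNIV - {x. poly [:u, -v:] x = 0} \<subseteq> {x. poly p x = 0}"
    by (auto simp: algebra_simps)
  moreover have "[:u, -v:] \<noteq> 0" using uv by auto
  then have "infinite (UNIV - {x. poly [:u, -v:] x = 0})"
    by (intro Diff_infinite_finite poly_roots_finite infinite_UNIV_char_0)
  ultimately have "infinite {x. poly p x = 0}" by (metis finite_subset)
  then have "p = 0" using poly_roots_finite by blast
  then have "coeff p r = 0" by simp
  moreover have "coeff p r = (\<Sum>i\<le>N. if i = r then w i else 0)"
    unfolding p_def by (simp add: coeff_sum)
  ultimately show ?thesis using r by simp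
qed

context half_integral_spin
begin

text \<open>
  For \<open>l = l1 + l2\<close> the bracket \<open>1 - X Y\<close> does not occur (\<open>a = 0\<close>), and the bracket coefficient is a product of two
  binomial coefficients, one power of which cancels against the factorials.
\<close>

lemma CG_square_top:
  assumes r: "r \<le> N" and s: "s \<le> N" and k: "k \<le> r" and m: "m \<le> N - r" "k + m = s"
  shows "(CG (real r / 2) (real (N - r) / 2) l (real k - real r / 2) (real m - real (N - r) / 2) (wt l s))\<^sup>2
     = fact s * fact (N - s) / fact N * (real (r choose k) * real ((N - r) choose m))"
proof -
  have e: "real r / 2 = real (0 + r) / 2" "real (N - r) / 2 = real (0 + (N - r)) / 2" "l = real (r + (N - r)) / 2"
    using spin r by auto
  have C: "CG (real r / 2) (real (N - r) / 2) l (real k - real r / 2) (real m - real (N - r) / 2) (wt l s)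
      = cg 0 r (N - r) (int (r - k)) (int m)"
    by (rule CG_eq_cg[OF e]) (use assms spin in \<open>auto simp: wt_def of_nat_diff field_simps\<close>)
  have B: "bracket_coeff 0 r (N - r) (int (r - k)) (int m) = real (r choose k) * real ((N - r) choose m)"
    using binomial_symmetric[OF k] by (simp add: binom_int_def)
  have I: "int r - int (r - k) + int m = int s" "int (N - r) + int (r - k) - int m = int (N - s)"
    "int (0 + r) - int (r - k) = int k" "int (0 + (N - r)) - int m = int (N - r - m)"
    using assms by (auto simp: of_nat_diff)
  have R: "r + (N - r) = N" "0 + r + (N - r) + 1 = Suc N" using r by auto
  have b: "real (r choose k) = fact r / (fact k * fact (r - k))"
    "real ((N - r) choose m) = fact (N - r) / (fact m * fact (N - r - m))"
    by (rule binomial_fact[OF k], rule binomial_fact[OF m(1)])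
  have "(cg 0 r (N - r) (int (r - k)) (int m))\<^sup>2
      = real (N + 1) / (fact 0 * fact r * fact (N - r) * fact (Suc N))
        * (fact s * fact (N - s) * (fact (r - k) * fact k * fact m * fact (N - r - m)))
        * (real (r choose k) * real ((N - r) choose m))\<^sup>2"
    unfolding cg_expand B I R ifact_def nat_int power_mult_distrib
    by (subst (1 2) real_sqrt_pow2) (simp_all del: fact_Suc)
  also have "\<dots> = fact s * fact (N - s) / fact N * (real (r choose k) * real ((N - r) choose m))"
  proof -
    \<comment> \<open>All factorials as atoms, so that only the cancellation is left.\<close>
    have cancel: "n / (1 * A * B * (n * E)) * (S * T * (C * D * F * G)) * (A / (D * C) * (B / (F * G)))\<^sup>2
        = S * T / E * (A / (D * C) * (B / (F * G)))"
      if "n > 0" "A > 0" "B > 0" "C > 0" "D > 0" "E > 0" "F > 0" "G > 0"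
      for n A B C D E F G S T :: real
      using that by (simp add: power2_eq_square field_simps)
    have f: "fact (Suc N) = real (N + 1) * fact N" by simp
    show ?thesis unfolding b f fact_0 by (rule cancel) simp_all
  qed
  finally show ?thesis unfolding C .
qed

lemma full_Phi_0_index:
  assumes r: "r \<le> N" and s: "s \<le> N"
  shows "full_Phi l 0 (a_elt t) $$ (r, s)
    = of_real (fact s * fact (N - s) / fact N) * cis ((real r - real N / 2) * t)
      * (\<Sum>k\<le>r. \<Sum>m\<le>N - r. if k + m = s then of_real (real (r choose k) * real ((N - r) choose m)) * (cis (-t) ^ k * cis t ^ m) else 0)"
proof -
  let ?l1 = "real r / 2" and ?l2 = "real (N - r) / 2"
  have d: "2 * ?l1 = real r" "2 * ?l2 = real (N - r)" by auto
  have "full_Phi l 0 (a_elt t) $$ (r, s) = spherical_entry l ?l1 ?l2 (wt l s) t"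
    using full_Phi_index[OF spin r s, of 0 t] by simp
  also have "\<dots> = (\<Sum>k\<le>r. \<Sum>m\<le>N - r. cis (((real m - ?l2) - (real k - ?l1)) * t)
      * of_real ((CG ?l1 ?l2 l (real k - ?l1) (real m - ?l2) (wt l s))\<^sup>2))"
    unfolding spherical_entry_def sum_weights_wt[OF d(1)] sum_weights_wt[OF d(2)] wt_def lessThan_Suc_atMost ..
  also have "\<dots> = (\<Sum>k\<le>r. \<Sum>m\<le>N - r. of_real (fact s * fact (N - s) / fact N) * cis ((real r - real N / 2) * t)
      * (if k + m = s then of_real (real (r choose k) * real ((N - r) choose m)) * (cis (-t) ^ k * cis t ^ m) else 0))"
  proof (intro sum.cong refl)
    fix k m assume km: "k \<in> {..r}" "m \<in> {..N - r}"
    show "cis (((real m - ?l2) - (real k - ?l1)) * t)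
      * of_real ((CG ?l1 ?l2 l (real k - ?l1) (real m - ?l2) (wt l s))\<^sup>2)
      = of_real (fact s * fact (N - s) / fact N) * cis ((real r - real N / 2) * t)
      * (if k + m = s then of_real (real (r choose k) * real ((N - r) choose m)) * (cis (-t) ^ k * cis t ^ m) else 0)"
    proof (cases "k + m = s")
      case True
      have c: "cis (((real m - ?l2) - (real k - ?l1)) * t) = cis ((real r - real N / 2) * t) * (cis (-t) ^ k * cis t ^ m)"
        unfolding Complex.DeMoivre cis_mult using r
        by (intro arg_cong[where f = cis]) (simp add: of_nat_diff field_simps)
      have km: "k \<le> r" "m \<le> N - r" using km by auto
      show ?thesis unfolding c CG_square_top[OF r s km True] if_P[OF True] of_real_mult
        by (simp only: mult_ac)
    next
      case False
      have "wt l s = real s - l" by (simp add: wt_def)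
      then have "real k - ?l1 + (real m - ?l2) = wt l s \<longleftrightarrow> real (k + m) = real s"
        using spin r by (auto simp: of_nat_diff field_simps)
      then have "real k - ?l1 + (real m - ?l2) \<noteq> wt l s" using False by (simp only: of_nat_eq_iff) simp
      then show ?thesis using False by (simp add: CG_def)
    qed
  qed
  finally show ?thesis by (simp only: sum_distrib_left)
qed

text \<open>
  Read as a statement about the coefficients of \<open>z\<close>: after rescaling rows and columns by nonzero numbers, row
  \<open>r\<close> consists of the coefficients of a product of powers of the two linear forms
  \<open>1 + z e\<^sup>-\<^sup>i\<^sup>t\<close> and \<open>1 + z e\<^sup>i\<^sup>t\<close>.
\<close>

lemma full_Phi_0_generating_function:
  assumes r: "r \<le> N"
  shows "(\<Sum>s\<le>N. z ^ s * of_real (fact N / (fact s * fact (N - s))) * full_Phi l 0 (a_elt t) $$ (r, s))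
    = cis ((real r - real N / 2) * t) * ((1 + z * cis (-t)) ^ r * (1 + z * cis t) ^ (N - r))"
proof -
  let ?c = "cis ((real r - real N / 2) * t)"
  define g where "g k m = of_real (real (r choose k) * real ((N - r) choose m)) * (cis (-t) ^ k * cis t ^ m) * z ^ (k + m)" for k m
  have "(\<Sum>s\<le>N. z ^ s * of_real (fact N / (fact s * fact (N - s))) * full_Phi l 0 (a_elt t) $$ (r, s))
      = (\<Sum>s\<le>N. \<Sum>k\<le>r. \<Sum>m\<le>N - r. if k + m = s then ?c * g k m else 0)"
  proof (rule sum.cong[OF refl])
    fix s assume "s \<in> {..N}"
    then have s: "s \<le> N" by simp
    have "complex_of_real (fact N / (fact s * fact (N - s))) * of_real (fact s * fact (N - s) / fact N) = 1"
      by (simp only: of_real_mult [symmetric]) simp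
    moreover have "z ^ s * a * (b * ?c * X) = z ^ s * ?c * X" if "a * b = 1" for a b X :: complex
    proof -
      have "z ^ s * a * (b * ?c * X) = (a * b) * (z ^ s * ?c * X)" by (simp only: mult_ac)
      then show ?thesis using that by simp
    qed
    ultimately have "z ^ s * of_real (fact N / (fact s * fact (N - s))) * full_Phi l 0 (a_elt t) $$ (r, s)
      = z ^ s * ?c * (\<Sum>k\<le>r. \<Sum>m\<le>N - r. if k + m = s then of_real (real (r choose k) * real ((N - r) choose m)) * (cis (-t) ^ k * cis t ^ m) else 0)"
      unfolding full_Phi_0_index[OF r s] by blast
    also have "\<dots> = (\<Sum>k\<le>r. \<Sum>m\<le>N - r. if k + m = s then ?c * g k m else 0)"
      unfolding sum_distrib_left by (intro sum.cong refl) (auto simp: g_def mult_ac)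
    finally show "z ^ s * of_real (fact N / (fact s * fact (N - s))) * full_Phi l 0 (a_elt t) $$ (r, s)
      = (\<Sum>k\<le>r. \<Sum>m\<le>N - r. if k + m = s then ?c * g k m else 0)" .
  qed
  also have "\<dots> = (\<Sum>k\<le>r. \<Sum>m\<le>N - r. \<Sum>s\<le>N. if k + m = s then ?c * g k m else 0)"
    by (subst sum.swap) (intro sum.cong refl sum.swap)
  also have "\<dots> = (\<Sum>k\<le>r. \<Sum>m\<le>N - r. ?c * g k m)"
    by (intro sum.cong refl) (use r in auto)
  also have "\<dots> = ?c * ((\<Sum>k\<le>r. of_nat (r choose k) * (z * cis (-t)) ^ k) * (\<Sum>m\<le>N - r. of_nat ((N - r) choose m) * (z * cis t) ^ m))"
    unfolding sum_product unfolding sum_distrib_left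
    by (intro sum.cong refl) (simp add: g_def power_mult_distrib power_add mult_ac)
  also have "(\<Sum>k\<le>r. of_nat (r choose k) * (z * cis (-t)) ^ k) = (1 + z * cis (-t)) ^ r"
    using binomial_ring[of "z * cis (-t)" 1 r] by (simp add: add.commute)
  also have "(\<Sum>m\<le>N - r. of_nat ((N - r) choose m) * (z * cis t) ^ m) = (1 + z * cis t) ^ (N - r)"
    using binomial_ring[of "z * cis t" 1 "N - r"] by (simp add: add.commute)
  finally show ?thesis .
qed

lemma cis_minus_neq_cis:
  assumes "generic_angle t"
  shows "cis (-t) \<noteq> cis t"
proof
  assume "cis (-t) = cis t"
  then have "sin (-t) = sin t" by (metis cis.sel(2))
  then have "sin t = 0" by simp
  then obtain m :: int where "t = of_int m * pi" by (auto simp: sin_zero_iff_int2)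
  then show False using assms by (auto simp: generic_angle_def)
qed

text \<open>
  A linear relation between the rows is a linear relation between the products \<open>U\<^sup>r V\<^sup>N\<^sup>-\<^sup>r\<close> of the two linear
  forms, which are not proportional because \<open>e\<^sup>-\<^sup>i\<^sup>t \<noteq> e\<^sup>i\<^sup>t\<close>.
\<close>

lemma full_Phi_0_det:
  assumes t: "generic_angle t"
  shows "det (full_Phi l 0 (a_elt t)) \<noteq> 0"
proof
  let ?F = "full_Phi l 0 (a_elt t)"
  have F: "?F \<in> carrier_mat (Suc N) (Suc N)" using full_Phi_carrier[of l 0] dimH_eq[OF spin] by simp
  assume "det ?F = 0"
  then have "det (transpose_mat ?F) = 0" using det_transpose[OF F] by simp
  then obtain w where w: "w \<in> carrier_vec (Suc N)" "w \<noteq> 0\<^sub>v (Suc N)" "transpose_mat ?F *\<^sub>v w = 0\<^sub>v (Suc N)"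
    using det_0_iff_vec_prod_zero[of "transpose_mat ?F" "Suc N"] F by auto
  have col: "(\<Sum>r\<le>N. ?F $$ (r, s) * w $ r) = 0" if s: "s \<le> N" for s
  proof -
    have "(\<Sum>r\<le>N. ?F $$ (r, s) * w $ r) = (transpose_mat ?F *\<^sub>v w) $ s"
      using F w(1) s by (simp add: scalar_prod_def atMost_atLeast0 atLeastLessThanSuc_atLeastAtMost)
    then show ?thesis using w(3) s by simp
  qed
  define w' where "w' r = w $ r * cis ((real r - real N / 2) * t)" for r
  have "(\<Sum>r\<le>N. w' r * ((1 + z * cis (-t)) ^ r * (1 + z * cis t) ^ (N - r))) = 0" for z
  proof -
    have "(\<Sum>r\<le>N. w' r * ((1 + z * cis (-t)) ^ r * (1 + z * cis t) ^ (N - r)))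
        = (\<Sum>r\<le>N. w $ r * (\<Sum>s\<le>N. z ^ s * of_real (fact N / (fact s * fact (N - s))) * ?F $$ (r, s)))"
      by (rule sum.cong[OF refl]) (simp only: atMost_iff full_Phi_0_generating_function, simp only: w'_def mult.assoc)
    also have "\<dots> = (\<Sum>s\<le>N. z ^ s * of_real (fact N / (fact s * fact (N - s))) * (\<Sum>r\<le>N. ?F $$ (r, s) * w $ r))"
      unfolding sum_distrib_left by (subst sum.swap) (simp only: mult_ac)
    also have "\<dots> = 0" by (simp add: col)
    finally show ?thesis .
  qed
  then have "w' r = 0" if "r \<le> N" for r
    using homogeneous_powers_independent[OF cis_minus_neq_cis[OF t], where N = N and w = w' and r = r] that by blast
  then have "w $ r = 0" if "r < Suc N" for r using that by (auto simp: w'_def)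
  then have "w = 0\<^sub>v (Suc N)" using w(1) by (intro eq_vecI) auto
  then show False using w(2) by simp
qed

section \<open>Full spherical polynomials\<close>

text \<open>
  The value whose entries \<open>Q_poly\<close> interpolates at generic angles.
\<close>

definition Q_at :: "int \<Rightarrow> real \<Rightarrow> complex mat" where
  "Q_at d t = full_Phi l d (a_elt t) * the (mat_inverse (full_Phi l 0 (a_elt t)))"

lemma Phi_0_inverse:
  assumes t: "generic_angle t"
  shows "the (mat_inverse (full_Phi l 0 (a_elt t))) \<in> carrier_mat (Suc N) (Suc N)"
    and "Q_at 0 t = 1\<^sub>m (Suc N)"
proof -
  let ?F = "full_Phi l 0 (a_elt t)"
  have F: "?F \<in> carrier_mat (Suc N) (Suc N)" using full_Phi_carrier[of l 0] dimH_eq[OF spin] by simp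
  have "?F \<in> Units (ring_mat TYPE(complex) (Suc N) ())"
    by (rule det_non_zero_imp_unit[OF F full_Phi_0_det[OF t]])
  then have "mat_inverse ?F \<noteq> None" using mat_inverse(1)[OF F, of "()"] by blast
  then obtain M where M: "mat_inverse ?F = Some M" by blast
  then have "?F * M = 1\<^sub>m (Suc N)" "M \<in> carrier_mat (Suc N) (Suc N)" using mat_inverse(2)[OF F M] by auto
  then show "the (mat_inverse ?F) \<in> carrier_mat (Suc N) (Suc N)" "Q_at 0 t = 1\<^sub>m (Suc N)"
    by (auto simp: M Q_at_def)
qed

text \<open>
  The recurrence for \<open>full_Phi\<close> multiplied from the right by the inverse of the degree-zero function.
\<close>

lemma Q_at_recurrence:
  assumes t: "generic_angle t" and r: "r \<le> N" and s: "s \<le> N"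
  shows "of_real (cos t) * Q_at (int d) t $$ (r, s) = of_real (A_coef d r) * Q_at (int d + 1) t $$ (r, s)
     + ((if r < N then of_real (B_up d r) * Q_at (int d) t $$ (r + 1, s) else 0)
        + (if 0 < r then of_real (B_down d r) * Q_at (int d) t $$ (r - 1, s) else 0))
     + (if d > 0 then of_real (C_coef d r) * Q_at (int d - 1) t $$ (r, s) else 0)"
proof -
  define M where "M = the (mat_inverse (full_Phi l 0 (a_elt t)))"
  have M: "M \<in> carrier_mat (Suc N) (Suc N)" unfolding M_def by (rule Phi_0_inverse(1)[OF t])
  note c = full_Phi_carrier[of l, unfolded dimH_eq[OF spin]]
  have idx: "Q_at d' t $$ (r', s) = (\<Sum>k<Suc N. full_Phi l d' (a_elt t) $$ (r', k) * M $$ (k, s))" if "r' \<le> N" for d' r'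
    unfolding Q_at_def M_def[symmetric]
    by (rule mult_mat_index_sum[OF c M]) (use that s in auto)
  have "of_real (cos t) * Q_at (int d) t $$ (r, s)
      = (\<Sum>k<Suc N. (of_real (cos t) * full_Phi l (int d) (a_elt t) $$ (r, k)) * M $$ (k, s))"
    unfolding idx[OF r] sum_distrib_left by (simp only: mult.assoc)
  also have "\<dots> = (\<Sum>k<Suc N. (of_real (A_coef d r) * full_Phi l (int d + 1) (a_elt t) $$ (r, k)
     + ((if r < N then of_real (B_up d r) * full_Phi l (int d) (a_elt t) $$ (r + 1, k) else 0)
        + (if 0 < r then of_real (B_down d r) * full_Phi l (int d) (a_elt t) $$ (r - 1, k) else 0))
     + (if d > 0 then of_real (C_coef d r) * full_Phi l (int d - 1) (a_elt t) $$ (r, k) else 0)) * M $$ (k, s))"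
    by (rule sum.cong[OF refl], subst full_Phi_recurrence_index) (use r in auto)
  also have "\<dots> = of_real (A_coef d r) * Q_at (int d + 1) t $$ (r, s)
     + ((if r < N then of_real (B_up d r) * Q_at (int d) t $$ (r + 1, s) else 0)
        + (if 0 < r then of_real (B_down d r) * Q_at (int d) t $$ (r - 1, s) else 0))
     + (if d > 0 then of_real (C_coef d r) * Q_at (int d - 1) t $$ (r, s) else 0)"
    using r by (simp add: idx sum_distrib_left sum.distrib distrib_right mult.assoc del: sum.lessThan_Suc)
  finally show ?thesis .
qed

text \<open>
  Because \<open>rec_A\<close> is diagonal with nonzero entries, the recurrence can be solved for degree \<open>d + 1\<close>, which
  exhibits its entries as polynomials in \<open>cos t\<close> once those of degrees \<open>d\<close> and \<open>d - 1\<close> are.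
\<close>

lemma Q_at_polynomial: "\<exists>P. \<forall>r\<le>N. \<forall>s\<le>N. \<forall>t. generic_angle t \<longrightarrow> poly (P r s) (complex_of_real (cos t)) = Q_at (int d) t $$ (r, s)"
proof (induction d rule: less_induct)
  case (less d)
  show ?case
  proof (cases d)
    case 0
    show ?thesis
      by (rule exI[of _ "\<lambda>r s. if r = s then 1 else 0"]) (simp add: 0 Phi_0_inverse(2))
  next
    case (Suc e)
    obtain P where P: "\<And>r s t. r \<le> N \<Longrightarrow> s \<le> N \<Longrightarrow> generic_angle t \<Longrightarrow> poly (P r s) (complex_of_real (cos t)) = Q_at (int e) t $$ (r, s)"
      using less.IH[of e] Suc by blast
    obtain P' where P': "\<And>r s t. 0 < e \<Longrightarrow> r \<le> N \<Longrightarrow> s \<le> N \<Longrightarrow> generic_angle t \<Longrightarrow> poly (P' r s) (complex_of_real (cos t)) = Q_at (int e - 1) t $$ (r, s)"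
    proof (cases "e = 0")
      case False
      then have "int e - 1 = int (e - 1)" "e - 1 < d" using Suc by auto
      then show ?thesis using less.IH[of "e - 1"] that by metis
    qed (use that in blast)
    define Q where "Q r s = smult (of_real (1 / A_coef e r)) ([:0, 1:] * P r s
       - ((if r < N then smult (of_real (B_up e r)) (P (r + 1) s) else 0)
          + (if 0 < r then smult (of_real (B_down e r)) (P (r - 1) s) else 0))
       - (if e > 0 then smult (of_real (C_coef e r)) (P' r s) else 0))" for r s
    have "poly (Q r s) (complex_of_real (cos t)) = Q_at (int d) t $$ (r, s)"
      if rs: "r \<le> N" "s \<le> N" and t: "generic_angle t" for r s t
    proof -
      have A: "A_coef e r \<noteq> 0" using A_coef_pos[OF rs(1), of e] by simp
      have "poly (Q r s) (complex_of_real (cos t)) = of_real (1 / A_coef e r) * (of_real (cos t) * Q_at (int e) t $$ (r, s)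
       - ((if r < N then of_real (B_up e r) * Q_at (int e) t $$ (r + 1, s) else 0)
          + (if 0 < r then of_real (B_down e r) * Q_at (int e) t $$ (r - 1, s) else 0))
       - (if e > 0 then of_real (C_coef e r) * Q_at (int e - 1) t $$ (r, s) else 0))"
        using rs t by (simp add: Q_def P P')
      also have "\<dots> = of_real (1 / A_coef e r) * (of_real (A_coef e r) * Q_at (int e + 1) t $$ (r, s))"
        unfolding Q_at_recurrence[OF t rs] by simp
      also have "\<dots> = Q_at (int d) t $$ (r, s)"
        using A by (simp add: Suc add.commute)
      finally show ?thesis .
    qed
    then show ?thesis by blast
  qed
qed

lemma Q_poly_eq:
  assumes "r \<le> N" "s \<le> N" "generic_angle t"
  shows "poly (Q_poly l (int d) r s) (complex_of_real (cos t)) = Q_at (int d) t $$ (r, s)"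
proof -
  obtain P where P: "\<And>t. generic_angle t \<Longrightarrow> poly P (complex_of_real (cos t)) = Q_at (int d) t $$ (r, s)"
    using Q_at_polynomial[of d] assms(1,2) by blast
  have "Q_poly l (int d) r s = P"
    unfolding Q_poly_def
  proof (rule the_equality)
    show "\<forall>t. (\<forall>m::int. t \<noteq> of_int m * pi) \<longrightarrow> poly P (complex_of_real (cos t)) =
       (full_Phi l (int d) (a_elt t) * the (mat_inverse (full_Phi l 0 (a_elt t)))) $$ (r, s)"
      using P by (auto simp: generic_angle_def Q_at_def)
  next
    fix P' assume "\<forall>t. (\<forall>m::int. t \<noteq> of_int m * pi) \<longrightarrow> poly P' (complex_of_real (cos t)) =
       (full_Phi l (int d) (a_elt t) * the (mat_inverse (full_Phi l 0 (a_elt t)))) $$ (r, s)"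
    then show "P' = P"
      by (intro poly_eq_if_eq_at_cos) (use P in \<open>auto simp: generic_angle_def Q_at_def\<close>)
  qed
  then show ?thesis using P assms(3) by simp
qed

text \<open>
  Both sides agree at the cosines of all generic angles and are therefore equal as polynomials; so the
  recurrence extends to the angles at which the degree-zero function is singular.
\<close>

lemma Q_poly_recurrence:
  assumes r: "r \<le> N" and s: "s \<le> N"
  shows "[:0, 1:] * Q_poly l (int d) r s = smult (of_real (A_coef d r)) (Q_poly l (int d + 1) r s)
     + ((if r < N then smult (of_real (B_up d r)) (Q_poly l (int d) (r + 1) s) else 0)
        + (if 0 < r then smult (of_real (B_down d r)) (Q_poly l (int d) (r - 1) s) else 0))
     + (if d > 0 then smult (of_real (C_coef d r)) (Q_poly l (int d - 1) r s) else 0)"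
proof (rule poly_eq_if_eq_at_cos)
  fix t assume t: "generic_angle t"
  have up: "poly (Q_poly l (int d + 1) r s) (of_real (cos t)) = Q_at (int d + 1) t $$ (r, s)"
    using Q_poly_eq[OF r s t, of "d + 1"] by (simp add: add.commute)
  have down: "poly (Q_poly l (int d - 1) r s) (of_real (cos t)) = Q_at (int d - 1) t $$ (r, s)" if "d > 0"
    using Q_poly_eq[OF r s t, of "d - 1"] that by (simp add: of_nat_diff)
  have terms: "poly (if r < N then smult (of_real (B_up d r)) (Q_poly l (int d) (r + 1) s) else 0) (of_real (cos t))
      = (if r < N then of_real (B_up d r) * Q_at (int d) t $$ (r + 1, s) else 0)"
    "poly (if 0 < r then smult (of_real (B_down d r)) (Q_poly l (int d) (r - 1) s) else 0) (of_real (cos t))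
      = (if 0 < r then of_real (B_down d r) * Q_at (int d) t $$ (r - 1, s) else 0)"
    "poly (if d > 0 then smult (of_real (C_coef d r)) (Q_poly l (int d - 1) r s) else 0) (of_real (cos t))
      = (if d > 0 then of_real (C_coef d r) * Q_at (int d - 1) t $$ (r, s) else 0)"
    using r s t Q_poly_eq[of "r + 1" s t d] Q_poly_eq[of "r - 1" s t d] down by auto
  have "poly ([:0, 1:] * Q_poly l (int d) r s) (complex_of_real (cos t)) = of_real (cos t) * Q_at (int d) t $$ (r, s)"
    using Q_poly_eq[OF r s t, of d] by simp
  then show "poly ([:0, 1:] * Q_poly l (int d) r s) (complex_of_real (cos t))
    = poly (smult (of_real (A_coef d r)) (Q_poly l (int d + 1) r s)
     + ((if r < N then smult (of_real (B_up d r)) (Q_poly l (int d) (r + 1) s) else 0)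
        + (if 0 < r then smult (of_real (B_down d r)) (Q_poly l (int d) (r - 1) s) else 0))
     + (if d > 0 then smult (of_real (C_coef d r)) (Q_poly l (int d - 1) r s) else 0)) (complex_of_real (cos t))"
    unfolding poly_add poly_smult up terms by (simp only: Q_at_recurrence[OF t r s])
qed

lemma full_Q_carrier: "full_Q l d a \<in> carrier_mat (Suc N) (Suc N)"
  by (simp add: full_Q_def dimH_eq[OF spin])

lemma full_Q_index:
  assumes "r \<le> N" "s \<le> N" "0 \<le> d"
  shows "full_Q l d a $$ (r, s) = poly (Q_poly l d r s) (complex_of_real (cos (angle a)))"
  using assms by (simp add: full_Q_def dimH_eq[OF spin])

lemma full_Q_recurrence:
  "complex_of_real (cos (angle a)) \<cdot>\<^sub>m full_Q l (int d) a =
     cmat (rec_A l d) * full_Q l (int d + 1) a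
     + cmat (rec_B l d) * full_Q l (int d) a
     + cmat (rec_C l d) * full_Q l (int d - 1) a" (is "_ = ?rhs")
proof (rule eq_matI)
  note c = full_Q_carrier
  have dims: "dim_row (full_Q l d' a) = Suc N" "dim_col (full_Q l d' a) = Suc N" for d' a
    using c[of d' a] by auto
  have rdims: "dim_row (rec_A l d) = Suc N" "dim_row (rec_B l d) = Suc N" "dim_row (rec_C l d) = Suc N"
    using rec_carrier[of d] by auto
  show "dim_row (complex_of_real (cos (angle a)) \<cdot>\<^sub>m full_Q l (int d) a) = dim_row ?rhs"
    "dim_col (complex_of_real (cos (angle a)) \<cdot>\<^sub>m full_Q l (int d) a) = dim_col ?rhs"
    by (simp_all add: dims rdims)
  fix r s
  assume "r < dim_row ?rhs" "s < dim_col ?rhs"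
  then have rs: "r \<le> N" "s \<le> N" "r < Suc N" "s < Suc N" by (auto simp: dims rdims)
  let ?x = "complex_of_real (cos (angle a))"
  have "(?x \<cdot>\<^sub>m full_Q l (int d) a) $$ (r, s) = poly ([:0, 1:] * Q_poly l (int d) r s) ?x"
    using rs by (simp add: dims full_Q_index)
  also have "\<dots> = (cmat (rec_A l d) * full_Q l (int d + 1) a) $$ (r, s)
     + (cmat (rec_B l d) * full_Q l (int d) a) $$ (r, s)
     + (cmat (rec_C l d) * full_Q l (int d - 1) a) $$ (r, s)"
    unfolding rec_mult_index[OF c rs(1,4)] Q_poly_recurrence[OF rs(1,2)]
    using rs by (simp add: full_Q_index)
  finally show "(?x \<cdot>\<^sub>m full_Q l (int d) a) $$ (r, s) = ?rhs $$ (r, s)"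
    using rs by (simp add: dims rdims)
qed

end

section \<open>The recurrences on the whole torus\<close>

text \<open>
  On \<open>[0, 4\<pi>)\<close> the first diagonal entry \<open>e\<^sup>i\<^sup>t\<^sup>/\<^sup>2\<close> determines \<open>t\<close>.
\<close>

lemma angle_a_elt:
  assumes t: "0 \<le> t" "t < 4 * pi"
  shows "angle (a_elt t) = t"
  unfolding angle_def
proof (rule the_equality)
  show "0 \<le> t \<and> t < 4 * pi \<and> a_elt t = a_elt t" using t by simp
  fix u assume u: "0 \<le> u \<and> u < 4 * pi \<and> a_elt t = a_elt u"
  then have "m_elt t $$ (0, 0) = m_elt u $$ (0, 0)" by (simp add: a_elt_def)
  then have c: "cis (t / 2) = cis (u / 2)" by (simp add: m_elt_def)
  then have "sin (t / 2) = sin (u / 2) \<and> cos (t / 2) = cos (u / 2)"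
    by (metis cis.sel)
  then obtain n :: int where n: "t / 2 = u / 2 + 2 * pi * of_int n"
    unfolding sin_cos_eq_iff by (auto simp: mult_ac)
  have "\<bar>t / 2 - u / 2\<bar> < 2 * pi" using t u by auto
  then have "2 * pi * \<bar>real_of_int n\<bar> < 2 * pi * 1"
    using n by (simp add: abs_mult)
  then have "\<bar>real_of_int n\<bar> < 1"
    using mult_less_cancel_left_pos[of "2 * pi" "\<bar>real_of_int n\<bar>" 1] by simp
  then have "n = 0" by linarith
  then show "u = t" using n by simp
qed

theorem theorem4p8:
  fixes l :: real
  assumes "2 * l \<in> \<nat>"
  shows "(\<forall>d::nat. \<forall>a\<in>A_star.
            phi a \<cdot>\<^sub>m full_Phi l (int d) a =
              cmat (rec_A l d) * full_Phi l (int d + 1) a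
              + cmat (rec_B l d) * full_Phi l (int d) a
              + cmat (rec_C l d) * full_Phi l (int d - 1) a)
       \<and> (\<forall>d::nat. \<forall>a\<in>A_star.
            phi a \<cdot>\<^sub>m full_Q l (int d) a =
              cmat (rec_A l d) * full_Q l (int d + 1) a
              + cmat (rec_B l d) * full_Q l (int d) a
              + cmat (rec_C l d) * full_Q l (int d - 1) a)
       \<and> (\<forall>d::nat. rec_A l d \<in> GL_real (nat \<lfloor>2 * l\<rfloor> + 1))"
proof -
  from assms obtain N where N: "2 * l = real N" by (rule Nats_cases)
  interpret half_integral_spin l N by unfold_locales (rule N)
  have size: "nat \<lfloor>2 * l\<rfloor> + 1 = Suc N" using N by simp
  show ?thesis
  proof (intro conjI allI ballI)
    fix d :: nat and a assume "a \<in> A_star"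
    then obtain t where t: "0 \<le> t" "t < 4 * pi" "a = a_elt t" by (auto simp: A_star_def)
    show "phi a \<cdot>\<^sub>m full_Phi l (int d) a =
              cmat (rec_A l d) * full_Phi l (int d + 1) a
              + cmat (rec_B l d) * full_Phi l (int d) a
              + cmat (rec_C l d) * full_Phi l (int d - 1) a"
      unfolding t(3) phi_a_elt by (rule full_Phi_recurrence)
    have "phi a = complex_of_real (cos (angle a))"
      unfolding t(3) angle_a_elt[OF t(1,2)] by (rule phi_a_elt)
    then show "phi a \<cdot>\<^sub>m full_Q l (int d) a =
              cmat (rec_A l d) * full_Q l (int d + 1) a
              + cmat (rec_B l d) * full_Q l (int d) a
              + cmat (rec_C l d) * full_Q l (int d - 1) a"
      by (simp only: full_Q_recurrence)
  next
    fix d :: nat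
    show "rec_A l d \<in> GL_real (nat \<lfloor>2 * l\<rfloor> + 1)"
      unfolding size by (rule rec_A_GL)
  qed
qed

end
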